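(* For every $n\ge 1$, the set of USOs of the $n$-dimensional hypercube that are associated with simple extensions of cyclic-P-matroids on $E_{2n}$ is exactly the set of realizable Matoušek-type USOs of the $n$-dimensional hypercube.
   Context: Hypercube orientations and USOs. Let $n\ge 1$, $[n]=\{1,\dots,n\}$, let $P([n])$ be its power set, and let $\oplus$ denote symmetric difference. An orientation of the $n$-dimensional hypercube is a function $o:P([n])\to P([n])$ (assigning each vertex its outmap) such that for all $v\in P([n])$ and $d\in[n]$: $d\in o(v)$ iff $d\notin o(v\oplus\{d\})$. It is a unique sink orientation (USO) if each face (subcube) $F$, spanned by a set of dimensions $D_F\subseteq[n]$, contains exactly one vertex $v$ with $o(v)\cap D_F=\emptyset$. Two orientations $o,o'$ are isomorphic if there are $F\subseteq[n]$ and a permutation $\pi$ of $[n]$ with $\pi(o(v))=o'(\pi(v\oplus F))$ for all $v\in P([n])$. Matoušek USOs. Let $G=([n],E)$ be a directed graph with a loop $(d,d)\in E$ for every $d\in[n]$ and no other directed cycles. The Matoušek USO with dimension influence graph $G$ is the unique orientation $m$ with $m(\emptyset)=\emptyset$ such that for all $d,d'\in[n]$ and all $v\in P([n])$: exactly one of $d'\in m(v)$, $d'\in m(v\oplus\{d\})$ holds if and only if $(d,d')\in E$. A Matoušek-type USO is a USO isomorphic to a Matoušek USO. Realizability. A P-matrix is a real square matrix all of whose principal minors are positive. Given a P-matrix $M\in\mathbb{R}^{n\times n}$ and $q\in\mathbb{R}^n$, a candidate solution is a pair $(w,z)\in\mathbb{R}^n\times\mathbb{R}^n$ with $w-Mz=q$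 and, for every $i$, $w_i=0$ or $z_i=0$. For every $B\subseteq[n]$ there is a unique candidate solution with $w_i=0$ for $i\in B$ and $z_i=0$ for $i\notin B$; $(M,q)$ is non-degenerate if in none of these is there an $i$ with $w_i=z_i=0$. A non-degenerate $(M,q)$ realizes the USO $o$ where $o(B)$ is the set of $i$ with $w_i,z_i\le 0$ in the candidate solution corresponding to $B$. A USO is realizable if it is realized by some non-degenerate $(M,q)$. Oriented matroids. Oriented matroids are given by their collection $\mathcal{C}$ of signed circuits $C=(C^+,C^-)$, with support $\underline{C}=C^+\cup C^-$. For a basis $B$ and an element $e\notin B$, the fundamental circuit $C(B,e)$ is the unique circuit with $e\in C(B,e)^+$ and support contained in $B\cup\{e\}$. For $F$ a subset of the ground set, ${}_{-F}\mathcal{M}$ is obtained by flipping the sign of all elements of $F$ in all circuits; for a permutation $\pi$, $\pi\cdot\mathcal{M}$ is obtained by relabeling all elements by $\pi$ in all circuits. The alternating matroid $\mathcal{A}^{N,r}$ on a linearly ordered ground set of $N$ elements is the rank-$r$ oriented matroid realized by the vectors $(1,x_i,x_i^2,\dots,x_i^{r-1})$ with $x_1<\dots<x_N$ (listed in the ground set order); it is uniform, and the circuits are the signed sets with support of size $r+1$ whose signs alternate along the order. P-matroids. Let $E_{2n}=[2n]$; the elements $i$ and $i+n$ ($i\in[n]$) are complementary, written $\overline{i}=i+n$ and $\overline{i+n}=i$. A P-matroid is an oriented matroid on $E_{2n}$ for which $[n]$ is a basis (and every set of $n$ elements without a complementary pair is a basis), and which has no circuit $C$ such that $\underline{C}$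 contains exactly one complementary pair $\{e,\overline{e}\}$ and $e,\overline{e}$ have different signs in $C$. A cyclic-P-matroid is a P-matroid $\mathcal{M}$ with $\pi\cdot({}_{-F}\mathcal{M})=\mathcal{A}^{2n,n}$ for some permutation $\pi$ of $E_{2n}$ and some $F\subseteq E_{2n}$. Simple extensions. A simple extension of a cyclic-P-matroid is an oriented matroid $\hat{\mathcal{M}}$ on $\hat{E}_{2n}=E_{2n}\cup\{q\}$ with $\pi\cdot({}_{-F}\hat{\mathcal{M}})=\mathcal{A}^{2n+1,n}$ for some permutation $\pi$ of $\hat{E}_{2n}$ with $\pi(q)=q$ and some $F\subseteq\hat{E}_{2n}$, where the ground set of $\mathcal{A}^{2n+1,n}$ is $E_{2n}\cup\{q\}$, linearly ordered by $1<2<\dots<2n$ with $q$ inserted at some (arbitrary) position, and such that $\pi$ and $F$ restricted to $E_{2n}$ are such that the restricted oriented matroid is a cyclic-P-matroid; equivalently: (i) for all $e\in E_{2n}$ with $\pi(e)<\pi(\overline{e})$ and all $f\in E_{2n}$, $\pi(f)\in[\pi(e),\pi(\overline{e})]\Leftrightarrow\pi(\overline{f})\in[\pi(e),\pi(\overline{e})]$ (positions in $[2n]$), and (ii) for every $e\in E_{2n}$, exactly one of $e,\overline{e}$ is in $F$ if $\frac{|\pi(e)-\pi(\overline{e})|-1}{2}$ is even, and both or none are in $F$ otherwise. The USO $u$ associated with $\hat{\mathcal{M}}$ is defined as follows: for $v\in P([n])$ let $C_v=C(\{i: i\in[n]\setminus v\}\cup\{i+n: i\in v\},\,q)$; then $i\in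 u(v)$ iff $i\in C_v^-$ or $i+n\in C_v^-$. *)

theory Defs
  imports
    "HOL-Library.FuncSet"
    "HOL-Combinatorics.Permutations"
    "Jordan_Normal_Form.Determinant"
    "Jordan_Normal_Form.DL_Submatrix"
begin

text \<open>
  Everything is indexed from 0: the dimension set \<open>[n]\<close> is \<open>{..<n}\<close>, so that it agrees with the
  index range of vectors and matrices of \<^theory>\<open>Jordan_Normal_Form.Matrix\<close>. The ground set
  \<open>E\<^sub>2\<^sub>n\<close> is \<open>{..<2 * n}\<close>, in which \<open>i\<close> and \<open>i + n\<close> (\<open>i < n\<close>) are complementary, and the extension
  element \<open>q\<close> is the fresh number \<open>2 * n\<close>, of which only the distinctness from \<open>E\<^sub>2\<^sub>n\<close> is used.
\<close>

section \<open>Hypercube orientations and unique sink orientations\<close>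

text \<open>
  Outmap functions live on \<open>Pow {..<n}\<close>; extensionality makes equality of orientations the same as
  equality of HOL functions.
\<close>

definition cube_orientation :: "nat \<Rightarrow> (nat set \<Rightarrow> nat set) \<Rightarrow> bool" where
  "cube_orientation n s \<longleftrightarrow>
     s \<in> Pow {..<n} \<rightarrow>\<^sub>E Pow {..<n} \<and>
     (\<forall>v \<in> Pow {..<n}. \<forall>d < n. d \<in> s v \<longleftrightarrow> d \<notin> s (sym_diff v {d}))"

definition cube_face :: "nat set \<Rightarrow> nat set \<Rightarrow> nat set set" where
  "cube_face v D = {sym_diff v X | X. X \<subseteq> D}"

definition USO :: "nat \<Rightarrow> (nat set \<Rightarrow> nat set) \<Rightarrow> bool" where
  "USO n s \<longleftrightarrow>
     cube_orientation n s \<and>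
     (\<forall>D \<in> Pow {..<n}. \<forall>v \<in> Pow {..<n}. \<exists>!x. x \<in> cube_face v D \<and> s x \<inter> D = {})"

definition isomorphic_orientations ::
    "nat \<Rightarrow> (nat set \<Rightarrow> nat set) \<Rightarrow> (nat set \<Rightarrow> nat set) \<Rightarrow> bool" where
  "isomorphic_orientations n s s' \<longleftrightarrow>
     (\<exists>F p. F \<subseteq> {..<n} \<and> p permutes {..<n} \<and>
        (\<forall>v \<in> Pow {..<n}. p ` s v = s' (p ` (sym_diff v F))))"

section \<open>Matousek-type USOs\<close>

definition influence_graph :: "nat \<Rightarrow> (nat \<times> nat) set \<Rightarrow> bool" where
  "influence_graph n G \<longleftrightarrow>
     G \<subseteq> {..<n} \<times> {..<n} \<and> (\<forall>d < n. (d, d) \<in> G) \<and> acyclic (G - Id)"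

definition matousek_USO :: "nat \<Rightarrow> (nat \<times> nat) set \<Rightarrow> (nat set \<Rightarrow> nat set) \<Rightarrow> bool" where
  "matousek_USO n G m \<longleftrightarrow>
     cube_orientation n m \<and> m {} = {} \<and>
     (\<forall>d < n. \<forall>d' < n. \<forall>v \<in> Pow {..<n}.
        (d' \<in> m v) \<noteq> (d' \<in> m (sym_diff v {d})) \<longleftrightarrow> (d, d') \<in> G)"

definition matousek_type_USO :: "nat \<Rightarrow> (nat set \<Rightarrow> nat set) \<Rightarrow> bool" where
  "matousek_type_USO n s \<longleftrightarrow>
     USO n s \<and>
     (\<exists>G m. influence_graph n G \<and> matousek_USO n G m \<and> isomorphic_orientations n s m)"

section \<open>Realizability by P-matrix linear complementarity problems\<close>

definition P_matrix :: "nat \<Rightarrow> real mat \<Rightarrow> bool" where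
  "P_matrix n M \<longleftrightarrow>
     M \<in> carrier_mat n n \<and> (\<forall>S. S \<subseteq> {..<n} \<and> S \<noteq> {} \<longrightarrow> det (submatrix M S S) > 0)"

definition candidate_solution ::
    "nat \<Rightarrow> real mat \<Rightarrow> real vec \<Rightarrow> nat set \<Rightarrow> real vec \<Rightarrow> real vec \<Rightarrow> bool" where
  "candidate_solution n M q B w z \<longleftrightarrow>
     w \<in> carrier_vec n \<and> z \<in> carrier_vec n \<and> w - M *\<^sub>v z = q \<and>
     (\<forall>i < n. (i \<in> B \<longrightarrow> w $ i = 0) \<and> (i \<notin> B \<longrightarrow> z $ i = 0))"

definition nondegenerate :: "nat \<Rightarrow> real mat \<Rightarrow> real vec \<Rightarrow> bool" where
  "nondegenerate n M q \<longleftrightarrow>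
     (\<forall>B \<in> Pow {..<n}. \<forall>w z. candidate_solution n M q B w z \<longrightarrow>
        \<not> (\<exists>i < n. w $ i = 0 \<and> z $ i = 0))"

definition realizes :: "nat \<Rightarrow> real mat \<Rightarrow> real vec \<Rightarrow> (nat set \<Rightarrow> nat set) \<Rightarrow> bool" where
  "realizes n M q s \<longleftrightarrow>
     (\<forall>B \<in> Pow {..<n}. \<exists>w z. candidate_solution n M q B w z \<and>
        s B = {i. i < n \<and> w $ i \<le> 0 \<and> z $ i \<le> 0})"

definition realizable_USO :: "nat \<Rightarrow> (nat set \<Rightarrow> nat set) \<Rightarrow> bool" where
  "realizable_USO n s \<longleftrightarrow>
     USO n s \<and>
     (\<exists>M q. P_matrix n M \<and> q \<in> carrier_vec n \<and> nondegenerate n M q \<and> realizes n M q s)"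

section \<open>Oriented matroids, given by their signed circuits\<close>

text \<open>The signed set \<open>(C\<^sup>+, C\<^sup>-)\<close> is a pair of sets; an oriented matroid is its set of circuits.\<close>

type_synonym 'a signed_set = "'a set \<times> 'a set"

definition supp :: "'a signed_set \<Rightarrow> 'a set" where
  "supp C = fst C \<union> snd C"

definition oriented_matroid :: "'a set \<Rightarrow> 'a signed_set set \<Rightarrow> bool" where
  "oriented_matroid E \<C> \<longleftrightarrow>
     finite E \<and>
     (\<forall>X \<in> \<C>. supp X \<subseteq> E \<and> fst X \<inter> snd X = {}) \<and>
     ({}, {}) \<notin> \<C> \<and>
     (\<forall>X \<in> \<C>. prod.swap X \<in> \<C>) \<and>
     (\<forall>X \<in> \<C>. \<forall>Y \<in> \<C>. supp X \<subseteq> supp Y \<longrightarrow> X = Y \<or> X = prod.swap Y) \<and>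
     (\<forall>X \<in> \<C>. \<forall>Y \<in> \<C>. \<forall>e \<in> fst X \<inter> snd Y. X \<noteq> prod.swap Y \<longrightarrow>
        (\<exists>Z \<in> \<C>. fst Z \<subseteq> (fst X \<union> fst Y) - {e} \<and> snd Z \<subseteq> (snd X \<union> snd Y) - {e}))"

definition om_independent :: "'a signed_set set \<Rightarrow> 'a set \<Rightarrow> bool" where
  "om_independent \<C> I \<longleftrightarrow> \<not> (\<exists>C \<in> \<C>. supp C \<subseteq> I)"

definition om_basis :: "'a set \<Rightarrow> 'a signed_set set \<Rightarrow> 'a set \<Rightarrow> bool" where
  "om_basis E \<C> B \<longleftrightarrow>
     B \<subseteq> E \<and> om_independent \<C> B \<and> (\<forall>e \<in> E - B. \<not> om_independent \<C> (insert e B))"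

definition fundamental_circuit :: "'a signed_set set \<Rightarrow> 'a set \<Rightarrow> 'a \<Rightarrow> 'a signed_set" where
  "fundamental_circuit \<C> B e = (THE C. C \<in> \<C> \<and> e \<in> fst C \<and> supp C \<subseteq> insert e B)"

definition reorient :: "'a set \<Rightarrow> 'a signed_set set \<Rightarrow> 'a signed_set set" where
  "reorient F \<C> = (\<lambda>(P, N). ((P - F) \<union> (N \<inter> F), (N - F) \<union> (P \<inter> F))) ` \<C>"

definition relabel :: "('a \<Rightarrow> 'a) \<Rightarrow> 'a signed_set set \<Rightarrow> 'a signed_set set" where
  "relabel p \<C> = (\<lambda>(P, N). (p ` P, p ` N)) ` \<C>"

definition om_restrict :: "'a signed_set set \<Rightarrow> 'a set \<Rightarrow> 'a signed_set set" where
  "om_restrict \<C> A = {C \<in> \<C>. supp C \<subseteq> A}"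

text \<open>
  The oriented matroid realized by the vectors \<open>(a e 0, \<dots>, a e (r - 1))\<close> for \<open>e \<in> E\<close>: its
  circuits are the sign patterns of the linear dependencies of inclusion-minimal support.
\<close>

definition lin_dependency :: "'a set \<Rightarrow> nat \<Rightarrow> ('a \<Rightarrow> nat \<Rightarrow> real) \<Rightarrow> ('a \<Rightarrow> real) \<Rightarrow> bool" where
  "lin_dependency E r a c \<longleftrightarrow>
     (\<exists>e \<in> E. c e \<noteq> 0) \<and> (\<forall>j < r. (\<Sum>e \<in> E. c e * a e j) = 0)"

definition realized_om :: "'a set \<Rightarrow> nat \<Rightarrow> ('a \<Rightarrow> nat \<Rightarrow> real) \<Rightarrow> 'a signed_set set" where
  "realized_om E r a =
     {({e \<in> E. c e > 0}, {e \<in> E. c e < 0}) | c.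
        lin_dependency E r a c \<and>
        \<not> (\<exists>c'. lin_dependency E r a c' \<and> {e \<in> E. c' e \<noteq> 0} \<subset> {e \<in> E. c e \<noteq> 0})}"

text \<open>
  \<open>is_alternating xs r \<C>\<close>: \<open>\<C>\<close> is the alternating matroid of rank \<open>r\<close> on the ground set \<open>set xs\<close>,
  linearly ordered as in the list \<open>xs\<close>. All increasing choices of \<open>x\<close> give the same \<open>\<C>\<close>.
\<close>

definition is_alternating :: "'a list \<Rightarrow> nat \<Rightarrow> 'a signed_set set \<Rightarrow> bool" where
  "is_alternating xs r \<C> \<longleftrightarrow>
     (\<exists>x :: 'a \<Rightarrow> real. sorted_wrt (\<lambda>e f. x e < x f) xs \<and>
        \<C> = realized_om (set xs) r (\<lambda>e j. x e ^ j))"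

section \<open>Cyclic-P-matroids and their simple extensions\<close>

definition P_matroid :: "nat \<Rightarrow> nat signed_set set \<Rightarrow> bool" where
  "P_matroid n \<C> \<longleftrightarrow>
     oriented_matroid {..<2 * n} \<C> \<and>
     om_basis {..<2 * n} \<C> {..<n} \<and>
     (\<forall>B \<subseteq> {..<2 * n}. card B = n \<and> \<not> (\<exists>i < n. {i, i + n} \<subseteq> B) \<longrightarrow> om_basis {..<2 * n} \<C> B) \<and>
     \<not> (\<exists>C \<in> \<C>. \<exists>i < n. {j. j < n \<and> {j, j + n} \<subseteq> supp C} = {i} \<and>
          (i \<in> fst C \<and> i + n \<in> snd C \<or> i \<in> snd C \<and> i + n \<in> fst C))"

definition cyclic_P_matroid_via ::
    "nat \<Rightarrow> (nat \<Rightarrow> nat) \<Rightarrow> nat set \<Rightarrow> nat signed_set set \<Rightarrow> bool" where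
  "cyclic_P_matroid_via n p F \<C> \<longleftrightarrow>
     P_matroid n \<C> \<and> p permutes {..<2 * n} \<and> F \<subseteq> {..<2 * n} \<and>
     is_alternating [0..<2 * n] n (relabel p (reorient F \<C>))"

definition cyclic_P_matroid :: "nat \<Rightarrow> nat signed_set set \<Rightarrow> bool" where
  "cyclic_P_matroid n \<C> \<longleftrightarrow> (\<exists>p F. cyclic_P_matroid_via n p F \<C>)"

definition simple_extension :: "nat \<Rightarrow> nat signed_set set \<Rightarrow> nat signed_set set \<Rightarrow> bool" where
  "simple_extension n \<C> \<C>' \<longleftrightarrow>
     oriented_matroid {..2 * n} \<C>' \<and>
     \<C> = om_restrict \<C>' {..<2 * n} \<and>
     (\<exists>p F ys zs.
        p permutes {..2 * n} \<and> p (2 * n) = 2 * n \<and> F \<subseteq> {..2 * n} \<and>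
        ys @ zs = [0..<2 * n] \<and>
        is_alternating (ys @ [2 * n] @ zs) n (relabel p (reorient F \<C>')) \<and>
        cyclic_P_matroid_via n p (F \<inter> {..<2 * n}) \<C>)"

definition associated_USO :: "nat \<Rightarrow> nat signed_set set \<Rightarrow> nat set \<Rightarrow> nat set" where
  "associated_USO n \<C>' =
     (\<lambda>v \<in> Pow {..<n}.
        let C = fundamental_circuit \<C>' (({..<n} - v) \<union> (\<lambda>i. i + n) ` v) (2 * n)
        in {i. i < n \<and> (i \<in> snd C \<or> i + n \<in> snd C)})"

end

theory Submission
  imports Defs
begin

text \<open>
  A simple extension of a cyclic-P-matroid is the oriented matroid of \<open>2 * n + 1\<close> points on the
  moment curve, some of them negated. In every circuit of points on the moment curve the signs
  alternate along the curve. Hence the sign of \<open>f\<close> relative to \<open>q\<close> in the fundamental circuit of a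
  transversal of the complementary pairs is the parity of the number of transversal elements
  between \<open>f\<close> and \<open>q\<close>, corrected by the negations. View each complementary pair as a chord joining
  two positions. The absence of circuits with exactly one complementary pair, of opposite signs,
  says that no two chords cross and that the negations at the two ends of a chord are coupled by
  the parity of the number of chords below it (\<open>P_matroid_imp_noncrossing_balanced\<close> and its converse).
  Walking along an edge of the cube in direction \<open>d\<close> moves one transversal element from one end of
  chord \<open>d\<close> to the other, and this changes the membership of \<open>d'\<close> in the outmap exactly if chord
  \<open>d\<close> separates \<open>q\<close> from chord \<open>d'\<close> (\<open>associated_USO_influenced\<close>). This does not depend on the
  vertex, so the orientation is of Matousek type. Cutting the circle of positions at \<open>q\<close> turns
  the chords into nested intervals and separation into containment, so the influence graph is a
  partial order in which the elements below any given one form a chain, a \<open>forest_order\<close>.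
  Conversely, every forest order is the containment order of a system of nested parentheses
  (\<open>nested_list_exists\<close>), with \<open>q\<close> outside all of them, and negating both ends of a chord
  flips one coordinate of the outmap, so that every orientation with this influence graph
  occurs (\<open>forest_order_simple_extension\<close>).

  Thus the theorem amounts to a characterization of the realizable Matousek-type USOs: they
  are those whose influence graph is a forest order. If it is one, an explicit matrix does it
  (\<open>forest_order_realizable\<close>): it is triangular for the order, has ones on the diagonal and
  entries \<open>\<plusminus>2\<close> for comparable pairs, and along a chain of ancestors the value of the free
  variable just changes sign at every element of the vertex. If the influence graph is not a
  forest order, then it contains \<open>a \<rightarrow> b \<rightarrow> c\<close> without \<open>a \<rightarrow> c\<close>, or \<open>a \<rightarrow> c \<leftarrow> b\<close> with \<open>a\<close>, \<open>b\<close>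
  unrelated. On the face spanned by \<open>a\<close>, \<open>b\<close>, \<open>c\<close> the outmap prescribes the signs of all
  candidate solutions, and suitable convex combinations of these solutions contradict each other
  (\<open>path_infeasible\<close>, \<open>quadrilateral_infeasible\<close>).

  Matousek-type orientations are handled throughout through the relation \<open>influenced_by\<close>, which
  forgets the position of the sink: by a triangular system over the two-element field, every
  prescribed set of outgoing directions within a face is attained at exactly one of its vertices
  (\<open>parity_system\<close>), which gives both the USO property
  and the isomorphism with the normalized Matousek USO.
\<close>

section \<open>Oriented matroids of vector configurations\<close>

definition sign_pattern :: "'a set \<Rightarrow> ('a \<Rightarrow> real) \<Rightarrow> 'a signed_set" where
  "sign_pattern E c = ({e \<in> E. c e > 0}, {e \<in> E. c e < 0})"

definition minimal_dependency :: "'a set \<Rightarrow> nat \<Rightarrow> ('a \<Rightarrow> nat \<Rightarrow> real) \<Rightarrow> ('a \<Rightarrow> real) \<Rightarrow> bool" where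
  "minimal_dependency E r a c \<longleftrightarrow> lin_dependency E r a c \<and>
     \<not> (\<exists>c'. lin_dependency E r a c' \<and> {e \<in> E. c' e \<noteq> 0} \<subset> {e \<in> E. c e \<noteq> 0})"

lemma realized_om_eq: "realized_om E r a = sign_pattern E ` {c. minimal_dependency E r a c}"
  by (auto simp: realized_om_def minimal_dependency_def sign_pattern_def)

lemma realized_omE:
  assumes "X \<in> realized_om E r a"
  obtains c where "minimal_dependency E r a c" "X = sign_pattern E c"
  using assms by (auto simp: realized_om_eq)

lemma supp_sign_pattern: "supp (sign_pattern E c) = {e \<in> E. c e \<noteq> 0}"
  by (auto simp: supp_def sign_pattern_def)

lemma fst_sign_pattern [simp]: "fst (sign_pattern E c) = {e \<in> E. c e > 0}"
  and snd_sign_pattern [simp]: "snd (sign_pattern E c) = {e \<in> E. c e < 0}"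
  by (simp_all add: sign_pattern_def)

lemma sign_pattern_uminus: "sign_pattern E (\<lambda>e. - c e) = prod.swap (sign_pattern E c)"
  by (auto simp: sign_pattern_def)

lemma sign_pattern_scale:
  assumes "\<And>e. e \<in> E \<Longrightarrow> c e = t * d e" "t > 0"
  shows "sign_pattern E c = sign_pattern E d"
  using assms by (auto simp: sign_pattern_def zero_less_mult_iff mult_less_0_iff)

lemma minimal_dependencyD: "minimal_dependency E r a c \<Longrightarrow> lin_dependency E r a c"
  by (simp add: minimal_dependency_def)

lemma lin_dependency_scale:
  assumes "lin_dependency E r a c" "t \<noteq> 0"
  shows "lin_dependency E r a (\<lambda>e. t * c e)"
  using assms by (auto simp: lin_dependency_def mult.assoc simp flip: sum_distrib_left)

lemma minimal_dependency_scale: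
  assumes "minimal_dependency E r a c" "t \<noteq> 0"
  shows "minimal_dependency E r a (\<lambda>e. t * c e)"
  using assms lin_dependency_scale[of E r a c t] by (auto simp: minimal_dependency_def)

lemma lin_dependency_add:
  assumes "lin_dependency E r a c" "lin_dependency E r a d" "\<exists>e\<in>E. c e + t * d e \<noteq> 0"
  shows "lin_dependency E r a (\<lambda>e. c e + t * d e)"
  using assms
  by (auto simp: lin_dependency_def distrib_right sum.distrib mult.assoc simp flip: sum_distrib_left)

text \<open>
  Otherwise a multiple of \<open>c\<close> could be subtracted from \<open>d\<close> so as to cancel one coordinate, which
  leaves a dependency of smaller support than \<open>c\<close>.
\<close>

lemma minimal_dependency_unique:
  assumes c: "minimal_dependency E r a c" and d: "lin_dependency E r a d"
    and sub: "{e \<in> E. d e \<noteq> 0} \<subseteq> {e \<in> E. c e \<noteq> 0}"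
  obtains t where "t \<noteq> 0" "\<And>e. e \<in> E \<Longrightarrow> d e = t * c e"
proof -
  obtain e where e: "e \<in> E" "d e \<noteq> 0"
    using d by (auto simp: lin_dependency_def)
  with sub have ce: "c e \<noteq> 0" by auto
  define t where "t = d e / c e"
  have t0: "t \<noteq> 0" using e ce by (simp add: t_def)
  have "\<forall>f\<in>E. d f + (- t) * c f = 0"
  proof (rule ccontr)
    assume "\<not> ?thesis"
    then have "lin_dependency E r a (\<lambda>f. d f + (- t) * c f)"
      using lin_dependency_add[OF d minimal_dependencyD[OF c], of "- t"] by blast
    moreover have "{f \<in> E. d f + (- t) * c f \<noteq> 0} \<subset> {f \<in> E. c f \<noteq> 0}"
    proof
      show "{f \<in> E. d f + (- t) * c f \<noteq> 0} \<subseteq> {f \<in> E. c f \<noteq> 0}"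
        using sub by auto
      have "d e + (- t) * c e = 0" using ce by (simp add: t_def)
      then show "{f \<in> E. d f + (- t) * c f \<noteq> 0} \<noteq> {f \<in> E. c f \<noteq> 0}"
        using e ce by blast
    qed
    ultimately show False using c unfolding minimal_dependency_def by blast
  qed
  then have "\<And>f. f \<in> E \<Longrightarrow> d f = t * c f" by auto
  with t0 show ?thesis using that by blast
qed

text \<open>
  The circuit elimination axiom rests on this: every dependency dominates a circuit sign by sign.
  If \<open>c\<close> is not itself minimal, subtract from it a dependency of smaller support, scaled so
  that it cancels a coordinate of \<open>c\<close> before it reverses the sign of any.
\<close>

lemma conformal_circuit:
  assumes fin: "finite E" and "lin_dependency E r a c"
  shows "\<exists>Z \<in> realized_om E r a. fst Z \<subseteq> {e \<in> E. c e > 0} \<and> snd Z \<subseteq> {e \<in> E. c e < 0}"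
  using assms(2)
proof (induction "card {e \<in> E. c e \<noteq> 0}" arbitrary: c rule: less_induct)
  case less
  show ?case
  proof (cases "minimal_dependency E r a c")
    case True
    then show ?thesis
      by (intro bexI[of _ "sign_pattern E c"]) (auto simp: realized_om_eq)
  next
    case False
    then obtain c0 where c0: "lin_dependency E r a c0" "{e \<in> E. c0 e \<noteq> 0} \<subset> {e \<in> E. c e \<noteq> 0}"
      using less.prems by (auto simp: minimal_dependency_def)
    then obtain e0 where e0: "e0 \<in> E" "c0 e0 \<noteq> 0" "c e0 \<noteq> 0"
      by (auto simp: lin_dependency_def)
    \<comment> \<open>The factor makes the coordinate of \<open>d\<close> at \<open>e0\<close> agree in sign with that of \<open>c\<close>.\<close>
    define d where "d = (\<lambda>e. (c0 e0 * c e0) * c0 e)"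
    have d: "lin_dependency E r a d"
      unfolding d_def using c0(1) e0 by (intro lin_dependency_scale) auto
    have dsub: "{e \<in> E. d e \<noteq> 0} \<subset> {e \<in> E. c e \<noteq> 0}"
      using c0(2) e0 by (auto simp: d_def)
    define P where "P = {e \<in> E. d e * c e > 0}"
    have "d e0 * c e0 = (c0 e0 * c e0)\<^sup>2" by (simp add: d_def power2_eq_square)
    then have "e0 \<in> P" using e0 by (simp add: P_def)
    have finP: "finite P" using fin by (simp add: P_def)
    define t where "t = Min ((\<lambda>e. c e / d e) ` P)"
    have tle: "t \<le> c e / d e" if "e \<in> P" for e
      unfolding t_def using finP that by (intro Min_le) auto
    have "t \<in> (\<lambda>e. c e / d e) ` P"
      unfolding t_def using finP \<open>e0 \<in> P\<close> by (intro Min_in) auto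
    then obtain e1 where e1: "e1 \<in> P" "t = c e1 / d e1" by auto
    have tpos: "t > 0" using e1 by (auto simp: P_def zero_less_mult_iff zero_less_divide_iff)
    define c' where "c' = (\<lambda>e. c e + (- t) * d e)"
    have pos: "0 \<le> c' e" if "e \<in> E" "c e > 0" for e
    proof (cases "d e > 0")
      case True
      then have "t \<le> c e / d e" using that tle[of e] by (auto simp: P_def)
      then show ?thesis using True by (simp add: c'_def field_simps)
    next
      case False
      then have "t * d e \<le> 0" using tpos by (auto simp: mult_le_0_iff)
      then show ?thesis using that by (simp add: c'_def)
    qed
    have neg: "c' e \<le> 0" if "e \<in> E" "c e < 0" for e
    proof (cases "d e < 0")
      case True
      then have "t \<le> c e / d e" using that tle[of e] by (auto simp: P_def mult_neg_neg)
      then show ?thesis using True by (simp add: c'_def field_simps)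
    next
      case False
      then have "t * d e \<ge> 0" using tpos by auto
      then show ?thesis using that by (simp add: c'_def)
    qed
    have zero: "c' e = 0" if "e \<in> E" "c e = 0" for e
      using that dsub by (auto simp: c'_def)
    obtain e2 where e2: "e2 \<in> E" "c e2 \<noteq> 0" "d e2 = 0" using dsub by auto
    have c': "lin_dependency E r a c'"
      unfolding c'_def using less.prems d e2
      by (intro lin_dependency_add) (auto intro!: bexI[of _ e2])
    have "c' e1 = 0" "e1 \<in> E" "c e1 \<noteq> 0"
      using e1 by (auto simp: c'_def P_def)
    then have "{e \<in> E. c' e \<noteq> 0} \<subset> {e \<in> E. c e \<noteq> 0}" using zero by blast
    then have "card {e \<in> E. c' e \<noteq> 0} < card {e \<in> E. c e \<noteq> 0}"
      using fin by (intro psubset_card_mono) auto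
    from less.hyps[OF this c'] obtain Z where Z: "Z \<in> realized_om E r a"
      "fst Z \<subseteq> {e \<in> E. c' e > 0}" "snd Z \<subseteq> {e \<in> E. c' e < 0}" by blast
    have "{e \<in> E. c' e > 0} \<subseteq> {e \<in> E. c e > 0}" "{e \<in> E. c' e < 0} \<subseteq> {e \<in> E. c e < 0}"
      using pos neg zero by (force simp: not_less[symmetric])+
    with Z show ?thesis by blast
  qed
qed

lemma oriented_matroid_realized_om:
  assumes fin: "finite E"
  shows "oriented_matroid E (realized_om E r a)"
  unfolding oriented_matroid_def
proof (intro conjI ballI impI)
  show "finite E" by fact
next
  fix X assume "X \<in> realized_om E r a"
  then show "supp X \<subseteq> E" "fst X \<inter> snd X = {}"
    by (auto elim!: realized_omE simp: supp_sign_pattern)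
next
  have "supp X \<noteq> {}" if X: "X \<in> realized_om E r a" for X
  proof -
    from X obtain c where "minimal_dependency E r a c" "X = sign_pattern E c" by (rule realized_omE)
    then show ?thesis by (auto simp: supp_sign_pattern minimal_dependency_def lin_dependency_def)
  qed
  then show "({}, {}) \<notin> realized_om E r a" by (force simp: supp_def)
next
  fix X assume "X \<in> realized_om E r a"
  then obtain c where c: "minimal_dependency E r a c" "X = sign_pattern E c" by (rule realized_omE)
  then have "minimal_dependency E r a (\<lambda>e. - c e)"
    using minimal_dependency_scale[of E r a c "- 1"] by simp
  with c show "prod.swap X \<in> realized_om E r a"
    by (auto simp: realized_om_eq simp flip: sign_pattern_uminus)
next
  fix X Y assume XY: "X \<in> realized_om E r a" "Y \<in> realized_om E r a" "supp X \<subseteq> supp Y"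
  obtain c where c: "minimal_dependency E r a c" "X = sign_pattern E c"
    using XY(1) by (rule realized_omE)
  obtain d where d: "minimal_dependency E r a d" "Y = sign_pattern E d"
    using XY(2) by (rule realized_omE)
  obtain t where t: "t \<noteq> 0" "\<And>e. e \<in> E \<Longrightarrow> c e = t * d e"
    using minimal_dependency_unique[OF d(1) minimal_dependencyD[OF c(1)]] XY(3)
    unfolding c(2) d(2) supp_sign_pattern by blast
  show "X = Y \<or> X = prod.swap Y"
  proof (cases "t > 0")
    case True
    then show ?thesis using sign_pattern_scale[of E c t d] t c d by auto
  next
    case False
    then show ?thesis
      using sign_pattern_scale[of E c "- t" "\<lambda>e. - d e"] t c d by (auto simp: sign_pattern_uminus)
  qed
next
  fix X Y e
  assume X: "X \<in> realized_om E r a" and Y: "Y \<in> realized_om E r a"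
    and e: "e \<in> fst X \<inter> snd Y" and ne: "X \<noteq> prod.swap Y"
  obtain c where c: "minimal_dependency E r a c" "X = sign_pattern E c"
    using X by (rule realized_omE)
  obtain d where d: "minimal_dependency E r a d" "Y = sign_pattern E d"
    using Y by (rule realized_omE)
  define t where "t = - (c e / d e)"
  from e c d have ed: "e \<in> E" "c e > 0" "d e < 0" by auto
  then have t: "t > 0" by (simp add: t_def divide_less_0_iff)
  have ex: "\<exists>f\<in>E. c f + t * d f \<noteq> 0"
  proof (rule ccontr)
    assume "\<not> ?thesis"
    then have "c f = t * - d f" if "f \<in> E" for f using that by auto
    then have "X = prod.swap Y"
      using sign_pattern_scale[of E c t "\<lambda>f. - d f"] t c d by (auto simp: sign_pattern_uminus)
    with ne show False by simp
  qed
  have "lin_dependency E r a (\<lambda>f. c f + t * d f)"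
    using lin_dependency_add[OF minimal_dependencyD[OF c(1)] minimal_dependencyD[OF d(1)] ex] .
  from conformal_circuit[OF fin this] obtain Z where Z: "Z \<in> realized_om E r a"
    "fst Z \<subseteq> {f \<in> E. c f + t * d f > 0}" "snd Z \<subseteq> {f \<in> E. c f + t * d f < 0}" by blast
  have e0: "c e + t * d e = 0" using ed by (simp add: t_def)
  have "{f \<in> E. c f + t * d f > 0} \<subseteq> fst X \<union> fst Y - {e}"
  proof
    fix f assume f: "f \<in> {f \<in> E. c f + t * d f > 0}"
    then have "c f > 0 \<or> d f > 0" using t by (smt (verit) mem_Collect_eq mult_nonneg_nonpos)
    then show "f \<in> fst X \<union> fst Y - {e}" using f e0 c d by auto
  qed
  moreover have "{f \<in> E. c f + t * d f < 0} \<subseteq> snd X \<union> snd Y - {e}"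
  proof
    fix f assume f: "f \<in> {f \<in> E. c f + t * d f < 0}"
    then have "c f < 0 \<or> d f < 0" using t by (smt (verit) mem_Collect_eq mult_nonneg_nonneg)
    then show "f \<in> snd X \<union> snd Y - {e}" using f e0 c d by auto
  qed
  ultimately show "\<exists>Z\<in>realized_om E r a.
      fst Z \<subseteq> fst X \<union> fst Y - {e} \<and> snd Z \<subseteq> snd X \<union> snd Y - {e}"
    using Z by blast
qed

lemma om_restrict_realized_om:
  assumes fin: "finite E" and sub: "A \<subseteq> E"
  shows "om_restrict (realized_om E r a) A = realized_om A r a"
proof -
  define ext where "ext c = (\<lambda>e. if e \<in> A then c e else 0)" for c :: "'a \<Rightarrow> real"
  have lin: "lin_dependency E r a c \<longleftrightarrow> lin_dependency A r a c"
    if "\<And>e. e \<in> E \<Longrightarrow> e \<notin> A \<Longrightarrow> c e = 0" for c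
  proof -
    have "(\<Sum>e\<in>E. c e * a e j) = (\<Sum>e\<in>A. c e * a e j)" for j
      using fin sub that by (intro sum.mono_neutral_right) auto
    moreover have "(\<exists>e\<in>E. c e \<noteq> 0) \<longleftrightarrow> (\<exists>e\<in>A. c e \<noteq> 0)" using that sub by auto
    ultimately show ?thesis by (simp add: lin_dependency_def)
  qed
  have lin_ext: "lin_dependency A r a (ext c) \<longleftrightarrow> lin_dependency A r a c" for c
    by (simp add: lin_dependency_def ext_def)
  have minl: "minimal_dependency E r a c \<longleftrightarrow> minimal_dependency A r a c"
    if c: "\<And>e. e \<in> E \<Longrightarrow> e \<notin> A \<Longrightarrow> c e = 0" for c
  proof -
    have suppc: "{e \<in> E. c e \<noteq> 0} = {e \<in> A. c e \<noteq> 0}" using c sub by auto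
    have "(\<exists>c'. lin_dependency E r a c' \<and> {e \<in> E. c' e \<noteq> 0} \<subset> {e \<in> A. c e \<noteq> 0}) \<longleftrightarrow>
          (\<exists>c'. lin_dependency A r a c' \<and> {e \<in> A. c' e \<noteq> 0} \<subset> {e \<in> A. c e \<noteq> 0})"
      (is "?L \<longleftrightarrow> ?R")
    proof
      assume ?L
      then obtain c' where c': "lin_dependency E r a c'" "{e \<in> E. c' e \<noteq> 0} \<subset> {e \<in> A. c e \<noteq> 0}"
        by blast
      then have z: "\<And>e. e \<in> E \<Longrightarrow> e \<notin> A \<Longrightarrow> c' e = 0" by auto
      have "{e \<in> A. c' e \<noteq> 0} \<subset> {e \<in> A. c e \<noteq> 0}"
        using c'(2) sub by (auto simp: psubset_eq)
      moreover have "lin_dependency A r a c'" using c'(1) lin[of c'] z by simp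
      ultimately show ?R by blast
    next
      assume ?R
      then obtain c' where c': "lin_dependency A r a c'" "{e \<in> A. c' e \<noteq> 0} \<subset> {e \<in> A. c e \<noteq> 0}"
        by blast
      have "lin_dependency E r a (ext c')"
        using c'(1) by (subst lin) (auto simp: lin_ext, auto simp: ext_def)
      moreover have "{e \<in> E. ext c' e \<noteq> 0} = {e \<in> A. c' e \<noteq> 0}" using sub by (auto simp: ext_def)
      ultimately show ?L using c'(2) by (intro exI[of _ "ext c'"]) simp
    qed
    moreover have "lin_dependency E r a c \<longleftrightarrow> lin_dependency A r a c" using c by (rule lin)
    ultimately show ?thesis unfolding minimal_dependency_def suppc by simp
  qed
  show ?thesis
  proof (intro equalityI subsetI)
    fix X assume "X \<in> om_restrict (realized_om E r a) A"
    then have X: "X \<in> realized_om E r a" "supp X \<subseteq> A" by (auto simp: om_restrict_def)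
    obtain c where c: "minimal_dependency E r a c" "X = sign_pattern E c"
      using X(1) by (rule realized_omE)
    have z: "\<And>e. e \<in> E \<Longrightarrow> e \<notin> A \<Longrightarrow> c e = 0" using X(2) c(2) by (auto simp: supp_sign_pattern)
    have "sign_pattern E c = sign_pattern A c" using z sub by (force simp: sign_pattern_def)
    then show "X \<in> realized_om A r a" using c minl[OF z] by (auto simp: realized_om_eq)
  next
    fix X assume X: "X \<in> realized_om A r a"
    obtain c where c: "minimal_dependency A r a c" "X = sign_pattern A c"
      using X by (rule realized_omE)
    have "minimal_dependency A r a (ext c)"
      using c(1) unfolding minimal_dependency_def lin_ext by (simp add: ext_def cong: conj_cong)
    then have "minimal_dependency E r a (ext c)" by (subst minl) (auto simp: ext_def)
    moreover have "X = sign_pattern E (ext c)" using c(2) sub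
      by (auto simp: sign_pattern_def ext_def)
    moreover have "supp X \<subseteq> A" using c(2) by (auto simp: supp_sign_pattern)
    ultimately show "X \<in> om_restrict (realized_om E r a) A"
      by (auto simp: realized_om_eq om_restrict_def)
  qed
qed

lemma oriented_matroid_disjoint:
  "oriented_matroid E \<C> \<Longrightarrow> X \<in> \<C> \<Longrightarrow> fst X \<inter> snd X = {}"
  by (simp add: oriented_matroid_def)

lemma oriented_matroid_swap: "oriented_matroid E \<C> \<Longrightarrow> X \<in> \<C> \<Longrightarrow> prod.swap X \<in> \<C>"
  by (simp add: oriented_matroid_def)

lemma oriented_matroid_incomparable:
  "oriented_matroid E \<C> \<Longrightarrow> X \<in> \<C> \<Longrightarrow> Y \<in> \<C> \<Longrightarrow> supp X \<subseteq> supp Y \<Longrightarrow> X = Y \<or> X = prod.swap Y"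
  by (simp add: oriented_matroid_def)

section \<open>Reorientation and relabeling of realized oriented matroids\<close>

text \<open>The points \<open>k e\<close> on the moment curve, those in \<open>F\<close> negated.\<close>

definition signed_moment :: "'a set \<Rightarrow> ('a \<Rightarrow> real) \<Rightarrow> 'a \<Rightarrow> nat \<Rightarrow> real" where
  "signed_moment F k e j = (if e \<in> F then - 1 else 1) * k e ^ j"

lemma reorient_realized_om:
  "reorient F (realized_om E r a) = realized_om E r (\<lambda>e j. (if e \<in> F then - 1 else 1) * a e j)"
proof -
  define sg :: "'a \<Rightarrow> real" where "sg = (\<lambda>e. if e \<in> F then - 1 else 1)"
  have sg: "sg e * (sg e * t) = t" for e t by (simp add: sg_def)
  have sg0: "sg e * t = 0 \<longleftrightarrow> t = 0" for e t by (simp add: sg_def)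
  have sgn: "sg e \<noteq> 0" for e by (simp add: sg_def)
  have lin: "lin_dependency E r (\<lambda>e j. sg e * b e j) (\<lambda>e. sg e * c e) \<longleftrightarrow> lin_dependency E r b c"
    for b c
  proof -
    have "(sg e * c e) * (sg e * b e j) = c e * b e j" for e j by (simp add: sg_def)
    then show ?thesis by (simp only: lin_dependency_def not_not sg0)
  qed
  have lin': "lin_dependency E r (\<lambda>e j. sg e * b e j) c \<longleftrightarrow> lin_dependency E r b (\<lambda>e. sg e * c e)"
    for b c using lin[of b "\<lambda>e. sg e * c e"] by (simp add: sg)
  have "(\<exists>c'. lin_dependency E r (\<lambda>e j. sg e * a e j) c' \<and> {e \<in> E. c' e \<noteq> 0} \<subset> A) \<longleftrightarrow>
     (\<exists>c'. lin_dependency E r a c' \<and> {e \<in> E. c' e \<noteq> 0} \<subset> A)" (is "?L \<longleftrightarrow> ?R") for A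
  proof
    assume ?L
    then obtain c' where "lin_dependency E r (\<lambda>e j. sg e * a e j) c'" "{e \<in> E. c' e \<noteq> 0} \<subset> A"
      by blast
    then show ?R by (intro exI[of _ "\<lambda>e. sg e * c' e"]) (simp add: lin' sg0 sgn)
  next
    assume ?R
    then obtain c' where "lin_dependency E r a c'" "{e \<in> E. c' e \<noteq> 0} \<subset> A" by blast
    then show ?L by (intro exI[of _ "\<lambda>e. sg e * c' e"]) (simp add: lin sg0 sgn)
  qed
  then have minl: "minimal_dependency E r (\<lambda>e j. sg e * a e j) (\<lambda>e. sg e * c e) \<longleftrightarrow>
      minimal_dependency E r a c" for c
    by (simp add: minimal_dependency_def lin sg0 sgn)
  have "{c. minimal_dependency E r (\<lambda>e j. sg e * a e j) c} =
        (\<lambda>c e. sg e * c e) ` {c. minimal_dependency E r a c}" (is "?A = ?B")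
  proof (intro equalityI subsetI)
    fix c assume "c \<in> ?A"
    then have "(\<lambda>e. sg e * c e) \<in> {c. minimal_dependency E r a c}"
      using minl[of "\<lambda>e. sg e * c e"] by (simp add: sg)
    moreover have "c = (\<lambda>e. sg e * (sg e * c e))" by (simp add: sg)
    ultimately show "c \<in> ?B" by (intro image_eqI[where x = "\<lambda>e. sg e * c e"]) simp_all
  next
    fix c assume "c \<in> ?B" then show "c \<in> ?A" using minl by auto
  qed
  moreover have "(\<lambda>(P, N). ((P - F) \<union> (N \<inter> F), (N - F) \<union> (P \<inter> F))) (sign_pattern E c) =
      sign_pattern E (\<lambda>e. sg e * c e)" for c
    by (auto simp: sign_pattern_def sg_def)
  ultimately have "reorient F (realized_om E r a) = realized_om E r (\<lambda>e j. sg e * a e j)"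
    unfolding reorient_def realized_om_eq by (simp add: image_image)
  then show ?thesis by (simp add: sg_def)
qed

lemma relabel_realized_om:
  assumes p: "p permutes E"
  shows "relabel p (realized_om E r (\<lambda>e. a (p e))) = realized_om E r a"
proof -
  have bij: "bij_betw p E E" using p by (rule permutes_imp_bij)
  have pin: "p e \<in> E \<longleftrightarrow> e \<in> E" for e using permutes_in_image[OF p] .
  have pinv: "inv_into UNIV p (p e) = e" "p (inv_into UNIV p e) = e" for e using permutes_inverses[OF p] by simp_all
  have lin: "lin_dependency E r (\<lambda>e. a (p e)) (\<lambda>e. c (p e)) \<longleftrightarrow> lin_dependency E r a c" for c
  proof -
    have "(\<Sum>e\<in>E. c (p e) * a (p e) j) = (\<Sum>e\<in>E. c e * a e j)" for j
      by (rule sum.reindex_bij_betw[OF bij])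
    moreover have "(\<exists>e\<in>E. c (p e) \<noteq> 0) \<longleftrightarrow> (\<exists>e\<in>E. c e \<noteq> 0)"
      using pin by (metis pinv(2))
    ultimately show ?thesis by (simp add: lin_dependency_def)
  qed
  have im: "{e \<in> E. Q (p e)} = inv_into UNIV p ` {e \<in> E. Q e}" for Q
  proof (intro equalityI subsetI)
    fix e assume "e \<in> {e \<in> E. Q (p e)}"
    then show "e \<in> inv_into UNIV p ` {e \<in> E. Q e}"
      using pin by (intro image_eqI[of _ _ "p e"]) (auto simp: pinv)
  next
    fix e assume "e \<in> inv_into UNIV p ` {e \<in> E. Q e}"
    then obtain f where f: "f \<in> E" "Q f" "e = inv_into UNIV p f" by blast
    then show "e \<in> {e \<in> E. Q (p e)}" using pin[of e] by (simp add: pinv)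
  qed
  have injinv: "inj (inv_into UNIV p)" using permutes_inj[OF permutes_inv[OF p]] .
  have "(\<exists>c'. lin_dependency E r (\<lambda>e. a (p e)) c' \<and> {e \<in> E. c' e \<noteq> 0} \<subset> {e \<in> E. c (p e) \<noteq> 0}) \<longleftrightarrow>
     (\<exists>c'. lin_dependency E r a c' \<and> {e \<in> E. c' e \<noteq> 0} \<subset> {e \<in> E. c e \<noteq> 0})" (is "?L \<longleftrightarrow> ?R") for c
  proof -
    have sub: "{e \<in> E. c' (p e) \<noteq> 0} \<subset> {e \<in> E. c (p e) \<noteq> 0} \<longleftrightarrow>
        {e \<in> E. c' e \<noteq> 0} \<subset> {e \<in> E. c e \<noteq> 0}" for c'
      unfolding im[of "\<lambda>e. c' e \<noteq> 0"] im[of "\<lambda>e. c e \<noteq> 0"] using injinv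
      by (simp add: inj_image_subset_iff psubset_eq inj_image_eq_iff)
    have "?L \<longleftrightarrow> (\<exists>c'. lin_dependency E r (\<lambda>e. a (p e)) (\<lambda>e. c' (p e)) \<and>
        {e \<in> E. c' (p e) \<noteq> 0} \<subset> {e \<in> E. c (p e) \<noteq> 0})"
      (is "_ \<longleftrightarrow> ?M")
    proof
      assume ?L
      then obtain c' where "lin_dependency E r (\<lambda>e. a (p e)) c'"
        "{e \<in> E. c' e \<noteq> 0} \<subset> {e \<in> E. c (p e) \<noteq> 0}" by blast
      then show ?M by (intro exI[of _ "\<lambda>e. c' (inv_into UNIV p e)"]) (simp add: pinv)
    qed blast
    then show ?thesis by (simp add: sub lin)
  qed
  note ex = this
  have minl: "minimal_dependency E r (\<lambda>e. a (p e)) (\<lambda>e. c (p e)) \<longleftrightarrow> minimal_dependency E r a c"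
    for c by (simp only: minimal_dependency_def lin ex)
  have "{c. minimal_dependency E r a c} =
        (\<lambda>c e. c (inv_into UNIV p e)) ` {c. minimal_dependency E r (\<lambda>e. a (p e)) c}" (is "?A = ?B")
  proof (intro equalityI subsetI)
    fix c assume "c \<in> ?A"
    then have "(\<lambda>e. c (p e)) \<in> {c. minimal_dependency E r (\<lambda>e. a (p e)) c}" by (simp add: minl)
    moreover have "c = (\<lambda>e. c (p (inv_into UNIV p e)))" by (simp add: pinv)
    ultimately show "c \<in> ?B" by (intro image_eqI[where x = "\<lambda>e. c (p e)"]) simp_all
  next
    fix c assume "c \<in> ?B"
    then obtain d where "minimal_dependency E r (\<lambda>e. a (p e)) d" "c = (\<lambda>e. d (inv_into UNIV p e))" by blast
    then show "c \<in> ?A" using minl[of c] by (simp add: pinv)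
  qed
  moreover have "(\<lambda>(P, N). (p ` P, p ` N)) (sign_pattern E c) =
      sign_pattern E (\<lambda>e. c (inv_into UNIV p e))" for c
  proof -
    have "p ` {e \<in> E. Q e} = {e \<in> E. Q (inv_into UNIV p e)}" for Q
    proof (intro equalityI subsetI)
      fix e assume "e \<in> p ` {e \<in> E. Q e}"
      then show "e \<in> {e \<in> E. Q (inv_into UNIV p e)}" using pin by (auto simp: pinv)
    next
      fix e assume "e \<in> {e \<in> E. Q (inv_into UNIV p e)}"
      then show "e \<in> p ` {e \<in> E. Q e}"
        using pin[of "inv_into UNIV p e"]
        by (intro image_eqI[of _ _ "inv_into UNIV p e"]) (auto simp: pinv)
    qed
    then show ?thesis by (simp add: sign_pattern_def)
  qed
  ultimately show ?thesis
    unfolding relabel_def realized_om_eq by (simp add: image_image)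
qed

lemma reorient_reorient [simp]: "reorient F (reorient F \<C>) = \<C>"
proof -
  have "((\<lambda>(P, N). ((P - F) \<union> (N \<inter> F), (N - F) \<union> (P \<inter> F))) \<circ>
        (\<lambda>(P, N). ((P - F) \<union> (N \<inter> F), (N - F) \<union> (P \<inter> F)))) = (\<lambda>X. X)"
    by (auto simp: fun_eq_iff)
  then show ?thesis unfolding reorient_def image_comp by simp
qed

lemma relabel_inj:
  assumes "p permutes E" "relabel p \<C> = relabel p \<D>"
  shows "\<C> = \<D>"
proof -
  have "inj p" using assms(1) by (rule permutes_inj)
  then have "inj (\<lambda>(P, N). (p ` P, p ` N))" by (auto simp: inj_on_def inj_image_eq_iff)
  then show ?thesis using assms(2) by (simp add: relabel_def inj_image_eq_iff)
qed

text \<open>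
  This and its converse below replace the abstract data \<open>p\<close>, \<open>F\<close> of an alternating matroid up to
  relabeling and reorientation by a single real configuration, with positions \<open>x \<circ> p\<close>.
\<close>

lemma relabel_reorient_signed_moment:
  assumes "p permutes E"
  shows "relabel p (reorient F (realized_om E r (signed_moment F (\<lambda>e. x (p e))))) =
         realized_om E r (\<lambda>e j. x e ^ j)"
proof -
  have "reorient F (realized_om E r (signed_moment F (\<lambda>e. x (p e)))) =
        realized_om E r (\<lambda>e j. x (p e) ^ j)"
  proof -
    have "(if e \<in> F then - 1 else 1) * ((if e \<in> F then - 1 else 1) * t) = t" for e and t :: real
      by simp
    then show ?thesis by (simp only: reorient_realized_om signed_moment_def)
  qed
  then show ?thesis using relabel_realized_om[OF assms, of r "\<lambda>e j. x e ^ j"] by simp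
qed

lemma relabel_reorient_eq_moment_iff:
  assumes "p permutes E"
  shows "relabel p (reorient F \<C>) = realized_om E r (\<lambda>e j. x e ^ j) \<longleftrightarrow>
         \<C> = realized_om E r (signed_moment F (\<lambda>e. x (p e)))"
  using relabel_reorient_signed_moment[OF assms, of F r x] relabel_inj[OF assms]
  by (metis reorient_reorient)

section \<open>Dependencies on the moment curve\<close>

text \<open>
  A dependency of the moment vectors annihilates all polynomials of low degree; well-chosen
  polynomials then yield all that is needed about its support and its signs.
\<close>

lemma moment_dependency_poly:
  assumes "lin_dependency E n (\<lambda>e j. k e ^ j) c" "degree p < n"
  shows "(\<Sum>e\<in>E. c e * poly p (k e)) = 0"
proof -
  have "(\<Sum>e\<in>E. c e * poly p (k e)) = (\<Sum>e\<in>E. \<Sum>j\<le>degree p. coeff p j * (c e * k e ^ j))"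
    by (simp add: poly_altdef sum_distrib_left mult_ac)
  also have "\<dots> = (\<Sum>j\<le>degree p. coeff p j * (\<Sum>e\<in>E. c e * k e ^ j))"
    by (subst sum.swap) (simp add: sum_distrib_left)
  also have "\<dots> = 0"
    using assms by (intro sum.neutral) (auto simp: lin_dependency_def)
  finally show ?thesis .
qed

lemma degree_prod_linear_le:
  fixes k :: "'a \<Rightarrow> real"
  assumes "finite T" shows "degree (\<Prod>g\<in>T. [:- k g, 1:]) \<le> card T"
  using degree_prod_sum_le[OF assms, of "\<lambda>g. [:- k g, 1:]"] by simp

text \<open>A polynomial vanishing on all but one point of a support of size at most \<open>n\<close> has degree below \<open>n\<close>.\<close>

lemma moment_dependency_card:
  assumes fin: "finite E" and inj: "inj_on k E" and c: "lin_dependency E n (\<lambda>e j. k e ^ j) c"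
  shows "n < card {e \<in> E. c e \<noteq> 0}"
proof (rule ccontr)
  let ?S = "{e \<in> E. c e \<noteq> 0}"
  assume "\<not> ?thesis"
  then have le: "card ?S \<le> n" by simp
  obtain e where e: "e \<in> ?S" using c by (auto simp: lin_dependency_def)
  let ?p = "\<Prod>g\<in>?S - {e}. [:- k g, 1:]"
  have "degree ?p \<le> card (?S - {e})" using fin by (intro degree_prod_linear_le) auto
  also have "\<dots> < card ?S" using fin e by (intro card_Diff1_less) auto
  finally have "(\<Sum>f\<in>E. c f * poly ?p (k f)) = 0"
    using le by (intro moment_dependency_poly[OF c]) auto
  also have "(\<Sum>f\<in>E. c f * poly ?p (k f)) = (\<Sum>f\<in>{e}. c f * poly ?p (k f))"
    using fin e by (intro sum.mono_neutral_right) (auto simp: poly_prod)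
  finally have "poly ?p (k e) = 0" using e by simp
  then show False using fin e inj by (auto simp: poly_prod inj_on_def)
qed

text \<open>
  In the induction step the coefficients \<open>c e\<close> are divided by \<open>k e - k g\<close>, where \<open>g\<close> is the new point:
  the result annihilates all multiples of \<open>X - k g\<close> up to degree \<open>n\<close>, whatever the coefficient at
  \<open>g\<close> is, and that coefficient is chosen such that the constant polynomial is annihilated as well.
\<close>

lemma moment_dependency_exists:
  assumes "finite S" "inj_on k S" "card S = Suc n"
  shows "\<exists>c. (\<forall>e\<in>S. c e \<noteq> 0) \<and> (\<forall>j<n. (\<Sum>e\<in>S. c e * k e ^ j) = (0::real))"
  using assms
proof (induction n arbitrary: S)
  case 0
  then show ?case by (intro exI[of _ "\<lambda>_. 1"]) simp
next
  case (Suc n)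
  then obtain g T where S: "S = insert g T" "g \<notin> T" "card T = Suc n" "finite T"
    by (metis card_Suc_eq finite_insert)
  obtain c where c: "\<forall>e\<in>T. c e \<noteq> 0" "\<forall>j<n. (\<Sum>e\<in>T. c e * k e ^ j) = 0"
    using Suc.IH[of T] Suc.prems S by auto
  have ne: "k e - k g \<noteq> 0" if "e \<in> T" for e
    using Suc.prems(2) S that by (auto simp: inj_on_def)
  define d where "d = (\<lambda>e. if e = g then - (\<Sum>e\<in>T. c e / (k e - k g)) else c e / (k e - k g))"
  have sumd: "(\<Sum>e\<in>S. d e * h e) = d g * h g + (\<Sum>e\<in>T. c e / (k e - k g) * h e)" for h
  proof -
    have "(\<Sum>e\<in>T. d e * h e) = (\<Sum>e\<in>T. c e / (k e - k g) * h e)"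
      using S by (intro sum.cong) (auto simp: d_def)
    then show ?thesis using S by simp
  qed
  have step: "(\<Sum>e\<in>S. d e * k e ^ Suc j) = k g * (\<Sum>e\<in>S. d e * k e ^ j)" if "j < n" for j
  proof -
    have "(\<Sum>e\<in>S. d e * k e ^ Suc j) - k g * (\<Sum>e\<in>S. d e * k e ^ j) =
          (\<Sum>e\<in>S. d e * ((k e - k g) * k e ^ j))"
      by (simp add: sum_distrib_left sum_subtractf[symmetric] algebra_simps)
    also have "\<dots> = (\<Sum>e\<in>T. c e * k e ^ j)"
      unfolding sumd using ne by (simp cong: sum.cong)
    finally show ?thesis using c that by simp
  qed
  have zero: "(\<Sum>e\<in>S. d e * k e ^ j) = 0" if "j < Suc n" for j
    using that
  proof (induction j)
    case 0
    show ?case unfolding sumd by (simp add: d_def)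
  next
    case (Suc j)
    then show ?case by (simp only: step)
  qed
  \<comment> \<open>The coefficient at \<open>g\<close> is nonzero because the support has more than \<open>Suc n\<close> elements.\<close>
  have "lin_dependency S (Suc n) (\<lambda>e j. k e ^ j) d"
  proof -
    obtain e where "e \<in> T" using S by fastforce
    then have "d e \<noteq> 0" "e \<in> S" using c(1) ne[of e] S by (auto simp: d_def)
    then show ?thesis using zero by (auto simp: lin_dependency_def)
  qed
  then have "Suc n < card {e \<in> S. d e \<noteq> 0}"
    using Suc.prems by (intro moment_dependency_card) auto
  then have "{e \<in> S. d e \<noteq> 0} = S"
    using Suc.prems by (intro card_seteq) auto
  then show ?case using zero by (intro exI[of _ d]) auto
qed

lemma minimal_moment_dependency_iff:
  assumes fin: "finite E" and inj: "inj_on k E"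
  shows "minimal_dependency E n (\<lambda>e j. k e ^ j) c \<longleftrightarrow>
     lin_dependency E n (\<lambda>e j. k e ^ j) c \<and> card {e \<in> E. c e \<noteq> 0} = Suc n"
proof (intro iffI conjI)
  assume c: "minimal_dependency E n (\<lambda>e j. k e ^ j) c"
  then show lin: "lin_dependency E n (\<lambda>e j. k e ^ j) c" by (rule minimal_dependencyD)
  show "card {e \<in> E. c e \<noteq> 0} = Suc n"
  proof (rule ccontr)
    let ?S = "{e \<in> E. c e \<noteq> 0}"
    assume "card ?S \<noteq> Suc n"
    then have "Suc n < card ?S" using moment_dependency_card[OF fin inj lin] by simp
    then obtain T where T: "T \<subseteq> ?S" "card T = Suc n" "finite T"
      by (meson less_imp_le obtain_subset_with_card_n)
    have TE: "T \<subset> ?S" using T \<open>Suc n < card ?S\<close> by auto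
    have "inj_on k T" using inj T(1) by (auto intro: inj_on_subset)
    from moment_dependency_exists[OF T(3) this T(2)] obtain d where
      d: "\<forall>e\<in>T. d e \<noteq> 0" "\<forall>j<n. (\<Sum>e\<in>T. d e * k e ^ j) = 0" by blast
    let ?d = "\<lambda>e. if e \<in> T then d e else 0"
    have "(\<Sum>e\<in>E. ?d e * k e ^ j) = (\<Sum>e\<in>T. d e * k e ^ j)" for j
      using fin T by (intro sum.mono_neutral_cong_right) auto
    moreover obtain e where "e \<in> T" using T by fastforce
    ultimately have "lin_dependency E n (\<lambda>e j. k e ^ j) ?d"
      using d T(1) by (auto simp: lin_dependency_def intro!: bexI[of _ e])
    moreover have "{e \<in> E. ?d e \<noteq> 0} = T" using T d by auto
    ultimately show False using c TE unfolding minimal_dependency_def by blast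
  qed
next
  assume c: "lin_dependency E n (\<lambda>e j. k e ^ j) c \<and> card {e \<in> E. c e \<noteq> 0} = Suc n"
  have "\<not> {e \<in> E. d e \<noteq> 0} \<subset> {e \<in> E. c e \<noteq> 0}" if "lin_dependency E n (\<lambda>e j. k e ^ j) d" for d
  proof
    assume "{e \<in> E. d e \<noteq> 0} \<subset> {e \<in> E. c e \<noteq> 0}"
    then have "card {e \<in> E. d e \<noteq> 0} < card {e \<in> E. c e \<noteq> 0}"
      using fin by (intro psubset_card_mono) auto
    then show False using moment_dependency_card[OF fin inj that] c by linarith
  qed
  then show "minimal_dependency E n (\<lambda>e j. k e ^ j) c"
    using c unfolding minimal_dependency_def by blast
qed

lemma prod_pos_iff_even_neg:
  fixes h :: "'a \<Rightarrow> real"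
  assumes "finite T" "\<forall>g\<in>T. h g \<noteq> 0"
  shows "0 < (\<Prod>g\<in>T. h g) \<longleftrightarrow> even (card {g \<in> T. h g < 0})"
  using assms
proof (induction T rule: finite_induct)
  case (insert g T)
  have "{x \<in> insert g T. h x < 0} = (if h g < 0 then insert g {x \<in> T. h x < 0} else {x \<in> T. h x < 0})"
    by auto
  moreover have "(\<Prod>g\<in>T. h g) \<noteq> 0" "h g \<noteq> 0" using insert by simp_all
  ultimately show ?case using insert
    by (cases "h g < 0") (auto simp: zero_less_mult_iff not_less le_less)
qed simp

definition between :: "('a \<Rightarrow> real) \<Rightarrow> 'a \<Rightarrow> 'a \<Rightarrow> 'a \<Rightarrow> bool" where
  "between k e f g \<longleftrightarrow> min (k e) (k f) < k g \<and> k g < max (k e) (k f)"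

text \<open>
  The signs of a circuit alternate along the curve: the polynomial vanishing on all points of the
  support except \<open>e\<close> and \<open>f\<close> has degree \<open>n - 1\<close>, and it changes sign once at each point in between.
\<close>

lemma moment_dependency_sign:
  assumes fin: "finite E" and inj: "inj_on k E" and c: "minimal_dependency E n (\<lambda>e j. k e ^ j) c"
    and e: "e \<in> E" "c e \<noteq> 0" and f: "f \<in> E" "c f \<noteq> 0" and ne: "e \<noteq> f"
  shows "0 < c e * c f \<longleftrightarrow> odd (card {g \<in> E. c g \<noteq> 0 \<and> between k e f g})"
proof -
  let ?S = "{e \<in> E. c e \<noteq> 0}"
  let ?T = "?S - {e, f}"
  let ?p = "\<Prod>g\<in>?T. [:- k g, 1:]"
  have lin: "lin_dependency E n (\<lambda>e j. k e ^ j) c" and card: "card ?S = Suc n"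
    using c by (auto simp: minimal_moment_dependency_iff[OF fin inj])
  have "card ?T = card ?S - card {e, f}"
    using e f fin by (intro card_Diff_subset) auto
  moreover have "card {e, f} \<le> card ?S" using e f fin by (intro card_mono) auto
  ultimately have "Suc (Suc (card ?T)) = Suc n" using card ne by simp
  moreover have "degree ?p \<le> card ?T" using fin by (intro degree_prod_linear_le) auto
  ultimately have "(\<Sum>g\<in>E. c g * poly ?p (k g)) = 0"
    by (intro moment_dependency_poly[OF lin]) linarith
  also have "(\<Sum>g\<in>E. c g * poly ?p (k g)) = (\<Sum>g\<in>{e, f}. c g * poly ?p (k g))"
    using fin e f by (intro sum.mono_neutral_right) (auto simp: poly_prod)
  finally have eq: "c e * poly ?p (k e) + c f * poly ?p (k f) = 0" using ne by simp
  have nz: "\<forall>g\<in>?T. (k e - k g) * (k f - k g) \<noteq> 0"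
    using inj e f by (auto simp: inj_on_def)
  have pe: "poly ?p (k e) * poly ?p (k f) = (\<Prod>g\<in>?T. (k e - k g) * (k f - k g))"
    by (simp add: poly_prod prod.distrib)
  have "{g \<in> ?T. (k e - k g) * (k f - k g) < 0} = {g \<in> E. c g \<noteq> 0 \<and> between k e f g}"
    by (auto simp: between_def mult_less_0_iff)
  then have par: "0 < poly ?p (k e) * poly ?p (k f) \<longleftrightarrow>
      even (card {g \<in> E. c g \<noteq> 0 \<and> between k e f g})"
    unfolding pe using fin nz by (subst prod_pos_iff_even_neg) auto
  have nzp: "poly ?p (k e) \<noteq> 0" "poly ?p (k f) \<noteq> 0"
    using nz fin by (auto simp: poly_prod)
  have "(c e * c f) * (poly ?p (k e) * poly ?p (k f)) =
      (c e * poly ?p (k e)) * (c f * poly ?p (k f))" by (simp only: mult_ac)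
  also have "c e * poly ?p (k e) = - (c f * poly ?p (k f))" using eq by linarith
  also have "- (c f * poly ?p (k f)) * (c f * poly ?p (k f)) < 0"
  proof -
    have "0 < (c f * poly ?p (k f))\<^sup>2" using f(2) nzp(2) by simp
    then show ?thesis by (simp only: power2_eq_square mult_minus_left neg_less_0_iff_less)
  qed
  finally have "(c e * c f) * (poly ?p (k e) * poly ?p (k f)) < 0" .
  moreover have "0 < s \<longleftrightarrow> \<not> 0 < t" if "s * t < 0" for s t :: real
    using that by (auto simp: mult_less_0_iff)
  ultimately have "0 < c e * c f \<longleftrightarrow> \<not> 0 < poly ?p (k e) * poly ?p (k f)" by blast
  with par show ?thesis by simp
qed

section \<open>Circuits of reoriented alternating matroids\<close>

context
  fixes E :: "'a set" and n :: nat and F :: "'a set" and k :: "'a \<Rightarrow> real"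
  assumes fin: "finite E" and inj: "inj_on k E"
begin

lemma signed_moment_circuitE:
  assumes "X \<in> realized_om E n (signed_moment F k)"
  obtains c where "minimal_dependency E n (\<lambda>e j. k e ^ j) c"
    "X = sign_pattern E (\<lambda>e. (if e \<in> F then - 1 else 1) * c e)"
proof -
  have "X \<in> reorient F (realized_om E n (\<lambda>e j. k e ^ j))"
    using assms by (simp add: reorient_realized_om signed_moment_def[abs_def])
  then obtain Y where Y: "Y \<in> realized_om E n (\<lambda>e j. k e ^ j)"
    "X = (\<lambda>(P, N). ((P - F) \<union> (N \<inter> F), (N - F) \<union> (P \<inter> F))) Y"
    unfolding reorient_def by blast
  obtain c where c: "minimal_dependency E n (\<lambda>e j. k e ^ j) c" "Y = sign_pattern E c"
    using Y(1) by (rule realized_omE)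
  moreover have "(\<lambda>(P, N). ((P - F) \<union> (N \<inter> F), (N - F) \<union> (P \<inter> F))) (sign_pattern E c) =
      sign_pattern E (\<lambda>e. (if e \<in> F then - 1 else 1) * c e)" for c
    by (auto simp: sign_pattern_def)
  ultimately show ?thesis using that[OF c(1)] Y(2) c(2) by simp
qed

lemma signed_moment_circuit_supp:
  assumes "X \<in> realized_om E n (signed_moment F k)"
  shows "supp X \<subseteq> E" "card (supp X) = Suc n"
proof -
  obtain c where c: "minimal_dependency E n (\<lambda>e j. k e ^ j) c"
    "X = sign_pattern E (\<lambda>e. (if e \<in> F then - 1 else 1) * c e)"
    using assms by (rule signed_moment_circuitE)
  have "supp X = {e \<in> E. c e \<noteq> 0}" unfolding c(2) supp_sign_pattern by auto
  then show "supp X \<subseteq> E" "card (supp X) = Suc n"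
    using c(1) by (auto simp: minimal_moment_dependency_iff[OF fin inj])
qed

text \<open>
  The rule by which all sign questions below are decided: \<open>e\<close> and \<open>f\<close> have equal signs iff the number
  of support elements between them is odd, where each negated end reverses the answer.
\<close>

lemma signed_moment_circuit_sign:
  assumes X: "X \<in> realized_om E n (signed_moment F k)"
    and ef: "e \<in> supp X" "f \<in> supp X" "e \<noteq> f"
  shows "(e \<in> fst X \<longleftrightarrow> f \<in> fst X) \<longleftrightarrow>
     (odd (card {g \<in> supp X. between k e f g}) \<longleftrightarrow> (e \<in> F \<longleftrightarrow> f \<in> F))"
proof -
  obtain c where c: "minimal_dependency E n (\<lambda>e j. k e ^ j) c"
    "X = sign_pattern E (\<lambda>e. (if e \<in> F then - 1 else 1) * c e)"
    using X by (rule signed_moment_circuitE)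
  have S: "supp X = {e \<in> E. c e \<noteq> 0}" unfolding c(2) supp_sign_pattern by auto
  have "0 < c e * c f \<longleftrightarrow> odd (card {g \<in> supp X. between k e f g})"
    using moment_dependency_sign[OF fin inj c(1), of e f] ef unfolding S
    by (simp add: conj_assoc)
  moreover have "e \<in> fst X \<longleftrightarrow> (if e \<in> F then c e < 0 else c e > 0)"
    "f \<in> fst X \<longleftrightarrow> (if f \<in> F then c f < 0 else c f > 0)" "c e \<noteq> 0" "c f \<noteq> 0"
    using ef S by (auto simp: c(2))
  ultimately show ?thesis by (auto simp: zero_less_mult_iff split: if_splits)
qed

lemma signed_moment_circuit_exists:
  assumes S: "S \<subseteq> E" "card S = Suc n" and e: "e \<in> S"
  shows "\<exists>X \<in> realized_om E n (signed_moment F k). supp X = S \<and> e \<in> fst X"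
proof -
  have finS: "finite S" and injS: "inj_on k S" using S fin inj by (auto intro: finite_subset inj_on_subset)
  obtain c where c: "\<forall>e\<in>S. c e \<noteq> 0" "\<forall>j<n. (\<Sum>e\<in>S. c e * k e ^ j) = 0"
    using moment_dependency_exists[OF finS injS S(2)] by blast
  let ?c = "\<lambda>e. if e \<in> S then c e else 0"
  have supp_c: "{e \<in> E. ?c e \<noteq> 0} = S" using c S by auto
  have "(\<Sum>e\<in>E. ?c e * k e ^ j) = (\<Sum>e\<in>S. c e * k e ^ j)" for j
    using fin S by (intro sum.mono_neutral_cong_right) auto
  then have "lin_dependency E n (\<lambda>e j. k e ^ j) ?c"
    using c e S by (auto simp: lin_dependency_def intro!: bexI[of _ e])
  then have minc: "minimal_dependency E n (\<lambda>e j. k e ^ j) ?c"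
    using supp_c S(2) by (simp only: minimal_moment_dependency_iff[OF fin inj])
  define X where "X = (\<lambda>(P, N). ((P - F) \<union> (N \<inter> F), (N - F) \<union> (P \<inter> F))) (sign_pattern E ?c)"
  have "X \<in> reorient F (realized_om E n (\<lambda>e j. k e ^ j))"
    using minc by (auto simp: X_def reorient_def realized_om_eq)
  then have X: "X \<in> realized_om E n (signed_moment F k)"
    by (simp add: reorient_realized_om signed_moment_def[abs_def])
  have "supp X = supp (sign_pattern E ?c)" by (auto simp: X_def supp_def sign_pattern_def)
  then have sX: "supp X = S" by (simp only: supp_sign_pattern supp_c)
  have "prod.swap X \<in> realized_om E n (signed_moment F k)"
    using oriented_matroid_swap[OF oriented_matroid_realized_om[OF fin] X] .
  moreover have "supp (prod.swap X) = S" using sX by (auto simp: supp_def)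
  moreover have "e \<in> fst X \<or> e \<in> fst (prod.swap X)" using sX e by (auto simp: supp_def)
  ultimately show ?thesis using X sX by blast
qed

lemma signed_moment_fundamental_circuit:
  assumes B: "B \<subseteq> E" "card B = n" and e: "e \<in> E - B"
  defines "C \<equiv> fundamental_circuit (realized_om E n (signed_moment F k)) B e"
  shows "C \<in> realized_om E n (signed_moment F k)" "e \<in> fst C" "supp C = insert e B"
proof -
  let ?M = "realized_om E n (signed_moment F k)"
  have finB: "finite B" using B(1) fin by (rule finite_subset)
  have card: "card (insert e B) = Suc n" using B e finB by simp
  then obtain X where X: "X \<in> ?M" "supp X = insert e B" "e \<in> fst X"
    using signed_moment_circuit_exists[of "insert e B" e] B e by auto
  have uniq: "Y = X" if Y: "Y \<in> ?M" "e \<in> fst Y" "supp Y \<subseteq> insert e B" for Y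
  proof -
    have "Y = X \<or> Y = prod.swap X" "fst X \<inter> snd X = {}"
      using oriented_matroid_incomparable[OF oriented_matroid_realized_om[OF fin] Y(1) X(1)]
        oriented_matroid_disjoint[OF oriented_matroid_realized_om[OF fin] X(1)] X(2) Y(3) by simp_all
    then show ?thesis using X(3) Y(2) by (metis disjoint_iff fst_swap)
  qed
  have "C = X"
    unfolding C_def fundamental_circuit_def
  proof (rule the_equality)
    show "X \<in> ?M \<and> e \<in> fst X \<and> supp X \<subseteq> insert e B" using X by simp
  qed (use uniq in blast)
  then show "C \<in> ?M" "e \<in> fst C" "supp C = insert e B" using X by simp_all
qed

lemma signed_moment_basis:
  assumes B: "B \<subseteq> E" "card B = n"
  shows "om_basis E (realized_om E n (signed_moment F k)) B"
  unfolding om_basis_def om_independent_def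
proof (intro conjI ballI)
  have finB: "finite B" using B(1) fin by (rule finite_subset)
  show "\<not> (\<exists>C\<in>realized_om E n (signed_moment F k). supp C \<subseteq> B)"
  proof
    assume "\<exists>C\<in>realized_om E n (signed_moment F k). supp C \<subseteq> B"
    then obtain C where C: "C \<in> realized_om E n (signed_moment F k)" "supp C \<subseteq> B" by blast
    have "card (supp C) \<le> card B" using C(2) finB by (rule card_mono[rotated])
    then show False using signed_moment_circuit_supp(2)[OF C(1)] B by simp
  qed
  fix e assume e: "e \<in> E - B"
  then show "\<not> \<not> (\<exists>C\<in>realized_om E n (signed_moment F k). supp C \<subseteq> insert e B)"
    using signed_moment_circuit_exists[of "insert e B" e] B finB by auto
qed (use B in auto)

end

section \<open>Influence relations, chords and parity\<close>

text \<open>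
  The element of the complementary pair \<open>j\<close>, \<open>j + n\<close> that belongs to the transversal of the vertex
  \<open>v\<close>; the transversal itself is the image of \<open>{..<n}\<close>.
\<close>

definition pair_choice :: "nat \<Rightarrow> nat set \<Rightarrow> nat \<Rightarrow> nat" where
  "pair_choice n v j = (if j \<in> v then j + n else j)"

text \<open>
  The pair \<open>i\<close>, \<open>i + n\<close> is regarded as a chord between the positions \<open>k i\<close> and \<open>k (i + n)\<close>.
\<close>

definition noncrossing :: "nat \<Rightarrow> (nat \<Rightarrow> real) \<Rightarrow> bool" where
  "noncrossing n k \<longleftrightarrow> (\<forall>i<n. \<forall>j<n. i \<noteq> j \<longrightarrow>
     (between k i (i + n) j \<longleftrightarrow> between k i (i + n) (j + n)))"

text \<open>
  For noncrossing chords, this coupling of the two ends of chord \<open>i\<close> makes the signs of \<open>i\<close> and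
  \<open>i + n\<close> agree in every circuit that contains just this one pair.
\<close>

definition balanced :: "nat \<Rightarrow> (nat \<Rightarrow> real) \<Rightarrow> nat set \<Rightarrow> bool" where
  "balanced n k F \<longleftrightarrow> (\<forall>i<n.
     odd (card {j \<in> {..<n}. between k i (i + n) j}) \<longleftrightarrow> (i \<in> F \<longleftrightarrow> i + n \<in> F))"

text \<open>
  The defining condition of a Matousek USO without the normalization of the outmap at the empty
  vertex, so that it is preserved by the reflections that isomorphisms allow.
\<close>

definition influenced_by :: "nat \<Rightarrow> (nat \<times> nat) set \<Rightarrow> (nat set \<Rightarrow> nat set) \<Rightarrow> bool" where
  "influenced_by n G s \<longleftrightarrow> s \<in> Pow {..<n} \<rightarrow>\<^sub>E Pow {..<n} \<and>
     (\<forall>v \<in> Pow {..<n}. \<forall>d < n. \<forall>d' < n.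
        (d' \<in> s v) \<noteq> (d' \<in> s (sym_diff v {d})) \<longleftrightarrow> (d, d') \<in> G)"

text \<open>The ancestor relation of a rooted forest on \<open>{..<n}\<close>, where \<open>(a, b)\<close> says that \<open>a\<close> is an ancestor of \<open>b\<close>.\<close>

definition forest_order :: "nat \<Rightarrow> (nat \<times> nat) set \<Rightarrow> bool" where
  "forest_order n G \<longleftrightarrow> G \<subseteq> {..<n} \<times> {..<n} \<and> (\<forall>d < n. (d, d) \<in> G) \<and> antisym G \<and> trans G \<and>
     (\<forall>a b c. (a, c) \<in> G \<longrightarrow> (b, c) \<in> G \<longrightarrow> (a, b) \<in> G \<or> (b, a) \<in> G)"

text \<open>
  Chord \<open>i\<close> separates the extension element \<open>2 * n\<close> from \<open>j\<close>. For noncrossing chords it does not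
  matter which end of chord \<open>j\<close> is taken.
\<close>

definition chord_order :: "nat \<Rightarrow> (nat \<Rightarrow> real) \<Rightarrow> (nat \<times> nat) set" where
  "chord_order n k = {(i, j). i < n \<and> j < n \<and>
     (i = j \<or> between k i (i + n) (2 * n) \<noteq> between k i (i + n) j)}"

lemma odd_card_xor:
  assumes "finite D"
  shows "odd (card {j \<in> D. P j \<noteq> Q j}) \<longleftrightarrow> odd (card {j \<in> D. P j}) \<noteq> odd (card {j \<in> D. Q j})"
proof -
  have split: "card {j \<in> D. R j} = card {j \<in> D. R j \<and> T j} + card {j \<in> D. R j \<and> \<not> T j}" for R T
  proof -
    have "{j \<in> D. R j} = {j \<in> D. R j \<and> T j} \<union> {j \<in> D. R j \<and> \<not> T j}" by blast
    then show ?thesis using assms by (simp only:) (rule card_Un_disjoint, auto)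
  qed
  have PQ: "card {j \<in> D. P j \<noteq> Q j} =
      card {j \<in> D. P j \<and> \<not> Q j} + card {j \<in> D. Q j \<and> \<not> P j}"
    using split[of "\<lambda>j. P j \<noteq> Q j" P] by (simp add: conj_commute cong: conj_cong)
  have "card {j \<in> D. Q j \<and> P j} = card {j \<in> D. P j \<and> Q j}" by (simp only: conj_commute)
  then show ?thesis unfolding PQ using split[of P Q] split[of Q P] by (simp, blast)
qed

lemma odd_card_change_one:
  assumes "finite D" "i \<in> D" "\<And>j. j \<in> D \<Longrightarrow> j \<noteq> i \<Longrightarrow> P j \<longleftrightarrow> Q j"
  shows "(odd (card {j \<in> D. P j}) \<noteq> odd (card {j \<in> D. Q j})) \<longleftrightarrow> P i \<noteq> Q i"
proof -
  have eq: "{j \<in> D. P j \<noteq> Q j} = (if P i \<noteq> Q i then {i} else {})"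
    using assms(2,3) by auto
  have "odd (card {j \<in> D. P j \<noteq> Q j}) \<longleftrightarrow> P i \<noteq> Q i" unfolding eq by simp
  then show ?thesis unfolding odd_card_xor[OF assms(1)] by blast
qed

lemma between_iff:
  "k g \<noteq> k e \<Longrightarrow> k g \<noteq> k f \<Longrightarrow> between k e f g \<longleftrightarrow> (k e < k g) \<noteq> (k f < k g)"
  by (auto simp: between_def)

text \<open>The relation of two pairs of points on a line that says that they interlace is symmetric.\<close>

lemma between_link:
  assumes "k a \<noteq> k f" "k b \<noteq> k f" "k a \<noteq> k q" "k b \<noteq> k q"
  shows "between k f q a \<noteq> between k f q b \<longleftrightarrow> between k a b q \<noteq> between k a b f"
proof -
  have "k f < k a \<longleftrightarrow> \<not> k a < k f" "k f < k b \<longleftrightarrow> \<not> k b < k f"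
    "k q < k a \<longleftrightarrow> \<not> k a < k q" "k q < k b \<longleftrightarrow> \<not> k b < k q" using assms by linarith+
  then show ?thesis
    using between_iff[of k a f q] between_iff[of k b f q] between_iff[of k q a b]
      between_iff[of k f a b] assms by metis
qed

lemma between_split:
  assumes "k a \<noteq> k f" "k b \<noteq> k f" "k q \<noteq> k f"
  shows "between k a q f \<noteq> between k b q f \<longleftrightarrow> between k a b f"
  using between_iff[of k f a q] between_iff[of k f b q] between_iff[of k f a b] assms by metis

lemma between_ends [simp]: "\<not> between k e f e" "\<not> between k e f f"
  by (auto simp: between_def)

lemma pair_choice_bounds: "v \<subseteq> {..<n} \<Longrightarrow> j < n \<Longrightarrow> pair_choice n v j < 2 * n"
  by (auto simp: pair_choice_def)

lemma pair_choice_eq_iff: "i < n \<Longrightarrow> j < n \<Longrightarrow> pair_choice n v i = pair_choice n w j \<longleftrightarrow> i = j \<and> (i \<in> v \<longleftrightarrow> i \<in> w)"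
  by (auto simp: pair_choice_def)

lemma inj_on_pair_choice: "inj_on (pair_choice n v) {..<n}"
  by (auto simp: inj_on_def pair_choice_eq_iff)

lemma card_transversal: "card {g \<in> pair_choice n v ` {..<n}. Q g} = card {j \<in> {..<n}. Q (pair_choice n v j)}"
proof -
  have "{g \<in> pair_choice n v ` {..<n}. Q g} = pair_choice n v ` {j \<in> {..<n}. Q (pair_choice n v j)}" by auto
  moreover have "inj_on (pair_choice n v) {j \<in> {..<n}. Q (pair_choice n v j)}"
    by (rule inj_on_subset[OF inj_on_pair_choice]) auto
  ultimately show ?thesis by (simp only: card_image)
qed

lemma transversal_eq: "v \<subseteq> {..<n} \<Longrightarrow> ({..<n} - v) \<union> (\<lambda>i. i + n) ` v = pair_choice n v ` {..<n}"
  by (auto simp: pair_choice_def image_iff)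

lemma noncrossing_pair_choice:
  assumes "noncrossing n k" "i < n" "j < n" "i \<noteq> j"
  shows "between k i (i + n) (pair_choice n v j) \<longleftrightarrow> between k i (i + n) j"
  using assms by (auto simp: noncrossing_def pair_choice_def)

lemma odd_between_pair:
  assumes nc: "noncrossing n k" and bal: "balanced n k F" and i: "i < n"
  shows "odd (card {j \<in> {..<n}. between k i (i + n) (pair_choice n v j)}) \<longleftrightarrow> (i \<in> F \<longleftrightarrow> i + n \<in> F)"
proof -
  have "between k i (i + n) (pair_choice n v j) \<longleftrightarrow> between k i (i + n) j" if "j < n" for j
    using noncrossing_pair_choice[OF nc i that] by (cases "j = i") (auto simp: pair_choice_def)
  then have "{j \<in> {..<n}. between k i (i + n) (pair_choice n v j)} = {j \<in> {..<n}. between k i (i + n) j}"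
    by auto
  then show ?thesis using bal i by (simp add: balanced_def)
qed

section \<open>Cyclic-P-matroids\<close>

context
  fixes n :: nat and k :: "nat \<Rightarrow> real" and F :: "nat set"
begin

text \<open>
  Add to any transversal the missing end of chord \<open>i\<close>. The resulting circuit contains exactly one
  complementary pair, so the number of transversal elements below chord \<open>i\<close> has a prescribed parity.
  Switching the transversal at \<open>j\<close> must not change this parity, so both ends of chord \<open>j\<close> are on
  the same side of chord \<open>i\<close>.
\<close>

lemma P_matroid_imp_noncrossing_balanced:
  assumes inj: "inj_on k {..<2 * n}"
    and P: "P_matroid n (realized_om {..<2 * n} n (signed_moment F k))"
  shows "noncrossing n k" "balanced n k F"
proof -
  let ?M = "realized_om {..<2 * n} n (signed_moment F k)"
  have fin: "finite {..<2 * n}" by simp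
  have *: "odd (card {j \<in> {..<n}. between k i (i + n) (pair_choice n v j)}) \<longleftrightarrow> (i \<in> F \<longleftrightarrow> i + n \<in> F)"
    if i: "i < n" and v: "v \<subseteq> {..<n}" for i v
  proof -
    let ?S = "insert i (insert (i + n) (pair_choice n v ` {..<n}))"
    have "?S = insert (pair_choice n ({i} - v) i) (pair_choice n v ` {..<n})"
      using i by (auto simp: pair_choice_def)
    moreover have "pair_choice n ({i} - v) i \<notin> pair_choice n v ` {..<n}" using i by (auto simp: pair_choice_eq_iff)
    ultimately have cardS: "card ?S = Suc n" using card_image[OF inj_on_pair_choice[of n v]] by simp
    have SE: "?S \<subseteq> {..<2 * n}" using i v pair_choice_bounds by auto
    obtain X where X: "X \<in> ?M" "supp X = ?S" "i \<in> fst X"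
      using signed_moment_circuit_exists[OF fin inj SE cardS, of i F] by auto
    have "{j. j < n \<and> {j, j + n} \<subseteq> supp X} = {i}"
      unfolding X(2) using i by (auto simp: pair_choice_def split: if_splits)
    then have "i + n \<notin> snd X" using P X i unfolding P_matroid_def by blast
    then have "i + n \<in> fst X" using X(2) by (auto simp: supp_def)
    moreover have "(i \<in> fst X \<longleftrightarrow> i + n \<in> fst X) \<longleftrightarrow>
        (odd (card {g \<in> supp X. between k i (i + n) g}) \<longleftrightarrow> (i \<in> F \<longleftrightarrow> i + n \<in> F))"
      using i by (intro signed_moment_circuit_sign[OF fin inj X(1)]) (auto simp: X(2))
    ultimately have "odd (card {g \<in> supp X. between k i (i + n) g}) \<longleftrightarrow> (i \<in> F \<longleftrightarrow> i + n \<in> F)"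
      using X(3) by blast
    moreover have "{g \<in> supp X. between k i (i + n) g} =
        {g \<in> pair_choice n v ` {..<n}. between k i (i + n) g}"
      unfolding X(2) by auto
    ultimately show ?thesis by (simp add: card_transversal)
  qed
  show "noncrossing n k"
    unfolding noncrossing_def
  proof (intro allI impI)
    fix i j assume ij: "i < n" "j < n" "i \<noteq> j"
    have "(odd (card {l \<in> {..<n}. between k i (i + n) (pair_choice n {} l)}) \<noteq>
           odd (card {l \<in> {..<n}. between k i (i + n) (pair_choice n {j} l)})) \<longleftrightarrow>
          between k i (i + n) (pair_choice n {} j) \<noteq> between k i (i + n) (pair_choice n {j} j)"
      using ij by (intro odd_card_change_one) (auto simp: pair_choice_def)
    moreover have "{} \<subseteq> {..<n}" "{j} \<subseteq> {..<n}" using ij by auto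
    ultimately have "between k i (i + n) (pair_choice n {} j) \<longleftrightarrow> between k i (i + n) (pair_choice n {j} j)"
      using *[OF ij(1)] by blast
    then show "between k i (i + n) j \<longleftrightarrow> between k i (i + n) (j + n)"
      by (simp add: pair_choice_def)
  qed
  show "balanced n k F"
    unfolding balanced_def using *[of _ "{}"] by (simp add: pair_choice_def)
qed

text \<open>
  A circuit has \<open>n + 1\<close> elements, so by counting, one with exactly one complementary pair arises
  from a transversal by adding the missing end of a chord.
\<close>

lemma P_matroid_if_noncrossing_balanced:
  assumes inj: "inj_on k {..<2 * n}" and nc: "noncrossing n k" and bal: "balanced n k F"
  shows "P_matroid n (realized_om {..<2 * n} n (signed_moment F k))"
proof -
  let ?M = "realized_om {..<2 * n} n (signed_moment F k)"
  have fin: "finite {..<2 * n}" by simp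
  have False if X: "X \<in> ?M" and i: "i < n" "{j. j < n \<and> {j, j + n} \<subseteq> supp X} = {i}"
    and opp: "i \<in> fst X \<and> i + n \<in> snd X \<or> i \<in> snd X \<and> i + n \<in> fst X" for X i
  proof -
    note S = signed_moment_circuit_supp[OF fin inj X]
    have finS: "finite (supp X)" using S by (meson finite_lessThan finite_subset)
    have iS: "i \<in> supp X" "i + n \<in> supp X" using i by auto
    \<comment> \<open>\<open>\<phi>\<close> maps an element to the index of its complementary pair.\<close>
    define \<phi> where "\<phi> = (\<lambda>e. if e < n then e else e - n)"
    have "inj_on \<phi> (supp X - {i + n})"
    proof (intro inj_onI)
      fix e f assume ef: "e \<in> supp X - {i + n}" "f \<in> supp X - {i + n}" "\<phi> e = \<phi> f"
      then have "e < 2 * n" "f < 2 * n" using S by auto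
      show "e = f"
      proof (rule ccontr)
        assume "e \<noteq> f"
        then have "{\<phi> e, \<phi> e + n} \<subseteq> supp X" "\<phi> e < n" "\<phi> e + n \<in> {e, f}"
          using ef \<open>e < 2 * n\<close> \<open>f < 2 * n\<close> by (auto simp: \<phi>_def split: if_splits)
        then have "\<phi> e = i" using i(2) by blast
        then show False using ef \<open>\<phi> e + n \<in> {e, f}\<close> by auto
      qed
    qed
    moreover have "\<phi> ` (supp X - {i + n}) \<subseteq> {..<n}" using S by (auto simp: \<phi>_def)
    moreover have "card (supp X - {i + n}) = n" using S finS iS by simp
    ultimately have surj: "\<phi> ` (supp X - {i + n}) = {..<n}"
      using card_subset_eq[of "{..<n}" "\<phi> ` (supp X - {i + n})"] card_image[of \<phi> "supp X - {i + n}"]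
      by simp
    have rep_some: "j \<in> supp X \<or> j + n \<in> supp X" if j: "j < n" for j
    proof -
      have "j \<in> \<phi> ` (supp X - {i + n})" using surj j by simp
      then obtain e where "e \<in> supp X" "\<phi> e = j" by (elim imageE) blast
      then show ?thesis using S by (auto simp: \<phi>_def split: if_splits)
    qed
    define v where "v = {j. j < n \<and> j + n \<in> supp X}"
    have Srep: "supp X = insert i (pair_choice n v ` {..<n})"
    proof (intro equalityI subsetI)
      fix e assume e: "e \<in> supp X"
      show "e \<in> insert i (pair_choice n v ` {..<n})"
      proof (cases "e < n")
        case True
        show ?thesis
        proof (cases "e = i")
          case False
          then have "e + n \<notin> supp X" using i(2) e True by auto
          then have "pair_choice n v e = e" by (auto simp: pair_choice_def v_def)
          then show ?thesis using True by (auto simp: image_iff intro!: bexI[of _ e])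
        qed simp
      next
        case False
        then have "e - n < n" "e - n + n = e" using e S by auto
        then have "pair_choice n v (e - n) = e" using e by (auto simp: pair_choice_def v_def)
        then show ?thesis using \<open>e - n < n\<close> by (auto simp: image_iff intro!: bexI[of _ "e - n"])
      qed
    next
      fix e assume "e \<in> insert i (pair_choice n v ` {..<n})"
      then show "e \<in> supp X" using iS rep_some by (auto simp: pair_choice_def v_def)
    qed
    have "{g \<in> supp X. between k i (i + n) g} = {g \<in> pair_choice n v ` {..<n}. between k i (i + n) g}"
      unfolding Srep by auto
    then have "odd (card {g \<in> supp X. between k i (i + n) g}) \<longleftrightarrow> (i \<in> F \<longleftrightarrow> i + n \<in> F)"
      using odd_between_pair[OF nc bal i(1), of v] by (simp add: card_transversal)
    then have "i \<in> fst X \<longleftrightarrow> i + n \<in> fst X"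
      using signed_moment_circuit_sign[OF fin inj X iS] i by simp
    moreover have "fst X \<inter> snd X = {}"
      using oriented_matroid_disjoint[OF oriented_matroid_realized_om[OF fin] X] .
    ultimately show False using opp by auto
  qed
  moreover have "om_basis {..<2 * n} ?M {..<n}"
    by (intro signed_moment_basis[OF fin inj]) auto
  moreover have "om_basis {..<2 * n} ?M B" if "B \<subseteq> {..<2 * n}" "card B = n" for B
    using that by (rule signed_moment_basis[OF fin inj])
  ultimately show ?thesis
    unfolding P_matroid_def using oriented_matroid_realized_om[OF fin] by blast
qed

section \<open>The orientation associated with an extension\<close>

lemma associated_USO_mem:
  assumes inj: "inj_on k {..2 * n}" and v: "v \<subseteq> {..<n}" and d: "d < n"
  defines "M \<equiv> realized_om {..2 * n} n (signed_moment F k)"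
  shows "d \<in> associated_USO n M v \<longleftrightarrow>
     \<not> (odd (card {j \<in> {..<n}. between k (pair_choice n v d) (2 * n) (pair_choice n v j)}) \<longleftrightarrow>
        (pair_choice n v d \<in> F \<longleftrightarrow> 2 * n \<in> F))"
proof -
  have fin: "finite {..2 * n}" by simp
  let ?B = "pair_choice n v ` {..<n}"
  let ?C = "fundamental_circuit M ?B (2 * n)"
  have B: "?B \<subseteq> {..2 * n}" "card ?B = n" "2 * n \<in> {..2 * n} - ?B"
    using pair_choice_bounds[OF v] card_image[OF inj_on_pair_choice[of n v]] by (auto simp: less_imp_le)
       (metis less_irrefl)
  note C = signed_moment_fundamental_circuit[OF fin inj B, of F, folded M_def]
  have dj: "fst ?C \<inter> snd ?C = {}"
    using oriented_matroid_disjoint[OF oriented_matroid_realized_om[OF fin] C(1)[unfolded M_def]]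
    by (simp add: M_def)
  have rd: "pair_choice n v d \<in> supp ?C" "pair_choice n v d \<noteq> 2 * n" "2 * n \<in> supp ?C"
    using C(3) d pair_choice_bounds[OF v d] by auto
  have "(d \<in> snd ?C \<or> d + n \<in> snd ?C) \<longleftrightarrow> pair_choice n v d \<in> snd ?C"
  proof -
    have "e \<in> snd ?C \<Longrightarrow> e \<in> insert (2 * n) ?B" for e using C(3) by (auto simp: supp_def)
    moreover have "e \<in> insert (2 * n) ?B \<Longrightarrow> e = d \<or> e = d + n \<Longrightarrow> e = pair_choice n v d" for e
      using d by (auto simp: pair_choice_def split: if_splits)
    ultimately show ?thesis by (metis pair_choice_def)
  qed
  also have "\<dots> \<longleftrightarrow> pair_choice n v d \<notin> fst ?C" using rd dj by (auto simp: supp_def)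
  also have "\<dots> \<longleftrightarrow> \<not> (pair_choice n v d \<in> fst ?C \<longleftrightarrow> 2 * n \<in> fst ?C)" using C(2) by simp
  also have "\<dots> \<longleftrightarrow> \<not> (odd (card {g \<in> supp ?C. between k (pair_choice n v d) (2 * n) g}) \<longleftrightarrow>
      (pair_choice n v d \<in> F \<longleftrightarrow> 2 * n \<in> F))"
    using signed_moment_circuit_sign[OF fin inj, of ?C n F "pair_choice n v d" "2 * n"] C(1) rd
    by (simp add: M_def)
  also have "{g \<in> supp ?C. between k (pair_choice n v d) (2 * n) g} =
      {g \<in> ?B. between k (pair_choice n v d) (2 * n) g}"
    unfolding C(3) by auto
  finally show ?thesis
    using v d by (simp add: associated_USO_def Let_def transversal_eq card_transversal)
qed

text \<open>
  Switching the transversal at \<open>d' \<noteq> d\<close> changes the number of elements between \<open>q\<close> and the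
  representative of \<open>d\<close> by one exactly if the ends of chord \<open>d'\<close> interlace with these two points.
  Switching it at \<open>d\<close> itself replaces the interval between \<open>q\<close> and one end of chord \<open>d\<close> by the
  interval between \<open>q\<close> and the other end. These differ by the part below the chord, and
  balancedness makes the orientation of the edge change.
\<close>

lemma associated_USO_influenced:
  assumes inj: "inj_on k {..2 * n}" and nc: "noncrossing n k" and bal: "balanced n k F"
  defines "M \<equiv> realized_om {..2 * n} n (signed_moment F k)"
  shows "influenced_by n (chord_order n k) (associated_USO n M)"
  unfolding influenced_by_def
proof (intro conjI ballI allI impI)
  show "associated_USO n M \<in> Pow {..<n} \<rightarrow>\<^sub>E Pow {..<n}"
    by (auto simp: associated_USO_def Let_def)
  fix v d' d assume v: "v \<in> Pow {..<n}" and d': "d' < n" and d: "d < n"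
  let ?w = "sym_diff v {d'}" and ?q = "2 * n"
  have w: "?w \<subseteq> {..<n}" using v d' by auto
  have kne: "k e \<noteq> k f" if "e \<le> 2 * n" "f \<le> 2 * n" "e \<noteq> f" for e f
    using inj that by (auto simp: inj_on_def)
  note mem = associated_USO_mem[OF inj _ d, folded M_def]
  show "(d \<in> associated_USO n M v) \<noteq> (d \<in> associated_USO n M ?w) \<longleftrightarrow> (d', d) \<in> chord_order n k"
  proof (cases "d' = d")
    case False
    let ?f = "pair_choice n v d"
    have f: "?f \<noteq> d'" "?f \<noteq> d' + n" "?f < 2 * n"
      using False d d' v pair_choice_bounds by (auto simp: pair_choice_def split: if_splits)
    have wf: "pair_choice n ?w d = ?f" using False by (auto simp: pair_choice_def)
    have "(odd (card {j \<in> {..<n}. between k ?f ?q (pair_choice n v j)}) \<noteq>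
           odd (card {j \<in> {..<n}. between k ?f ?q (pair_choice n ?w j)})) \<longleftrightarrow>
          between k ?f ?q (pair_choice n v d') \<noteq> between k ?f ?q (pair_choice n ?w d')"
      using d' by (intro odd_card_change_one) (auto simp: pair_choice_def)
    also have "\<dots> \<longleftrightarrow> between k ?f ?q d' \<noteq> between k ?f ?q (d' + n)"
      by (auto simp: pair_choice_def)
    also have "\<dots> \<longleftrightarrow> between k d' (d' + n) ?q \<noteq> between k d' (d' + n) ?f"
      using f d' by (intro between_link kne) auto
    also have "between k d' (d' + n) ?f = between k d' (d' + n) d"
      using noncrossing_pair_choice[OF nc d' d False] .
    finally show ?thesis
      using mem[of v] mem[of ?w] v w d d' False wf by (auto simp: chord_order_def)
  next
    case True
    have swap: "pair_choice n ?w j = pair_choice n v j" if "j \<noteq> d" for j using that True by (auto simp: pair_choice_def)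
    have A: "{j \<in> {..<n}. between k (pair_choice n x d) ?q (pair_choice n x j)} =
        {j \<in> {..<n}. j \<noteq> d \<and> between k (pair_choice n x d) ?q (pair_choice n v j)}" if "x \<in> {v, ?w}" for x
    proof -
      have "between k (pair_choice n x d) ?q (pair_choice n x j) \<longleftrightarrow>
          j \<noteq> d \<and> between k (pair_choice n x d) ?q (pair_choice n v j)" for j
        using swap[of j] that by (cases "j = d") auto
      then show ?thesis by auto
    qed
    have "{j \<in> {..<n}. (j \<noteq> d \<and> between k (pair_choice n v d) ?q (pair_choice n v j)) \<noteq>
           (j \<noteq> d \<and> between k (pair_choice n ?w d) ?q (pair_choice n v j))} =
         {j \<in> {..<n}. between k d (d + n) (pair_choice n v j)}"
    proof (intro Collect_cong conj_cong refl)
      fix j assume "j \<in> {..<n}"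
      then have j: "j < n" by simp
      show "((j \<noteq> d \<and> between k (pair_choice n v d) ?q (pair_choice n v j)) \<noteq>
           (j \<noteq> d \<and> between k (pair_choice n ?w d) ?q (pair_choice n v j))) \<longleftrightarrow>
         between k d (d + n) (pair_choice n v j)"
      proof (cases "j = d")
        case True
        then show ?thesis by (auto simp: pair_choice_def)
      next
        case False
        let ?f = "pair_choice n v j"
        have f: "?f \<noteq> d" "?f \<noteq> d + n" "?f < 2 * n"
          using False d j v pair_choice_bounds by (auto simp: pair_choice_def split: if_splits)
        have "between k d ?q ?f \<noteq> between k (d + n) ?q ?f \<longleftrightarrow> between k d (d + n) ?f"
          using f d by (intro between_split kne) auto
        then show ?thesis using False True by (auto simp: pair_choice_def)
      qed
    qed
    then have "(odd (card {j \<in> {..<n}. between k (pair_choice n v d) ?q (pair_choice n v j)}) \<noteq>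
        odd (card {j \<in> {..<n}. between k (pair_choice n ?w d) ?q (pair_choice n ?w j)})) \<longleftrightarrow> (d \<in> F \<longleftrightarrow> d + n \<in> F)"
      using odd_card_xor[of "{..<n}" "\<lambda>j. j \<noteq> d \<and> between k (pair_choice n v d) ?q (pair_choice n v j)"
          "\<lambda>j. j \<noteq> d \<and> between k (pair_choice n ?w d) ?q (pair_choice n v j)"]
        odd_between_pair[OF nc bal d, of v]
      by (simp only: A insert_iff simp_thms finite_lessThan)
    moreover have "(pair_choice n v d = d \<and> pair_choice n ?w d = d + n) \<or> (pair_choice n v d = d + n \<and> pair_choice n ?w d = d)"
      using True by (auto simp: pair_choice_def)
    ultimately have "(d \<in> associated_USO n M v) \<noteq> (d \<in> associated_USO n M ?w)"
      using mem[of v] mem[of ?w] v w by fastforce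
    then show ?thesis using True d by (auto simp: chord_order_def)
  qed
qed

text \<open>
  The projective map \<open>\<rho>\<close> sends \<open>q\<close> to infinity and keeps the cyclic order of the other
  points, so that separation from \<open>q\<close> becomes inclusion in an interval. Intervals of noncrossing
  chords are nested or disjoint.
\<close>

lemma forest_order_chord_order:
  assumes inj: "inj_on k {..2 * n}" and nc: "noncrossing n k"
  shows "forest_order n (chord_order n k)"
proof -
  let ?q = "2 * n"
  define \<rho> where "\<rho> = (\<lambda>e. - 1 / (k e - k ?q))"
  have kne: "k e \<noteq> k f" if "e \<le> 2 * n" "f \<le> 2 * n" "e \<noteq> f" for e f
    using inj that by (auto simp: inj_on_def)
  have less_iff: "\<rho> e < \<rho> f \<longleftrightarrow> ((k e < k f) \<noteq> (k e < k ?q)) \<noteq> (k f < k ?q)"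
    if "e < 2 * n" "f < 2 * n" for e f
  proof -
    have "- 1 / x < - 1 / y \<longleftrightarrow> ((x < y) \<noteq> (x < 0)) \<noteq> (y < 0)" if "x \<noteq> 0" "y \<noteq> 0" for x y :: real
      using that by (cases "x < 0"; cases "y < 0") (auto simp: field_simps)
    from this[of "k e - k ?q" "k f - k ?q"] show ?thesis
      using kne[of e ?q] kne[of f ?q] that by (simp add: \<rho>_def)
  qed
  have \<rho>ne: "\<rho> e \<noteq> \<rho> f" if "e < 2 * n" "f < 2 * n" "e \<noteq> f" for e f
  proof -
    have "k e < k f \<or> k f < k e" using kne[of e f] that by linarith
    then show ?thesis using less_iff[OF that(1,2)] less_iff[OF that(2,1)] by (metis less_asym less_irrefl)
  qed
  have sep: "between \<rho> i (i + n) e \<longleftrightarrow> between k i (i + n) ?q \<noteq> between k i (i + n) e"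
    if "i < n" "e < 2 * n" "e \<noteq> i" "e \<noteq> i + n" for i e
  proof -
    have "between \<rho> i (i + n) e \<longleftrightarrow> (\<rho> i < \<rho> e) \<noteq> (\<rho> (i + n) < \<rho> e)"
      using that by (intro between_iff \<rho>ne) auto
    moreover have "between k i (i + n) e \<longleftrightarrow> (k i < k e) \<noteq> (k (i + n) < k e)"
      using that by (intro between_iff kne) auto
    moreover have "between k i (i + n) ?q \<longleftrightarrow> (k i < k ?q) \<noteq> (k (i + n) < k ?q)"
      using that by (intro between_iff kne) auto
    moreover have "i < 2 * n" "i + n < 2 * n" using that by auto
    ultimately show ?thesis using less_iff[of i e] less_iff[of "i + n" e] that(2) by blast
  qed
  define lo hi where "lo i = min (\<rho> i) (\<rho> (i + n))" and "hi i = max (\<rho> i) (\<rho> (i + n))" for i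
  have both: "between \<rho> i (i + n) j \<longleftrightarrow> between \<rho> i (i + n) (j + n)" if "i < n" "j < n" "i \<noteq> j" for i j
    using sep[of i j] sep[of i "j + n"] nc that by (auto simp: noncrossing_def)
  have order: "(i, j) \<in> chord_order n k \<longleftrightarrow>
      i < n \<and> j < n \<and> (i = j \<or> lo i < lo j \<and> hi j < hi i)" for i j
  proof (cases "i < n \<and> j < n \<and> i \<noteq> j")
    case True
    then have "(i, j) \<in> chord_order n k \<longleftrightarrow> between \<rho> i (i + n) j"
      using sep[of i j] by (auto simp: chord_order_def)
    moreover have "between \<rho> i (i + n) j \<longleftrightarrow> between \<rho> i (i + n) j \<and> between \<rho> i (i + n) (j + n)"
      using both[of i j] True by blast
    moreover have "\<dots> \<longleftrightarrow> lo i < lo j \<and> hi j < hi i"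
      by (auto simp: between_def lo_def hi_def)
    ultimately show ?thesis using True by blast
  qed (auto simp: chord_order_def)
  have lohi: "lo i < hi i" if "i < n" for i
    using \<rho>ne[of i "i + n"] that by (auto simp: lo_def hi_def)
  have chain: "(i, j) \<in> chord_order n k"
    if "i < n" "j < n" "i \<noteq> j" "lo i < lo j" "lo j < hi i" for i j
  proof -
    have "between \<rho> i (i + n) e \<longleftrightarrow> lo i < \<rho> e \<and> \<rho> e < hi i" for e
      by (simp add: between_def lo_def hi_def)
    moreover have "lo j = \<rho> j \<or> lo j = \<rho> (j + n)" by (auto simp: lo_def)
    ultimately have "between \<rho> i (i + n) j \<or> between \<rho> i (i + n) (j + n)"
      using that(4,5) by metis
    then have "between \<rho> i (i + n) j" using both[of i j] that by blast
    then show ?thesis using sep[of i j] that by (auto simp: chord_order_def)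
  qed
  have lone: "lo i \<noteq> lo j" if "i < n" "j < n" "i \<noteq> j" for i j
    using \<rho>ne[of i j] \<rho>ne[of i "j + n"] \<rho>ne[of "i + n" j] \<rho>ne[of "i + n" "j + n"] that
    by (auto simp: lo_def min_def)
  show ?thesis
    unfolding forest_order_def
  proof (intro conjI allI impI)
    show "antisym (chord_order n k)" by (rule antisymI) (auto simp: order)
    show "trans (chord_order n k)" by (rule transI) (auto simp: order)
    fix a b c assume "(a, c) \<in> chord_order n k" "(b, c) \<in> chord_order n k"
    then have abc: "a < n" "b < n" "c < n" "lo a \<le> lo c" "lo b \<le> lo c" "hi c \<le> hi a" "hi c \<le> hi b"
      by (auto simp: order)
    show "(a, b) \<in> chord_order n k \<or> (b, a) \<in> chord_order n k"
    proof (cases "a = b")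
      case True
      then show ?thesis using abc by (simp add: order)
    next
      case False
      then consider "lo a < lo b" | "lo b < lo a" using lone[OF abc(1,2)] by linarith
      then show ?thesis
        using chain[of a b] chain[of b a] abc False lohi[OF abc(3)] by cases auto
    qed
  qed (auto simp: order)
qed

end

section \<open>Matousek-type orientations\<close>

text \<open>An orientation is determined by its influence graph and its outmap at a single vertex.\<close>

lemma influenced_by_sym_diff:
  assumes s: "influenced_by n G s" and v: "v \<subseteq> {..<n}" and X: "X \<subseteq> {..<n}" and j: "j < n"
  shows "j \<in> s (sym_diff v X) \<longleftrightarrow> (j \<in> s v) \<noteq> odd (card {d \<in> X. (d, j) \<in> G})"
proof -
  have "finite X" using X by (rule finite_subset) simp
  then show ?thesis using X
  proof (induction X rule: finite_induct)
    case (insert d X)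
    have eq: "sym_diff v (insert d X) = sym_diff (sym_diff v X) {d}"
      using insert.hyps(2) by blast
    have "(j \<in> s (sym_diff v X)) \<noteq> (j \<in> s (sym_diff (sym_diff v X) {d})) \<longleftrightarrow> (d, j) \<in> G"
    proof -
      have "sym_diff v X \<in> Pow {..<n}" using v insert.prems by blast
      then show ?thesis using s insert.prems j unfolding influenced_by_def by blast
    qed
    moreover have "{e \<in> insert d X. (e, j) \<in> G} =
        (if (d, j) \<in> G then insert d {e \<in> X. (e, j) \<in> G} else {e \<in> X. (e, j) \<in> G})" by auto
    ultimately show ?case unfolding eq using insert by auto
  qed simp
qed

lemma influenced_by_mem:
  assumes "influenced_by n G s" "v \<subseteq> {..<n}" "j < n"
  shows "j \<in> s v \<longleftrightarrow> (j \<in> s {}) \<noteq> odd (card {d \<in> v. (d, j) \<in> G})"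
  using influenced_by_sym_diff[OF assms(1) _ assms(2,3), of "{}"] by simp

text \<open>
  An acyclic relation with loops is a unitriangular matrix over the two-element field, hence
  invertible. The induction removes an element \<open>m\<close> that influences no other one, so that its membership
  in \<open>X\<close> enters only the equation at \<open>m\<close>.
\<close>

lemma parity_system:
  assumes "finite D" and ac: "acyclic (G - Id)" and "\<And>d. d \<in> D \<Longrightarrow> (d, d) \<in> G"
  shows "\<exists>!X. X \<subseteq> D \<and> (\<forall>j\<in>D. odd (card {d \<in> X. (d, j) \<in> G}) \<longleftrightarrow> T j)"
  using assms(1,3)
proof (induction D rule: finite_psubset_induct)
  case (psubset D)
  show ?case
  proof (cases "D = {}")
    case True
    then show ?thesis by auto
  next
    case False
    have "acyclic ((G - Id) \<inter> D \<times> D)" using ac by (rule acyclic_subset) auto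
    then have "wf (((G - Id) \<inter> D \<times> D)\<inverse>)"
      using psubset.hyps by (intro finite_acyclic_wf_converse) auto
    then obtain m where m: "m \<in> D" "\<And>j. j \<in> D \<Longrightarrow> j \<noteq> m \<Longrightarrow> (m, j) \<notin> G"
      using wfE_min[of "((G - Id) \<inter> D \<times> D)\<inverse>" _ D] False by (metis (no_types, lifting)
        Diff_iff IntI SigmaI all_not_in_conv converse_iff pair_in_Id_conv)
    let ?P = "\<lambda>D X. X \<subseteq> D \<and> (\<forall>j\<in>D. odd (card {d \<in> X. (d, j) \<in> G}) \<longleftrightarrow> T j)"
    let ?D = "D - {m}"
    have red: "?P D X \<longleftrightarrow> X \<subseteq> D \<and> ?P ?D (X - {m}) \<and>
        (m \<in> X \<longleftrightarrow> T m \<noteq> odd (card {d \<in> X - {m}. (d, m) \<in> G}))" for X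
    proof (cases "X \<subseteq> D")
      case True
      then have finX: "finite X" using psubset.hyps by (rule finite_subset)
      have "{d \<in> X. (d, j) \<in> G} = {d \<in> X - {m}. (d, j) \<in> G}" if "j \<in> ?D" for j
        using m that by auto
      then have 1: "(\<forall>j\<in>?D. odd (card {d \<in> X. (d, j) \<in> G}) \<longleftrightarrow> T j) \<longleftrightarrow>
          (\<forall>j\<in>?D. odd (card {d \<in> X - {m}. (d, j) \<in> G}) \<longleftrightarrow> T j)" by simp
      have eq: "{d \<in> X. (d, m) \<in> G} = (if m \<in> X then insert m {d \<in> X - {m}. (d, m) \<in> G}
          else {d \<in> X - {m}. (d, m) \<in> G})" using psubset.prems[OF m(1)] by auto
      have 2: "odd (card {d \<in> X. (d, m) \<in> G}) \<longleftrightarrow>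
          (m \<in> X) \<noteq> odd (card {d \<in> X - {m}. (d, m) \<in> G})"
        unfolding eq using finX by (cases "m \<in> X") simp_all
      have "?P D X \<longleftrightarrow> (\<forall>j\<in>?D. odd (card {d \<in> X. (d, j) \<in> G}) \<longleftrightarrow> T j) \<and>
          (odd (card {d \<in> X. (d, m) \<in> G}) \<longleftrightarrow> T m)"
        using True m(1) by blast
      moreover have "X - {m} \<subseteq> ?D" using True by blast
      ultimately show ?thesis unfolding 1 2 using True by blast
    qed simp
    have "\<exists>!Y. ?P ?D Y" using psubset.IH[of ?D] psubset.prems m(1) by blast
    then obtain Y where Y: "?P ?D Y" "\<And>Z. ?P ?D Z \<Longrightarrow> Z = Y" by (elim ex1E) blast
    define X where "X = (if T m \<noteq> odd (card {d \<in> Y. (d, m) \<in> G}) then insert m Y else Y)"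
    have XY: "X - {m} = Y" "X \<subseteq> D" using Y(1) m(1) by (auto simp: X_def)
    have mX: "m \<in> X \<longleftrightarrow> T m \<noteq> odd (card {d \<in> Y. (d, m) \<in> G})" using Y(1) by (auto simp: X_def)
    have PX: "?P D X" unfolding red XY(1) using XY(2) Y(1) mX by blast
    have uniq: "Z = X" if Z: "?P D Z" for Z
    proof -
      have ZY: "Z - {m} = Y" using Z unfolding red[of Z] by (intro Y(2)) blast
      moreover have "m \<in> Z \<longleftrightarrow> m \<in> X" using Z unfolding red[of Z] ZY mX by blast
      ultimately show ?thesis using XY(1) by blast
    qed
    show ?thesis using PX uniq by (rule ex1I)
  qed
qed

lemma influence_graphD:
  assumes "influence_graph n G"
  shows "G \<subseteq> {..<n} \<times> {..<n}" "\<And>d. d < n \<Longrightarrow> (d, d) \<in> G" "acyclic (G - Id)"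
  using assms by (auto simp: influence_graph_def)

lemma influenced_by_cube_orientation:
  assumes "influence_graph n G" "influenced_by n G s"
  shows "cube_orientation n s"
  unfolding cube_orientation_def
proof (intro conjI ballI allI impI)
  show "s \<in> Pow {..<n} \<rightarrow>\<^sub>E Pow {..<n}" using assms(2) by (simp add: influenced_by_def)
  fix v d assume "v \<in> Pow {..<n}" "d < n"
  then have "(d \<in> s v) \<noteq> (d \<in> s (sym_diff v {d})) \<longleftrightarrow> (d, d) \<in> G"
    using assms(2) unfolding influenced_by_def by blast
  then show "d \<in> s v \<longleftrightarrow> d \<notin> s (sym_diff v {d})"
    using influence_graphD(2)[OF assms(1) \<open>d < n\<close>] by blast
qed

text \<open>The sink of a face is the unique solution of a parity system.\<close>

lemma influenced_by_USO:
  assumes G: "influence_graph n G" and s: "influenced_by n G s"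
  shows "USO n s"
  unfolding USO_def
proof (intro conjI ballI)
  show "cube_orientation n s" using assms by (rule influenced_by_cube_orientation)
  fix D v assume D: "D \<in> Pow {..<n}" and v: "v \<in> Pow {..<n}"
  have "finite D" using D by (auto intro: finite_subset)
  then have "\<exists>!X. X \<subseteq> D \<and> (\<forall>j\<in>D. odd (card {d \<in> X. (d, j) \<in> G}) \<longleftrightarrow> j \<in> s v)"
    using D influence_graphD[OF G] by (intro parity_system) auto
  moreover have "(\<forall>j\<in>D. odd (card {d \<in> X. (d, j) \<in> G}) \<longleftrightarrow> j \<in> s v) \<longleftrightarrow>
      s (sym_diff v X) \<inter> D = {}" if X: "X \<subseteq> D" for X
  proof -
    have "(odd (card {d \<in> X. (d, j) \<in> G}) \<longleftrightarrow> j \<in> s v) \<longleftrightarrow> j \<notin> s (sym_diff v X)" if "j \<in> D" for j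
      using influenced_by_sym_diff[OF s, of v X j] v D X that by blast
    then show ?thesis by blast
  qed
  ultimately have "\<exists>!X. X \<subseteq> D \<and> s (sym_diff v X) \<inter> D = {}" by (simp cong: conj_cong)
  then obtain X where X: "X \<subseteq> D" "s (sym_diff v X) \<inter> D = {}"
    "\<And>Y. Y \<subseteq> D \<and> s (sym_diff v Y) \<inter> D = {} \<Longrightarrow> Y = X" by (elim ex1E) blast
  show "\<exists>!x. x \<in> cube_face v D \<and> s x \<inter> D = {}"
  proof (rule ex1I[of _ "sym_diff v X"])
    show "sym_diff v X \<in> cube_face v D \<and> s (sym_diff v X) \<inter> D = {}"
      using X(1,2) unfolding cube_face_def by blast
    fix x assume "x \<in> cube_face v D \<and> s x \<inter> D = {}"
    then obtain Y where "Y \<subseteq> D" "x = sym_diff v Y" "s x \<inter> D = {}" unfolding cube_face_def by blast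
    then show "x = sym_diff v X" using X(3)[of Y] by blast
  qed
qed

text \<open>Reflecting the cube so that the global sink becomes the empty vertex yields the Matousek USO.\<close>

lemma matousek_type_USO_if_influenced_by:
  assumes G: "influence_graph n G" and s: "influenced_by n G s"
  shows "matousek_type_USO n s"
proof -
  have U: "USO n s" using assms by (rule influenced_by_USO)
  then have "\<exists>!x. x \<in> cube_face {} {..<n} \<and> s x \<inter> {..<n} = {}" unfolding USO_def by blast
  then obtain F where F: "F \<subseteq> {..<n}" "s F \<inter> {..<n} = {}" by (auto simp: cube_face_def)
  have sP: "s \<in> Pow {..<n} \<rightarrow>\<^sub>E Pow {..<n}" using s by (simp add: influenced_by_def)
  then have "s F \<subseteq> {..<n}" using F by blast
  then have sF: "s F = {}" using F by blast
  define m where "m = (\<lambda>v \<in> Pow {..<n}. s (sym_diff v F))"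
  have m_eq: "m v = s (sym_diff v F)" if "v \<subseteq> {..<n}" for v using that by (simp add: m_def)
  have inf: "influenced_by n G m"
    unfolding influenced_by_def
  proof (intro conjI ballI allI impI)
    show "m \<in> Pow {..<n} \<rightarrow>\<^sub>E Pow {..<n}"
    proof -
      have "s (sym_diff v F) \<in> Pow {..<n}" if "v \<in> Pow {..<n}" for v
        using that F by (intro PiE_mem[OF sP]) blast
      then show ?thesis unfolding m_def by (rule restrict_PiE_iff[THEN iffD2, rule_format])
    qed
    fix v d d' assume v: "v \<in> Pow {..<n}" "d < n" "d' < n"
    have eq: "sym_diff (sym_diff v {d}) F = sym_diff (sym_diff v F) {d}" by blast
    have "sym_diff v {d} \<subseteq> {..<n}" "v \<subseteq> {..<n}" "sym_diff v F \<in> Pow {..<n}" using v F by auto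
    then show "(d' \<in> m v) \<noteq> (d' \<in> m (sym_diff v {d})) \<longleftrightarrow> (d, d') \<in> G"
      using s v(2,3) unfolding influenced_by_def by (simp only: m_eq eq)
  qed
  then have "matousek_USO n G m"
    unfolding matousek_USO_def using influenced_by_cube_orientation[OF G inf] sF m_eq[of "{}"]
    unfolding influenced_by_def by simp
  moreover have "isomorphic_orientations n s m"
    unfolding isomorphic_orientations_def
  proof (intro exI[of _ F] exI[of _ id] conjI ballI)
    show "id permutes {..<n}" by (rule permutes_id)
    fix v assume v: "v \<in> Pow {..<n}"
    have eq: "sym_diff (sym_diff v F) F = v" by blast
    have "sym_diff v F \<subseteq> {..<n}" using v F by blast
    from m_eq[OF this] show "id ` s v = m (id ` sym_diff v F)"
      unfolding eq by (simp only: image_id id_apply)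
  qed (rule F(1))
  ultimately show ?thesis using U G unfolding matousek_type_USO_def by blast
qed

text \<open>
  Reflections do not affect the influence graph, so it suffices to pull the graph of the
  Matousek USO back along the permutation of the dimensions.
\<close>

lemma influenced_by_if_matousek_type_USO:
  assumes "matousek_type_USO n s"
  obtains G where "influence_graph n G" "influenced_by n G s"
proof -
  obtain G m where G: "influence_graph n G" and m: "matousek_USO n G m"
    and "isomorphic_orientations n s m"
    using assms unfolding matousek_type_USO_def by blast
  then obtain F p where F: "F \<subseteq> {..<n}" and p: "p permutes {..<n}"
    and iso': "\<forall>v \<in> Pow {..<n}. p ` s v = m (p ` (sym_diff v F))"
    unfolding isomorphic_orientations_def by (elim exE conjE)
  note iso = bspec[OF iso']
  have sP: "s \<in> Pow {..<n} \<rightarrow>\<^sub>E Pow {..<n}"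
    using assms by (simp add: matousek_type_USO_def USO_def cube_orientation_def)
  have pn: "p d < n \<longleftrightarrow> d < n" for d using permutes_in_image[OF p, of d] by simp
  have injp: "inj p" using p by (rule permutes_inj)
  define H where "H = {(d, d'). d < n \<and> d' < n \<and> (p d, p d') \<in> G}"
  have "acyclic (H - Id)"
  proof (rule acyclicI, rule allI, rule notI)
    fix x assume x: "(x, x) \<in> (H - Id)\<^sup>+"
    have "(p x, p y) \<in> (G - Id)\<^sup>+" if "(x, y) \<in> (H - Id)\<^sup>+" for x y
      using that
    proof (induction rule: trancl_induct)
      case (base y)
      then show ?case using injp by (intro r_into_trancl) (auto simp: H_def inj_eq)
    next
      case (step y z)
      then have "(p y, p z) \<in> G - Id" using injp by (auto simp: H_def inj_eq)
      with step.IH show ?case by (rule trancl_into_trancl)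
    qed
    with x have "(p x, p x) \<in> (G - Id)\<^sup>+" by blast
    then show False using influence_graphD(3)[OF G] by (simp add: acyclic_def)
  qed
  then have "influence_graph n H"
    using influence_graphD(2)[OF G] pn by (auto simp: influence_graph_def H_def)
  moreover have "influenced_by n H s"
    unfolding influenced_by_def
  proof (intro conjI ballI allI impI)
    fix v d d' assume v: "v \<in> Pow {..<n}" "d < n" "d' < n"
    let ?u = "p ` (sym_diff v F)"
    have w: "sym_diff v {d} \<in> Pow {..<n}" using v by auto
    have "sym_diff (sym_diff v {d}) F = sym_diff (sym_diff v F) {d}" by blast
    then have eq: "p ` (sym_diff (sym_diff v {d}) F) = sym_diff ?u {p d}"
      using injp by (simp add: image_Un image_set_diff)
    have mem: "d' \<in> s x \<longleftrightarrow> p d' \<in> p ` s x" for x using injp by (simp add: inj_image_mem_iff)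
    have u: "?u \<in> Pow {..<n}" using v F pn by auto
    have "(p d' \<in> m ?u) \<noteq> (p d' \<in> m (sym_diff ?u {p d})) \<longleftrightarrow> (p d, p d') \<in> G"
      using m u v(2,3) pn unfolding matousek_USO_def by blast
    then show "(d' \<in> s v) \<noteq> (d' \<in> s (sym_diff v {d})) \<longleftrightarrow> (d, d') \<in> H"
      unfolding mem iso[OF v(1)] iso[OF w] eq using v(2,3) by (simp add: H_def)
  qed (rule sP)
  ultimately show ?thesis by (rule that)
qed

lemma forest_order_influence_graph:
  assumes "forest_order n G" shows "influence_graph n G"
proof -
  have "trans (G - Id)"
    using assms unfolding forest_order_def by (intro trans_diff_Id) auto
  moreover have "irrefl (G - Id)" by (auto simp: irrefl_def)
  ultimately have "acyclic (G - Id)" by (simp add: acyclic_irrefl)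
  then show ?thesis using assms by (simp add: forest_order_def influence_graph_def)
qed

section \<open>Realizing a forest order\<close>

text \<open>
  Triangularity with respect to an arbitrary ranking of the indices, which need not follow their
  numerical order. A permutation that contributes to the determinant never increases the rank, so
  by comparing the sums of all ranks it preserves it everywhere and is the identity.
\<close>

lemma det_unitriangular:
  fixes A :: "'a :: comm_ring_1 mat" and rank :: "nat \<Rightarrow> nat"
  assumes A: "A \<in> carrier_mat m m"
    and diag: "\<And>i. i < m \<Longrightarrow> A $$ (i, i) = 1"
    and tri: "\<And>i j. i < m \<Longrightarrow> j < m \<Longrightarrow> i \<noteq> j \<Longrightarrow> A $$ (i, j) \<noteq> 0 \<Longrightarrow> rank j < rank i"
  shows "det A = 1"
proof -
  have "(\<Prod>i = 0..<m. A $$ (i, p i)) = 0" if p: "p permutes {0..<m}" "p \<noteq> id" for p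
  proof (rule ccontr)
    assume "(\<Prod>i = 0..<m. A $$ (i, p i)) \<noteq> 0"
    then have nz: "A $$ (i, p i) \<noteq> 0" if "i < m" for i
      using that by (metis (no_types, lifting) atLeastLessThan_iff finite_atLeastLessThan prod_zero zero_le)
    have pm: "p i < m" if "i < m" for i using permutes_in_image[OF p(1), of i] that by simp
    have le: "rank (p i) \<le> rank i" if "i < m" for i
      using tri[OF that pm[OF that]] nz[OF that] by (cases "p i = i") auto
    obtain i where i: "p i \<noteq> i" using p(2) by fastforce
    then have im: "i < m" using p(1) by (metis atLeastLessThan_iff permutes_not_in zero_le)
    have "(\<Sum>i = 0..<m. rank (p i)) < (\<Sum>i = 0..<m. rank i)"
      using le im tri[OF im pm[OF im]] nz[OF im] i by (intro sum_strict_mono_ex1) auto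
    moreover have "(\<Sum>i = 0..<m. rank (p i)) = (\<Sum>i = 0..<m. rank i)"
      using sum.permute[OF p(1), of rank] by (simp add: o_def)
    ultimately show False by simp
  qed
  then have "det A = (\<Sum>p\<in>{id}. signof p * (\<Prod>i = 0..<m. A $$ (i, p i)))"
    unfolding det_def'[OF A]
    by (intro sum.mono_neutral_right) (auto simp: finite_permutations permutes_id)
  then show ?thesis using diag by simp
qed

text \<open>
  Listed along the chain, the summands are \<open>1, - 1, 1, \<dots>\<close>. This is the identity that makes the
  entries \<open>2\<close> of the matrix below work.
\<close>

lemma alternating_chain_sum:
  assumes "finite A" and "trans G" "antisym G"
    and "\<And>a b. a \<in> A \<Longrightarrow> b \<in> A \<Longrightarrow> (a, b) \<in> G \<or> (b, a) \<in> G"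
  shows "1 - 2 * (\<Sum>i\<in>A. (- 1) ^ card {a \<in> A. a \<noteq> i \<and> (a, i) \<in> G}) = (- 1 :: real) ^ card A"
  using assms(1,4)
proof (induction A rule: finite_psubset_induct)
  case (psubset A)
  show ?case
  proof (cases "A = {}")
    case False
    have "\<exists>m\<in>A. \<forall>a\<in>A. (a, m) \<in> G"
      using psubset.hyps False psubset.prems
    proof (induction A rule: finite_ne_induct)
      case (singleton x)
      then show ?case by blast
    next
      case (insert x B)
      then obtain m where m: "m \<in> B" "\<forall>a\<in>B. (a, m) \<in> G" by blast
      show ?case
      proof (cases "(x, m) \<in> G")
        case True
        then show ?thesis using m by blast
      next
        case False
        then have "(m, x) \<in> G" using insert.prems[of x m] m by blast
        then show ?thesis using m insert.prems[of x x] assms(2) by (blast dest: transD)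
      qed
    qed
    then obtain m where m: "m \<in> A" "\<And>a. a \<in> A \<Longrightarrow> (a, m) \<in> G" by blast
    let ?B = "A - {m}"
    have cA: "card A = Suc (card ?B)" using m(1) psubset.hyps by (rule card.remove[rotated])
    have "{a \<in> A. a \<noteq> i \<and> (a, i) \<in> G} = {a \<in> ?B. a \<noteq> i \<and> (a, i) \<in> G}" if "i \<in> ?B" for i
    proof -
      have "(m, i) \<notin> G" using m(2)[of i] that assms(3) by (auto dest: antisymD)
      then show ?thesis by auto
    qed
    then have "(\<Sum>i\<in>?B. (- 1 :: real) ^ card {a \<in> A. a \<noteq> i \<and> (a, i) \<in> G}) =
        (\<Sum>i\<in>?B. (- 1) ^ card {a \<in> ?B. a \<noteq> i \<and> (a, i) \<in> G})" by (intro sum.cong) auto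
    moreover have "{a \<in> A. a \<noteq> m \<and> (a, m) \<in> G} = ?B" using m by auto
    ultimately have "(\<Sum>i\<in>A. (- 1 :: real) ^ card {a \<in> A. a \<noteq> i \<and> (a, i) \<in> G}) =
        (- 1) ^ card ?B + (\<Sum>i\<in>?B. (- 1) ^ card {a \<in> ?B. a \<noteq> i \<and> (a, i) \<in> G})"
      using sum.remove[OF psubset.hyps m(1), of "\<lambda>i. (- 1 :: real) ^ card {a \<in> A. a \<noteq> i \<and> (a, i) \<in> G}"]
      by simp
    moreover have "1 - 2 * (\<Sum>i\<in>?B. (- 1) ^ card {a \<in> ?B. a \<noteq> i \<and> (a, i) \<in> G}) =
        (- 1 :: real) ^ card ?B"
      using m(1) psubset.prems by (intro psubset.IH) auto
    ultimately show ?thesis unfolding cA by simp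
  qed simp
qed

text \<open>
  The signs \<open>\<sigma>\<close> will be those of the outmap at the empty vertex. Conjugation with them keeps
  principal minors and only switches the signs of coordinates of solutions.
\<close>

definition forest_matrix :: "nat \<Rightarrow> (nat \<times> nat) set \<Rightarrow> (nat \<Rightarrow> real) \<Rightarrow> real mat" where
  "forest_matrix n G \<sigma> = mat n n (\<lambda>(j, i).
     if i = j then 1 else if (i, j) \<in> G then 2 * \<sigma> i * \<sigma> j else 0)"

lemma submatrix_carrier_nat:
  assumes "A \<in> carrier_mat n n" "S \<subseteq> {..<n}"
  shows "submatrix A S S \<in> carrier_mat (card S) (card S)"
    "\<And>i j. i < card S \<Longrightarrow> j < card S \<Longrightarrow> submatrix A S S $$ (i, j) = A $$ (pick S i, pick S j)"
proof -
  have S: "{i. i < n \<and> i \<in> S} = S" using assms(2) by auto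
  show "submatrix A S S \<in> carrier_mat (card S) (card S)"
    using assms(1) S by (intro carrier_matI) (auto simp: dim_submatrix)
  show "submatrix A S S $$ (i, j) = A $$ (pick S i, pick S j)" if "i < card S" "j < card S" for i j
    using assms(1) S that by (intro submatrix_index) auto
qed

lemma P_matrix_forest_matrix:
  assumes G: "forest_order n G"
  shows "P_matrix n (forest_matrix n G \<sigma>)"
  unfolding P_matrix_def
proof (intro conjI allI impI)
  let ?M = "forest_matrix n G \<sigma>"
  show M: "?M \<in> carrier_mat n n" by (simp add: forest_matrix_def)
  fix S :: "nat set" assume S: "S \<subseteq> {..<n} \<and> S \<noteq> {}"
  then have finS: "finite S" by (auto intro: finite_subset)
  have pickS: "pick S i \<in> S" "pick S i < n" if "i < card S" for i
    using pick_in_set_le[OF that] S by auto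
  have pick_inj: "pick S i \<noteq> pick S j" if "i < card S" "j < card S" "i \<noteq> j" for i j
    using pick_mono_le[of i S j] pick_mono_le[of j S i] that by (metis less_irrefl nat_neq_iff)
  define rank where "rank = (\<lambda>i. card {d. d < n \<and> (d, pick S i) \<in> G})"
  have "det (submatrix ?M S S) = 1"
  proof (rule det_unitriangular[where rank = rank])
    show "submatrix ?M S S \<in> carrier_mat (card S) (card S)"
      using submatrix_carrier_nat(1)[OF M] S by blast
    fix i assume i: "i < card S"
    then show "submatrix ?M S S $$ (i, i) = 1"
      using submatrix_carrier_nat(2)[OF M] S pickS by (simp add: forest_matrix_def)
    fix j assume j: "j < card S" "i \<noteq> j" "submatrix ?M S S $$ (i, j) \<noteq> 0"
    let ?a = "pick S i" and ?b = "pick S j"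
    have ab: "(?b, ?a) \<in> G" "?a \<noteq> ?b"
      using submatrix_carrier_nat(2)[OF M _ i j(1)] S pickS i j pick_inj[OF i j(1,2)]
      by (auto simp: forest_matrix_def split: if_splits)
    have tr: "trans G" "antisym G" "(?a, ?a) \<in> G" using G pickS[OF i] by (auto simp: forest_order_def)
    have "{d. d < n \<and> (d, ?b) \<in> G} \<subset> {d. d < n \<and> (d, ?a) \<in> G}"
    proof
      show "{d. d < n \<and> (d, ?b) \<in> G} \<subseteq> {d. d < n \<and> (d, ?a) \<in> G}"
        using ab(1) tr(1) by (auto dest: transD)
      have "(?a, ?b) \<notin> G" using ab tr(2) by (auto dest: antisymD)
      then show "{d. d < n \<and> (d, ?b) \<in> G} \<noteq> {d. d < n \<and> (d, ?a) \<in> G}"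
        using tr(3) pickS(2)[OF i] by blast
    qed
    then show "rank j < rank i" unfolding rank_def by (intro psubset_card_mono) auto
  qed
  then show "det (submatrix ?M S S) > 0" by simp
qed

text \<open>
  In a candidate solution for \<open>B\<close>, the value \<open>w j - z j\<close> of the variable of index \<open>j\<close> that is not
  forced to vanish is \<open>\<sigma> j\<close>, minus twice the signed sum of the values at the ancestors of \<open>j\<close> in
  \<open>B\<close>. These ancestors form a chain, so by induction along the order the values alternate and
  the sum telescopes: the value at \<open>j\<close> is \<open>\<sigma> j\<close> times \<open>- 1\<close> for each proper ancestor in \<open>B\<close>.
\<close>

lemma forest_order_realizable:
  assumes G: "forest_order n G" and s: "influenced_by n G s"
  shows "realizable_USO n s"
proof -
  have GD: "G \<subseteq> {..<n} \<times> {..<n}" "\<And>d. d < n \<Longrightarrow> (d, d) \<in> G" "antisym G" "trans G"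
    "\<And>a b c. (a, c) \<in> G \<Longrightarrow> (b, c) \<in> G \<Longrightarrow> (a, b) \<in> G \<or> (b, a) \<in> G"
    using G unfolding forest_order_def by blast+
  define \<sigma> :: "nat \<Rightarrow> real" where "\<sigma> j = (if j \<in> s {} then - 1 else 1)" for j
  have sq: "\<sigma> j * (\<sigma> j * x) = x" for j x by (simp add: \<sigma>_def)
  define anc where "anc B j = {i \<in> B. i \<noteq> j \<and> (i, j) \<in> G}" for B j
  define t where "t B j = \<sigma> j * (- 1) ^ card (anc B j)" for B j
  let ?M = "forest_matrix n G \<sigma>" and ?q = "vec n \<sigma>"
  have t_rec: "t B j = \<sigma> j - (\<Sum>i\<in>anc B j. 2 * \<sigma> i * \<sigma> j * t B i)" if B: "B \<subseteq> {..<n}" for B j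
  proof -
    have finB: "finite B" using B by (rule finite_subset) simp
    have "anc B i = {a \<in> anc B j. a \<noteq> i \<and> (a, i) \<in> G}" if "i \<in> anc B j" for i
      using that GD(3,4) by (auto simp: anc_def dest: transD antisymD)
    then have "2 * \<sigma> i * \<sigma> j * t B i =
        2 * \<sigma> j * (- 1) ^ card {a \<in> anc B j. a \<noteq> i \<and> (a, i) \<in> G}" if "i \<in> anc B j" for i
      using that sq[of i] by (simp add: t_def mult_ac)
    then have "(\<Sum>i\<in>anc B j. 2 * \<sigma> i * \<sigma> j * t B i) =
        (\<Sum>i\<in>anc B j. 2 * \<sigma> j * (- 1) ^ card {a \<in> anc B j. a \<noteq> i \<and> (a, i) \<in> G})"
      by (intro sum.cong) auto
    then have "\<sigma> j - (\<Sum>i\<in>anc B j. 2 * \<sigma> i * \<sigma> j * t B i) =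
        \<sigma> j * (1 - 2 * (\<Sum>i\<in>anc B j. (- 1) ^ card {a \<in> anc B j. a \<noteq> i \<and> (a, i) \<in> G}))"
      by (simp add: sum_distrib_left[symmetric] right_diff_distrib)
    also have "\<dots> = \<sigma> j * (- 1) ^ card (anc B j)"
      using finB GD(3-5) by (subst alternating_chain_sum) (auto simp: anc_def)
    finally show ?thesis by (simp add: t_def)
  qed
  have row: "(?M *\<^sub>v z) $ j = z $ j + (\<Sum>i\<in>anc B j. 2 * \<sigma> i * \<sigma> j * z $ i)"
    if "B \<subseteq> {..<n}" "z \<in> carrier_vec n" "j < n" "\<And>i. i < n \<Longrightarrow> i \<notin> B \<Longrightarrow> z $ i = 0" for B z j
  proof -
    have "(?M *\<^sub>v z) $ j = (\<Sum>i = 0..<n. (if i = j then 1 else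
        if (i, j) \<in> G then 2 * \<sigma> i * \<sigma> j else 0) * z $ i)"
      using that by (simp add: forest_matrix_def scalar_prod_def)
    also have "\<dots> = z $ j + (\<Sum>i\<in>{0..<n} - {j}. (if (i, j) \<in> G then 2 * \<sigma> i * \<sigma> j else 0) * z $ i)"
      using that(3) by (subst sum.remove[of _ j]) auto
    also have "(\<Sum>i\<in>{0..<n} - {j}. (if (i, j) \<in> G then 2 * \<sigma> i * \<sigma> j else 0) * z $ i) =
        (\<Sum>i\<in>anc B j. 2 * \<sigma> i * \<sigma> j * z $ i)"
    proof (rule sum.mono_neutral_cong_right)
      show "\<forall>i\<in>{0..<n} - {j} - anc B j. (if (i, j) \<in> G then 2 * \<sigma> i * \<sigma> j else 0) * z $ i = 0"
        using that(4) by (fastforce simp: anc_def)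
    qed (use that(1) in \<open>auto simp: anc_def\<close>)
    finally show ?thesis .
  qed
  have sol: "w $ j - z $ j = t B j"
    if B: "B \<subseteq> {..<n}" and c: "candidate_solution n ?M ?q B w z" and j: "j < n" for B w z j
    using j
  proof (induction "card {i. i < n \<and> (i, j) \<in> G}" arbitrary: j rule: less_induct)
    case less
    have wz: "w \<in> carrier_vec n" "z \<in> carrier_vec n" "w - ?M *\<^sub>v z = ?q"
      "\<And>i. i < n \<Longrightarrow> i \<in> B \<Longrightarrow> w $ i = 0" "\<And>i. i < n \<Longrightarrow> i \<notin> B \<Longrightarrow> z $ i = 0"
      using c by (auto simp: candidate_solution_def)
    have zi: "z $ i = - t B i" if i: "i \<in> anc B j" for i
    proof -
      have i': "i \<in> B" "i < n" "i \<noteq> j" "(i, j) \<in> G" using i B by (auto simp: anc_def)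
      have "{a. a < n \<and> (a, i) \<in> G} \<subset> {a. a < n \<and> (a, j) \<in> G}"
      proof
        show "{a. a < n \<and> (a, i) \<in> G} \<subseteq> {a. a < n \<and> (a, j) \<in> G}"
          using i'(4) GD(4) by (auto dest: transD)
        have "(j, i) \<notin> G" using i' GD(3) by (auto dest: antisymD)
        then show "{a. a < n \<and> (a, i) \<in> G} \<noteq> {a. a < n \<and> (a, j) \<in> G}"
          using GD(2)[OF less.prems] less.prems by blast
      qed
      then have "card {a. a < n \<and> (a, i) \<in> G} < card {a. a < n \<and> (a, j) \<in> G}"
        by (intro psubset_card_mono) auto
      from less.hyps[OF this i'(2)] show ?thesis using wz(4)[OF i'(2,1)] by simp
    qed
    have "dim_vec (?M *\<^sub>v z) = n" by (simp add: forest_matrix_def)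
    then have "(w - ?M *\<^sub>v z) $ j = w $ j - (?M *\<^sub>v z) $ j"
      using less.prems by (intro index_minus_vec(1)) simp
    then have "w $ j - (?M *\<^sub>v z) $ j = \<sigma> j"
      using wz(3) less.prems by simp
    moreover have "(?M *\<^sub>v z) $ j = z $ j + (\<Sum>i\<in>anc B j. 2 * \<sigma> i * \<sigma> j * z $ i)"
      using row[OF B wz(2) less.prems wz(5)] .
    moreover have "(\<Sum>i\<in>anc B j. 2 * \<sigma> i * \<sigma> j * z $ i) = - (\<Sum>i\<in>anc B j. 2 * \<sigma> i * \<sigma> j * t B i)"
      using zi by (simp add: sum_negf)
    ultimately show ?case using t_rec[OF B, of j] by simp
  qed
  have t_cases: "t B j = 1 \<or> t B j = - 1" for B j
    by (cases "even (card (anc B j))") (auto simp: t_def \<sigma>_def)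
  have nd: "nondegenerate n ?M ?q"
    unfolding nondegenerate_def
  proof (intro ballI allI impI notI)
    fix B w z assume B: "B \<in> Pow {..<n}" and c: "candidate_solution n ?M ?q B w z"
      and "\<exists>i<n. w $ i = 0 \<and> z $ i = 0"
    then obtain i where i: "i < n" "w $ i = 0" "z $ i = 0" by blast
    then have "t B i = 0" using sol[of B w z i] B c by simp
    then show False using t_cases[of B i] by auto
  qed
  have re: "realizes n ?M ?q s"
    unfolding realizes_def
  proof
    fix B assume "B \<in> Pow {..<n}"
    then have B: "B \<subseteq> {..<n}" by simp
    define w where "w = vec n (\<lambda>j. if j \<in> B then 0 else t B j)"
    define z where "z = vec n (\<lambda>j. if j \<in> B then - t B j else 0)"
    have wz: "w $ j - z $ j = t B j" "j \<in> B \<Longrightarrow> w $ j = 0" "j \<notin> B \<Longrightarrow> z $ j = 0" if "j < n" for j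
      using that by (auto simp: w_def z_def)
    have zc: "z \<in> carrier_vec n" "w \<in> carrier_vec n" by (simp_all add: z_def w_def)
    have "w - ?M *\<^sub>v z = ?q"
    proof (rule eq_vecI)
      fix j assume "j < dim_vec ?q"
      then have j: "j < n" by simp
      have "dim_vec (?M *\<^sub>v z) = n" by (simp add: forest_matrix_def)
      then have "(w - ?M *\<^sub>v z) $ j = w $ j - (?M *\<^sub>v z) $ j"
        using j by (intro index_minus_vec(1)) simp
      also have "(?M *\<^sub>v z) $ j = z $ j + (\<Sum>i\<in>anc B j. 2 * \<sigma> i * \<sigma> j * z $ i)"
        using zc(1) j wz(3) by (intro row[OF B]) auto
      also have "(\<Sum>i\<in>anc B j. 2 * \<sigma> i * \<sigma> j * z $ i) = - (\<Sum>i\<in>anc B j. 2 * \<sigma> i * \<sigma> j * t B i)"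
        using B by (subst sum_negf[symmetric], intro sum.cong) (auto simp: z_def anc_def)
      finally show "(w - ?M *\<^sub>v z) $ j = ?q $ j" using t_rec[OF B, of j] wz(1)[OF j] j by simp
    qed (simp add: forest_matrix_def)
    then have c: "candidate_solution n ?M ?q B w z"
      unfolding candidate_solution_def using zc wz by blast
    have mem: "j \<in> s B \<longleftrightarrow> w $ j \<le> 0 \<and> z $ j \<le> 0" if j: "j < n" for j
    proof -
      have finB: "finite B" using B by (rule finite_subset) simp
      have "{d \<in> B. (d, j) \<in> G} = (if j \<in> B then insert j (anc B j) else anc B j)"
        using GD(2)[OF j] by (auto simp: anc_def)
      moreover have "finite (anc B j)" "j \<notin> anc B j" using finB by (auto simp: anc_def)
      ultimately have "odd (card {d \<in> B. (d, j) \<in> G}) \<longleftrightarrow> (j \<in> B) \<noteq> odd (card (anc B j))" by simp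
      then have "j \<in> s B \<longleftrightarrow> (j \<in> s {}) \<noteq> ((j \<in> B) \<noteq> odd (card (anc B j)))"
        using influenced_by_mem[OF s B j] by simp
      moreover have "t B j \<le> 0 \<longleftrightarrow> (j \<in> s {}) \<noteq> odd (card (anc B j))"
        by (cases "even (card (anc B j))") (auto simp: t_def \<sigma>_def)
      moreover have "- t B j \<le> 0 \<longleftrightarrow> \<not> t B j \<le> 0" using t_cases[of B j] by auto
      ultimately show ?thesis using j by (auto simp: w_def z_def)
    qed
    have "s B \<subseteq> {..<n}" using s B by (auto simp: influenced_by_def)
    then have "s B = {i. i < n \<and> w $ i \<le> 0 \<and> z $ i \<le> 0}" using mem by auto
    with c show "\<exists>w z. candidate_solution n ?M ?q B w z \<and> s B = {i. i < n \<and> w $ i \<le> 0 \<and> z $ i \<le> 0}"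
      by blast
  qed
  have "USO n s" using influenced_by_USO[OF forest_order_influence_graph[OF G] s] .
  moreover have "?q \<in> carrier_vec n" by simp
  ultimately show ?thesis
    unfolding realizable_USO_def using P_matrix_forest_matrix[OF G] nd re by blast
qed

section \<open>Realizable orientations have forest orders\<close>

text \<open>
  The part \<open>z\<close> of the candidate solution for \<open>B\<close>, rescaled by signs such that the outmap at
  the empty vertex becomes empty. Then the influence graph alone prescribes the signs of all solutions.
\<close>

definition lcp_solution ::
    "nat \<Rightarrow> (nat \<times> nat) set \<Rightarrow> (nat \<Rightarrow> nat \<Rightarrow> real) \<Rightarrow> (nat \<Rightarrow> real) \<Rightarrow> nat set \<Rightarrow>
     (nat \<Rightarrow> real) \<Rightarrow> bool" where
  "lcp_solution n G N r B z \<longleftrightarrow>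
     (\<forall>j<n. let w = r j + (\<Sum>i\<in>B. N j i * z i);
                e = even (card {d \<in> B. (d, j) \<in> G})
       in if j \<in> B then w = 0 \<and> (if e then 0 < z j else z j < 0)
          else if e then 0 < w else w < 0)"

lemma realizable_normal_form:
  assumes real: "realizable_USO n s" and s: "influenced_by n G s"
  obtains N r where "\<And>B. B \<subseteq> {..<n} \<Longrightarrow> \<exists>z. lcp_solution n G N r B z"
proof -
  obtain M q where M: "M \<in> carrier_mat n n" and q: "q \<in> carrier_vec n"
    and nd: "nondegenerate n M q" and re: "realizes n M q s"
    using real unfolding realizable_USO_def P_matrix_def by blast
  define \<sigma> :: "nat \<Rightarrow> real" where "\<sigma> j = (if j \<in> s {} then - 1 else 1)" for j
  have sq: "\<sigma> j * (\<sigma> j * x) = x" for j x by (simp add: \<sigma>_def)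
  define N where "N = (\<lambda>j i. \<sigma> j * \<sigma> i * M $$ (j, i))"
  define r where "r = (\<lambda>j. \<sigma> j * q $ j)"
  have "\<exists>z. lcp_solution n G N r B z" if B: "B \<subseteq> {..<n}" for B
  proof -
    obtain w z where c: "candidate_solution n M q B w z"
      and sB: "s B = {i. i < n \<and> w $ i \<le> 0 \<and> z $ i \<le> 0}"
      using re B unfolding realizes_def by blast
    have wz: "w \<in> carrier_vec n" "z \<in> carrier_vec n" "w - M *\<^sub>v z = q"
      "\<And>i. i < n \<Longrightarrow> i \<in> B \<Longrightarrow> w $ i = 0" "\<And>i. i < n \<Longrightarrow> i \<notin> B \<Longrightarrow> z $ i = 0"
      using c by (auto simp: candidate_solution_def)
    have nz: "w $ j \<noteq> 0 \<or> z $ j \<noteq> 0" if "j < n" for j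
      using nd c B that unfolding nondegenerate_def by blast
    have row: "w $ j = q $ j + (\<Sum>i\<in>B. M $$ (j, i) * z $ i)" if j: "j < n" for j
    proof -
      have "(M *\<^sub>v z) $ j = (\<Sum>i = 0..<n. M $$ (j, i) * z $ i)"
        using M wz(2) j by (simp add: scalar_prod_def)
      also have "\<dots> = (\<Sum>i\<in>B. M $$ (j, i) * z $ i)"
        using B wz(5) by (intro sum.mono_neutral_right) auto
      finally have "(M *\<^sub>v z) $ j = (\<Sum>i\<in>B. M $$ (j, i) * z $ i)" .
      moreover have "dim_vec (M *\<^sub>v z) = n" using M by simp
      then have "(w - M *\<^sub>v z) $ j = w $ j - (M *\<^sub>v z) $ j"
        using j by (intro index_minus_vec(1)) simp
      ultimately show ?thesis using wz(3) by simp
    qed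
    have "lcp_solution n G N r B (\<lambda>i. \<sigma> i * z $ i)"
      unfolding lcp_solution_def
    proof (intro allI impI)
      fix j assume j: "j < n"
      have "N j i * (\<sigma> i * z $ i) = \<sigma> j * (M $$ (j, i) * z $ i)" for i
        using sq[of i "\<sigma> j * (M $$ (j, i) * z $ i)"] by (simp add: N_def mult_ac)
      then have "(\<Sum>i\<in>B. N j i * (\<sigma> i * z $ i)) = (\<Sum>i\<in>B. \<sigma> j * (M $$ (j, i) * z $ i))"
        by (intro sum.cong refl)
      then have W: "r j + (\<Sum>i\<in>B. N j i * (\<sigma> i * z $ i)) = \<sigma> j * w $ j"
        by (simp add: row[OF j] r_def distrib_left flip: sum_distrib_left)
      have mem: "j \<in> s B \<longleftrightarrow> (j \<in> s {}) \<noteq> odd (card {d \<in> B. (d, j) \<in> G})"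
        using influenced_by_mem[OF s B j] .
      show "let w = r j + (\<Sum>i\<in>B. N j i * (\<sigma> i * z $ i));
               e = even (card {d \<in> B. (d, j) \<in> G})
         in if j \<in> B then w = 0 \<and> (if e then 0 < \<sigma> j * z $ j else \<sigma> j * z $ j < 0)
            else if e then 0 < w else w < 0"
      proof (cases "j \<in> B")
        case True
        then have zero: "w $ j = 0" and nonzero: "z $ j \<noteq> 0" using wz(4)[OF j] nz[OF j] by auto
        have "j \<in> s B \<longleftrightarrow> w $ j \<le> 0 \<and> z $ j \<le> 0" unfolding sB using j by simp
        also have "\<dots> \<longleftrightarrow> z $ j < 0" using zero nonzero by linarith
        finally have neg: "z $ j < 0 \<longleftrightarrow> (j \<in> s {}) \<noteq> odd (card {d \<in> B. (d, j) \<in> G})"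
          using mem by blast
        have pos: "0 < z $ j \<longleftrightarrow> \<not> z $ j < 0" using nonzero by linarith
        show ?thesis unfolding W Let_def
          by (cases "j \<in> s {}") (simp_all add: True \<sigma>_def zero pos neg)
      next
        case False
        then have zero: "z $ j = 0" and nonzero: "w $ j \<noteq> 0" using wz(5)[OF j] nz[OF j] by auto
        have "j \<in> s B \<longleftrightarrow> w $ j \<le> 0 \<and> z $ j \<le> 0" unfolding sB using j by simp
        also have "\<dots> \<longleftrightarrow> w $ j < 0" using zero nonzero by linarith
        finally have neg: "w $ j < 0 \<longleftrightarrow> (j \<in> s {}) \<noteq> odd (card {d \<in> B. (d, j) \<in> G})"
          using mem by blast
        have pos: "0 < w $ j \<longleftrightarrow> \<not> w $ j < 0" using nonzero by linarith
        show ?thesis unfolding W Let_def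
          by (cases "j \<in> s {}") (simp_all add: False \<sigma>_def zero pos neg)
      qed
    qed
    then show ?thesis by blast
  qed
  then show ?thesis by (rule that)
qed

lemma card_filter_singleton: "card {d. d = a \<and> P d} = (if P a then 1 else 0)"
proof -
  have "{d. d = a \<and> P d} = (if P a then {a} else {})" by auto
  then show ?thesis by simp
qed

lemma card_filter_pair:
  assumes "a \<noteq> b"
  shows "card {d. (d = a \<or> d = b) \<and> P d} = (if P a then 1 else 0) + (if P b then 1 else 0)"
proof -
  have "{d. (d = a \<or> d = b) \<and> P d} = (if P a then {a} else {}) \<union> (if P b then {b} else {})" by auto
  then show ?thesis using assms by simp
qed

text \<open>
  In the plane of the variables \<open>a\<close>, \<open>b\<close>, the solutions for the four vertices of the face
  \<open>{a, b}\<close> are \<open>(0, 0)\<close>, \<open>(- p, 0)\<close>, \<open>(0, - t)\<close> and \<open>(- x, - y)\<close>. Because \<open>w\<^sub>a\<close> is positive at the third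
  point, the fourth lies beyond the line through the second and third. The slack \<open>w\<^sub>c\<close> is negative
  at the second and third point, but positive at the other two, although the diagonals cross.
\<close>

lemma quadrilateral_infeasible:
  fixes p t x y Naa Nab Nba Nbb Nca Ncb ra rb rc :: real
  assumes "0 < ra" "0 < rc" "0 < p" "0 < t" "0 < x" "0 < y"
    and a: "ra = Naa * p" "rc < Nca * p"
    and b: "rc < Ncb * t" "Nab * t < ra"
    and ab: "ra = Naa * x + Nab * y" "Nca * x + Ncb * y < rc"
  shows False
proof -
  have A: "0 < Naa" using assms(1,3) a(1) by (simp add: zero_less_mult_iff)
  have "Nab * y < ra * (y / t)" using b(2) assms(4,6) by (simp add: field_simps)
  then have "Naa * p < Naa * x + Naa * p * (y / t)" using ab(1) a(1) by simp
  moreover have "Naa * p * (x / p + y / t) = Naa * x + Naa * p * (y / t)"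
    using assms(3) by (simp add: distrib_left)
  ultimately have "Naa * p * 1 < Naa * p * (x / p + y / t)" by simp
  then have gt: "1 < x / p + y / t" using A assms(3) by (simp only: mult_less_cancel_left_pos mult_pos_pos)
  have "rc * (x / p) < Nca * x" using a(2) assms(3,5) by (simp add: field_simps)
  moreover have "rc * (y / t) < Ncb * y" using b(1) assms(4,6) by (simp add: field_simps)
  ultimately have "rc * (x / p + y / t) < rc * 1" using ab(2) by (simp add: distrib_left)
  then have "x / p + y / t < 1" using assms(2) by (simp only: mult_less_cancel_left_pos)
  with gt show False by simp
qed

text \<open>
  The positive slacks at the point \<open>(- \<xi>, - \<tau>)\<close> force \<open>U\<close> and \<open>V\<close> to be negative, and they give
  \<open>A * C < U * V\<close>. For negative \<open>U\<close> and \<open>V\<close>, the signs at the other solutions give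
  \<open>U * V < A * C\<close>, which is the positivity of the determinant of the matrix with rows \<open>(A, U)\<close> and
  \<open>(V, C)\<close>.
\<close>

lemma planar_infeasible:
  fixes A C U V qa qc \<alpha> \<gamma> \<xi> \<tau> :: real
  assumes pos: "0 < qa" "qc < 0" "0 < \<alpha>" "0 < \<gamma>" "0 < \<xi>" "0 < \<tau>"
    and eqs: "qa = A * \<alpha>" "qc - V * \<alpha> < 0" "qc + C * \<gamma> = 0" "0 < qa + U * \<gamma>"
    and X: "0 < qa - A * \<xi> - U * \<tau>" "0 < qc - V * \<xi> - C * \<tau>"
  shows False
proof -
  have A: "0 < A" using pos eqs by (simp add: zero_less_mult_iff)
  have "0 < C * \<gamma>" using pos eqs by linarith
  then have C: "0 < C" using pos by (simp add: zero_less_mult_iff)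
  have C\<tau>: "0 < C * \<tau>" using C pos by simp
  then have "V * \<xi> < 0" using X(2) pos(2) by linarith
  then have V: "V < 0" using pos by (simp add: mult_less_0_iff)
  have v: "C * \<tau> < - V * (\<xi> - \<alpha>)" using X(2) eqs(2) by (simp add: algebra_simps)
  then have "0 < - V * (\<xi> - \<alpha>)" using C\<tau> by linarith
  then have \<xi>\<alpha>: "0 < \<xi> - \<alpha>" using V by (intro zero_less_mult_pos[of "- V" "\<xi> - \<alpha>"]) simp_all
  have u: "A * (\<xi> - \<alpha>) < - U * \<tau>" using X(1) eqs(1) by (simp add: algebra_simps)
  moreover have "0 < A * (\<xi> - \<alpha>)" using A \<xi>\<alpha> by simp
  ultimately have "0 < - U * \<tau>" by linarith
  then have U: "U < 0" using pos by (simp add: zero_less_mult_iff mult_less_0_iff)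
  have "(A * (\<xi> - \<alpha>)) * (C * \<tau>) < (- U * \<tau>) * (- V * (\<xi> - \<alpha>))"
    using u v \<open>0 < A * (\<xi> - \<alpha>)\<close> C\<tau> by (intro mult_strict_mono[of "A * (\<xi> - \<alpha>)" "- U * \<tau>"]) linarith+
  then have "(A * C) * ((\<xi> - \<alpha>) * \<tau>) < (U * V) * ((\<xi> - \<alpha>) * \<tau>)" by (simp add: mult_ac)
  then have 1: "A * C < U * V" using \<xi>\<alpha> pos by (simp only: mult_less_cancel_right_pos mult_pos_pos)
  have "- V * \<alpha> < C * \<gamma>" "- U * \<gamma> < A * \<alpha>" using eqs by linarith+
  then have "(- V * \<alpha>) * (- U * \<gamma>) < (C * \<gamma>) * (A * \<alpha>)"
    using U V pos \<open>0 < C * \<gamma>\<close>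
    by (intro mult_strict_mono[of "- V * \<alpha>" "C * \<gamma>"]) (simp_all add: mult_nonpos_nonneg)
  then have "(U * V) * (\<alpha> * \<gamma>) < (A * C) * (\<alpha> * \<gamma>)" by (simp add: mult_ac)
  then have "U * V < A * C" using pos by (simp only: mult_less_cancel_right_pos mult_pos_pos)
  with 1 show False by simp
qed

text \<open>
  The signs belong to \<open>a \<rightarrow> b \<rightarrow> c\<close> without \<open>a \<rightarrow> c\<close>; here \<open>l i x y t\<close> is the slack of row \<open>i\<close>. The slack
  of \<open>b\<close> is negative at the solution for \<open>{a}\<close> and positive at the one for \<open>{c}\<close>, so it vanishes
  at some convex combination of the two. Eliminating the variable \<open>y\<close> by means of row \<open>b\<close> puts
  this point into one plane with the solutions for the vertices that contain \<open>b\<close>.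
\<close>

lemma path_infeasible:
  fixes N :: "_ \<Rightarrow> _ \<Rightarrow> real" and l :: "'i \<Rightarrow> real \<Rightarrow> real \<Rightarrow> real \<Rightarrow> real"
  assumes l: "\<And>i x y t. l i x y t = q i + N i a * x + N i b * y + N i c * t"
    and o: "0 < l b 0 0 0"
    and A: "x2 < 0" "l a x2 0 0 = 0" "l b x2 0 0 < 0" "0 < l c x2 0 0"
    and B: "y1 < 0" "l b 0 y1 0 = 0" "0 < l a 0 y1 0" "l c 0 y1 0 < 0"
    and C: "t3 < 0" "l c 0 0 t3 = 0" "0 < l a 0 0 t3" "0 < l b 0 0 t3"
    and AB: "x4 < 0" "l a x4 y4 0 = 0" "l b x4 y4 0 = 0" "l c x4 y4 0 < 0"
    and BC: "0 < t5" "l b 0 y5 t5 = 0" "l c 0 y5 t5 = 0" "0 < l a 0 y5 t5"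
  shows False
proof -
  have "0 < - (N b b * y1)" using o B(2) by (simp add: l)
  then have bb: "0 < N b b" using B(1) by (simp add: zero_less_mult_iff mult_less_0_iff)
  \<comment> \<open>The Schur complement of the pivot \<open>N b b\<close>.\<close>
  define S where "S i j = N i j - N i b * N b j / N b b" for i j
  define p where "p i = q i - N i b * q b / N b b" for i
  have red: "l i x y t = p i + S i a * x + S i c * t" if "l b x y t = 0" for i x y t
  proof -
    have "N b b * y = - (q b + N b a * x + N b c * t)" using that by (simp add: l)
    then have "y = - (q b + N b a * x + N b c * t) / N b b" using bb by (simp add: field_simps)
    then show ?thesis
      by (simp only: l S_def p_def)
        (simp add: algebra_simps add_divide_distrib diff_divide_distrib)
  qed
  \<comment> \<open>The weight at which the slack of \<open>b\<close> vanishes on the segment between the solutions for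
    \<open>{a}\<close> and \<open>{c}\<close>.\<close>
  define \<theta> where "\<theta> = l b 0 0 t3 / (l b 0 0 t3 - l b x2 0 0)"
  have den: "0 < l b 0 0 t3 - l b x2 0 0" using A C by simp
  have \<theta>: "0 < \<theta>" "\<theta> < 1" using A C den by (simp_all add: \<theta>_def field_simps)
  have mix: "l i (\<theta> * x2) 0 ((1 - \<theta>) * t3) = \<theta> * l i x2 0 0 + (1 - \<theta>) * l i 0 0 t3" for i
    by (simp add: l algebra_simps)
  have "\<theta> * (l b 0 0 t3 - l b x2 0 0) = l b 0 0 t3" using den by (simp add: \<theta>_def)
  then have "l b (\<theta> * x2) 0 ((1 - \<theta>) * t3) = 0" unfolding mix by (simp add: algebra_simps)
  note redX = red[OF this]
  have "0 < l a (\<theta> * x2) 0 ((1 - \<theta>) * t3)" "0 < l c (\<theta> * x2) 0 ((1 - \<theta>) * t3)"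
    unfolding mix using A C \<theta> by simp_all
  then have X: "0 < p a - S a a * - (\<theta> * x2) - S a c * - ((1 - \<theta>) * t3)"
    "0 < p c - S c a * - (\<theta> * x2) - S c c * - ((1 - \<theta>) * t3)"
    unfolding redX by simp_all
  show False
  proof (rule planar_infeasible[OF _ _ _ _ _ _ _ _ _ _ X])
    show "0 < p a" "p c < 0" using B(3,4) red[OF B(2)] by simp_all
    show "0 < - x4" "0 < t5" "0 < - (\<theta> * x2)" "0 < - ((1 - \<theta>) * t3)"
      using AB(1) BC(1) A(1) C(1) \<theta> by (simp_all add: mult_less_0_iff)
    show "p a = S a a * - x4" "p c - S c a * - x4 < 0" using AB(2,4) red[OF AB(3)] by simp_all
    show "p c + S c c * t5 = 0" "0 < p a + S a c * t5" using BC(3,4) red[OF BC(2)] by simp_all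
  qed
qed

text \<open>
  A violation of transitivity, or of the chain condition, involves three dimensions. Acyclicity
  determines the remaining edges between them, and with them the signs of the solutions for the
  vertices of the face that these dimensions span.
\<close>

lemma realizable_imp_forest_order:
  assumes G: "influence_graph n G" and s: "influenced_by n G s" and real: "realizable_USO n s"
  shows "forest_order n G"
proof -
  note GD = influence_graphD[OF G]
  obtain N r where sol: "\<And>B. B \<subseteq> {..<n} \<Longrightarrow> \<exists>z. lcp_solution n G N r B z"
    using realizable_normal_form[OF real s] by blast
  have no_cycle: False if "(x, y) \<in> (G - Id)\<^sup>+" "(y, x) \<in> (G - Id)\<^sup>+" for x y
    using GD(3) trancl_trans[OF that] by (simp add: acyclic_def)
  have anti: "(y, x) \<notin> G" if "(x, y) \<in> G" "x \<noteq> y" for x y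
  proof
    assume "(y, x) \<in> G"
    then have "(x, y) \<in> G - Id" "(y, x) \<in> G - Id" using that by auto
    then show False using no_cycle[of x y] by blast
  qed
  have lt: "x < n" "y < n" if "(x, y) \<in> G" for x y using GD(1) that by auto
  have tr: "(a, c) \<in> G" if ab: "(a, b) \<in> G" and bc: "(b, c) \<in> G" for a b c
  proof (rule ccontr)
    assume ac: "(a, c) \<notin> G"
    have ne: "a \<noteq> b" "b \<noteq> c" using ab bc ac by auto
    then have "a \<noteq> c" using ab bc anti by auto
    have ca: "(c, a) \<notin> G"
    proof
      assume ca: "(c, a) \<in> G"
      have "(a, b) \<in> (G - Id)\<^sup>+" using ab ne by auto
      moreover have "(b, a) \<in> (G - Id)\<^sup>+"
        using bc ca ne \<open>a \<noteq> c\<close>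
        by (intro trancl_trans[OF r_into_trancl r_into_trancl, of b c _ a]) auto
      ultimately show False by (rule no_cycle)
    qed
    note abc = lt[OF ab] lt[OF bc]
    note rel = ab bc ac ca anti[OF ab ne(1)] anti[OF bc ne(2)] GD(2)[OF abc(1)] GD(2)[OF abc(2)]
      GD(2)[OF abc(4)] ne \<open>a \<noteq> c\<close> ne[symmetric] \<open>a \<noteq> c\<close>[symmetric]
    have inst: "\<exists>z. lcp_solution n G N r B z" if "B \<subseteq> {a, b, c}" for B
      using that abc by (intro sol) auto
    obtain z0 where z0: "lcp_solution n G N r {} z0" using inst[of "{}"] by auto
    obtain z1 where z1: "lcp_solution n G N r {b} z1" using inst[of "{b}"] by auto
    obtain z2 where z2: "lcp_solution n G N r {a} z2" using inst[of "{a}"] by auto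
    obtain z3 where z3: "lcp_solution n G N r {c} z3" using inst[of "{c}"] by auto
    obtain z4 where z4: "lcp_solution n G N r {a, b} z4" using inst[of "{a, b}"] by auto
    obtain z5 where z5: "lcp_solution n G N r {b, c} z5" using inst[of "{b, c}"] by auto
    let ?l = "\<lambda>i x y t. r i + N i a * x + N i b * y + N i c * t"
    have at: "let w = r j + (\<Sum>i\<in>B. N j i * z i); e = even (card {d \<in> B. (d, j) \<in> G})
       in if j \<in> B then w = 0 \<and> (if e then 0 < z j else z j < 0)
          else if e then 0 < w else w < 0"
      if "lcp_solution n G N r B z" "j \<in> {a, b, c}" for B z j
      using that abc unfolding lcp_solution_def by blast
    note simps = Let_def card_filter_singleton card_filter_pair rel
    show False
    proof (rule path_infeasible[where l = ?l and a = a and b = b and c = c and q = r and N = N])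
      show "0 < ?l b 0 0 0" using at[OF z0, of b] by simp
      show "z2 a < 0" "?l a (z2 a) 0 0 = 0" "?l b (z2 a) 0 0 < 0" "0 < ?l c (z2 a) 0 0"
        using at[OF z2, of a] at[OF z2, of b] at[OF z2, of c] by (simp_all add: simps)
      show "z1 b < 0" "?l b 0 (z1 b) 0 = 0" "0 < ?l a 0 (z1 b) 0" "?l c 0 (z1 b) 0 < 0"
        using at[OF z1, of a] at[OF z1, of b] at[OF z1, of c] by (simp_all add: simps)
      show "z3 c < 0" "?l c 0 0 (z3 c) = 0" "0 < ?l a 0 0 (z3 c)" "0 < ?l b 0 0 (z3 c)"
        using at[OF z3, of a] at[OF z3, of b] at[OF z3, of c] by (simp_all add: simps)
      show "z4 a < 0" "?l a (z4 a) (z4 b) 0 = 0" "?l b (z4 a) (z4 b) 0 = 0"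
        "?l c (z4 a) (z4 b) 0 < 0"
        using at[OF z4, of a] at[OF z4, of b] at[OF z4, of c] by (simp_all add: simps add.assoc)
      show "0 < z5 c" "?l b 0 (z5 b) (z5 c) = 0" "?l c 0 (z5 b) (z5 c) = 0"
        "0 < ?l a 0 (z5 b) (z5 c)"
        using at[OF z5, of a] at[OF z5, of b] at[OF z5, of c] by (simp_all add: simps add.assoc)
    qed simp
  qed
  have chain: "(a, b) \<in> G \<or> (b, a) \<in> G" if ac: "(a, c) \<in> G" and bc: "(b, c) \<in> G" for a b c
  proof (rule ccontr)
    assume nab: "\<not> ((a, b) \<in> G \<or> (b, a) \<in> G)"
    note abc = lt[OF ac] lt[OF bc]
    have ne: "a \<noteq> c" "b \<noteq> c" "a \<noteq> b" using nab ac bc GD(2) abc by auto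
    note rel = ac bc nab[unfolded de_Morgan_disj] anti[OF ac ne(1)] anti[OF bc ne(2)]
      GD(2)[OF abc(1)] GD(2)[OF abc(2)] GD(2)[OF abc(3)] ne ne[symmetric]
    have inst: "\<exists>z. lcp_solution n G N r B z" if "B \<subseteq> {a, b}" for B
      using that abc by (intro sol) auto
    obtain z0 where z0: "lcp_solution n G N r {} z0" using inst[of "{}"] by auto
    obtain z1 where z1: "lcp_solution n G N r {a} z1" using inst[of "{a}"] by auto
    obtain z2 where z2: "lcp_solution n G N r {b} z2" using inst[of "{b}"] by auto
    obtain z3 where z3: "lcp_solution n G N r {a, b} z3" using inst[of "{a, b}"] by auto
    have at: "let w = r j + (\<Sum>i\<in>B. N j i * z i); e = even (card {d \<in> B. (d, j) \<in> G})
       in if j \<in> B then w = 0 \<and> (if e then 0 < z j else z j < 0)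
          else if e then 0 < w else w < 0"
      if "lcp_solution n G N r B z" "j \<in> {a, b, c}" for B z j
      using that abc unfolding lcp_solution_def by blast
    note simps = Let_def card_filter_singleton card_filter_pair rel
    have "0 < r a" "0 < r c" using at[OF z0, of a] at[OF z0, of c] by simp_all
    moreover have "z1 a < 0" "r a + N a a * z1 a = 0" "r c + N c a * z1 a < 0"
      using at[OF z1, of a] at[OF z1, of c] by (simp_all add: simps)
    moreover have "z2 b < 0" "0 < r a + N a b * z2 b" "r c + N c b * z2 b < 0"
      using at[OF z2, of a] at[OF z2, of b] at[OF z2, of c] by (simp_all add: simps)
    moreover have "z3 a < 0" "z3 b < 0" "r a + (N a a * z3 a + N a b * z3 b) = 0"
      "0 < r c + (N c a * z3 a + N c b * z3 b)"
      using at[OF z3, of a] at[OF z3, of b] at[OF z3, of c] by (simp_all add: simps)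
    ultimately show False
      by (intro quadrilateral_infeasible[of "r a" "r c" "- z1 a" "- z2 b" "- z3 a" "- z3 b"
            "N a a" "N c a" "N c b" "N a b"]) simp_all
  qed
  have "trans G" using tr by (blast intro: transI)
  moreover have "antisym G" using anti by (blast intro: antisymI)
  ultimately show ?thesis unfolding forest_order_def using GD(1,2) chain by blast
qed

section \<open>Forest orders from nested parentheses\<close>

definition with_complements :: "nat \<Rightarrow> nat set \<Rightarrow> nat set" where
  "with_complements n A = A \<union> (\<lambda>i. i + n) ` A"

definition strict_descendants :: "(nat \<times> nat) set \<Rightarrow> nat set \<Rightarrow> nat \<Rightarrow> nat set" where
  "strict_descendants G S d = {e \<in> S. e \<noteq> d \<and> (d, e) \<in> G}"

text \<open>
  A depth-first traversal: the pair of a root \<open>r\<close> encloses its descendants \<open>D\<close> and is followed by the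
  rest. By the chain condition no element of the rest has a descendant in \<open>D\<close>.
\<close>

lemma nested_list_exists:
  assumes G: "forest_order n G" and "finite S" "S \<subseteq> {..<n}"
  shows "\<exists>xs. distinct xs \<and> set xs = with_complements n S \<and>
     (\<forall>d\<in>S. \<exists>A I C. xs = A @ d # I @ (d + n) # C \<and> set I = with_complements n (strict_descendants G S d))"
  using assms(2,3)
proof (induction S rule: finite_psubset_induct)
  case (psubset S)
  have GD: "\<And>d. d < n \<Longrightarrow> (d, d) \<in> G" "antisym G" "trans G"
    "\<And>a b c. (a, c) \<in> G \<Longrightarrow> (b, c) \<in> G \<Longrightarrow> (a, b) \<in> G \<or> (b, a) \<in> G"
    using G unfolding forest_order_def by blast+
  show ?case
  proof (cases "S = {}")
    case True
    then show ?thesis by (intro exI[of _ "[]"]) (simp add: with_complements_def)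
  next
    case False
    have "acyclic (G - Id)"
      using forest_order_influence_graph[OF G] by (simp add: influence_graph_def)
    then have "acyclic ((G - Id) \<inter> S \<times> S)" by (rule acyclic_subset) auto
    then have wf: "wf ((G - Id) \<inter> S \<times> S)"
      using psubset.hyps by (intro finite_acyclic_wf) auto
    obtain x where "x \<in> S" using False by blast
    then obtain r where r: "r \<in> S" "\<And>a. (a, r) \<in> (G - Id) \<inter> S \<times> S \<Longrightarrow> a \<notin> S"
      using wfE_min[OF wf] by metis
    then have root: "a = r" if "a \<in> S" "(a, r) \<in> G" for a using that by blast
    define D where "D = {e \<in> S. (r, e) \<in> G}"
    have rD: "r \<in> D" "D \<subseteq> S" using r(1) GD(1) psubset.prems by (auto simp: D_def)
    obtain L1 where L1: "distinct L1" "set L1 = with_complements n (D - {r})"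
      "\<forall>d\<in>D - {r}. \<exists>A I C. L1 = A @ d # I @ (d + n) # C \<and> set I = with_complements n (strict_descendants G (D - {r}) d)"
      using psubset.IH[of "D - {r}"] rD psubset.prems by blast
    obtain L2 where L2: "distinct L2" "set L2 = with_complements n (S - D)"
      "\<forall>d\<in>S - D. \<exists>A I C. L2 = A @ d # I @ (d + n) # C \<and> set I = with_complements n (strict_descendants G (S - D) d)"
      using psubset.IH[of "S - D"] rD psubset.prems by blast
    let ?xs = "r # L1 @ (r + n) # L2"
    have less: "e < n" if "e \<in> S" for e using that psubset.prems by auto
    have with_complements_mem: "e \<in> with_complements n A \<longleftrightarrow> e \<in> A" "e + n \<in> with_complements n A \<longleftrightarrow> e \<in> A"
      if "A \<subseteq> S" "e \<in> S" for e A
      using that less by (fastforce simp: with_complements_def)+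
    have "r \<notin> set L1" "r + n \<notin> set L1" "r \<notin> set L2" "r + n \<notin> set L2"
      unfolding L1(2) L2(2) using with_complements_mem[of "D - {r}" r] with_complements_mem[of "S - D" r] rD r(1) by auto
    moreover have "set L1 \<inter> set L2 = {}"
    proof -
      have "e \<notin> with_complements n (S - D)" if "e \<in> with_complements n (D - {r})" for e
      proof -
        obtain d where d: "d \<in> D - {r}" "e = d \<or> e = d + n" using \<open>e \<in> _\<close> unfolding with_complements_def by blast
        then show ?thesis using with_complements_mem[of "S - D" d] rD by auto
      qed
      then show ?thesis unfolding L1(2) L2(2) by blast
    qed
    moreover have "r + n \<noteq> r" using less[OF r(1)] by simp
    ultimately have "distinct ?xs" using L1(1) L2(1) by simp
    moreover have "set ?xs = with_complements n S"
    proof -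
      have "set ?xs = with_complements n ({r} \<union> (D - {r}) \<union> (S - D))"
        unfolding list.set set_append L1(2) L2(2) with_complements_def by blast
      also have "{r} \<union> (D - {r}) \<union> (S - D) = S" using rD by blast
      finally show ?thesis .
    qed
    moreover have "\<exists>A I C. ?xs = A @ d # I @ (d + n) # C \<and> set I = with_complements n (strict_descendants G S d)"
      if d: "d \<in> S" for d
    proof -
      consider "d = r" | "d \<in> D - {r}" | "d \<in> S - D" using d by blast
      then show ?thesis
      proof cases
        case 1
        have "strict_descendants G S r = D - {r}" by (auto simp: strict_descendants_def D_def)
        then have "?xs = [] @ d # L1 @ (d + n) # L2 \<and> set L1 = with_complements n (strict_descendants G S d)"
          using 1 L1(2) by simp
        then show ?thesis by blast
      next
        case 2
        then obtain A I C where AIC: "L1 = A @ d # I @ (d + n) # C"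
          "set I = with_complements n (strict_descendants G (D - {r}) d)" using L1(3) by blast
        have rd: "(r, d) \<in> G" "d \<noteq> r" using 2 by (auto simp: D_def)
        have "strict_descendants G (D - {r}) d = strict_descendants G S d"
          using rd GD(2,3) by (auto simp: strict_descendants_def D_def dest: transD antisymD)
        then have "?xs = (r # A) @ d # I @ (d + n) # (C @ (r + n) # L2) \<and>
            set I = with_complements n (strict_descendants G S d)" using AIC by simp
        then show ?thesis by blast
      next
        case 3
        then obtain A I C where AIC: "L2 = A @ d # I @ (d + n) # C"
          "set I = with_complements n (strict_descendants G (S - D) d)" using L2(3) by blast
        have "(r, e) \<notin> G" if "(d, e) \<in> G" for e
        proof
          assume "(r, e) \<in> G"
          then have "(r, d) \<in> G \<or> (d, r) \<in> G" using that GD(4) by blast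
          then show False using 3 root[of d] rD(1) by (auto simp: D_def)
        qed
        then have "strict_descendants G (S - D) d = strict_descendants G S d" by (auto simp: strict_descendants_def D_def)
        then have "?xs = (r # L1 @ (r + n) # A) @ d # I @ (d + n) # C \<and>
            set I = with_complements n (strict_descendants G S d)" using AIC by simp
        then show ?thesis by blast
      qed
    qed
    ultimately show ?thesis by blast
  qed
qed

lemma forest_order_positions:
  assumes G: "forest_order n G"
  obtains pos where "bij_betw pos {..<2 * n} {..<2 * n}"
    "\<And>d g. d < n \<Longrightarrow> g < 2 * n \<Longrightarrow>
       pos d < pos g \<and> pos g < pos (d + n) \<longleftrightarrow> g \<in> with_complements n (strict_descendants G {..<n} d)"
    "\<And>d. d < n \<Longrightarrow> pos d < pos (d + n)"
proof -
  obtain xs where xs: "distinct xs" "set xs = with_complements n {..<n}"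
    "\<forall>d\<in>{..<n}. \<exists>A I C. xs = A @ d # I @ (d + n) # C \<and> set I = with_complements n (strict_descendants G {..<n} d)"
    using nested_list_exists[OF G, of "{..<n}"] by auto
  have "with_complements n {..<n} = {..<2 * n}"
  proof (intro equalityI subsetI)
    fix e assume "e \<in> {..<2 * n}"
    then have "e < n \<or> e - n < n \<and> e = e - n + n" by auto
    then show "e \<in> with_complements n {..<n}" unfolding with_complements_def by blast
  qed (auto simp: with_complements_def)
  then have set: "set xs = {..<2 * n}" using xs(2) by simp
  then have len: "length xs = 2 * n" using distinct_card[OF xs(1)] by simp
  have bij: "bij_betw ((!) xs) {..<2 * n} {..<2 * n}"
    by (rule bij_betw_nth[OF xs(1)]) (simp_all add: len set)
  define pos where "pos = inv_into {..<2 * n} ((!) xs)"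
  have bpos: "bij_betw pos {..<2 * n} {..<2 * n}" unfolding pos_def using bij by (rule bij_betw_inv_into)
  have pos_nth: "pos (xs ! i) = i" if "i < 2 * n" for i
    unfolding pos_def using bij that by (simp add: bij_betw_def inv_into_f_f)
  have nth_pos: "xs ! pos g = g" "pos g < 2 * n" if "g < 2 * n" for g
    using bij_betw_inv_into_right[OF bij, of g] bij_betwE[OF bpos] that by (auto simp: pos_def)
  have AIC: "\<exists>a b. pos d = a \<and> pos (d + n) = Suc (a + b) \<and>
      (\<forall>g<2 * n. a < pos g \<and> pos g < Suc (a + b) \<longleftrightarrow> g \<in> with_complements n (strict_descendants G {..<n} d))"
    if d: "d < n" for d
  proof -
    obtain A I C where *: "xs = A @ d # I @ (d + n) # C" "set I = with_complements n (strict_descendants G {..<n} d)"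
      using xs(3) d by blast
    let ?a = "length A" and ?b = "length I"
    have l: "Suc (?a + ?b) < 2 * n" using len by (simp add: *(1))
    have "xs ! ?a = d" "xs ! Suc (?a + ?b) = d + n" by (simp_all add: *(1) nth_append)
    then have "pos d = ?a" "pos (d + n) = Suc (?a + ?b)"
      using pos_nth[of ?a] pos_nth[of "Suc (?a + ?b)"] l by auto
    moreover have "?a < pos g \<and> pos g < Suc (?a + ?b) \<longleftrightarrow> g \<in> set I" if g: "g < 2 * n" for g
    proof
      assume "?a < pos g \<and> pos g < Suc (?a + ?b)"
      then obtain i where i: "pos g = Suc (?a + i)" "i < ?b" using less_imp_Suc_add by fastforce
      then have "xs ! pos g = I ! i" by (simp add: *(1) nth_append)
      then have "g = I ! i" using nth_pos(1)[OF g] by simp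
      then show "g \<in> set I" using i(2) by simp
    next
      assume "g \<in> set I"
      then obtain i where i: "i < ?b" "g = I ! i" by (auto simp: in_set_conv_nth)
      then have "xs ! Suc (?a + i) = g" by (simp add: *(1) nth_append)
      then have "pos g = Suc (?a + i)" using pos_nth[of "Suc (?a + i)"] i l by auto
      then show "?a < pos g \<and> pos g < Suc (?a + ?b)" using i by simp
    qed
    ultimately show ?thesis using *(2) by blast
  qed
  show ?thesis
  proof (rule that[OF bpos])
    fix d g assume "d < n" "g < 2 * n"
    then show "pos d < pos g \<and> pos g < pos (d + n) \<longleftrightarrow> g \<in> with_complements n (strict_descendants G {..<n} d)"
      using AIC[of d] by metis
  next
    fix d assume "d < n" then show "pos d < pos (d + n)" using AIC[of d] by auto
  qed
qed

lemma influenced_by_unique: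
  assumes s: "influenced_by n G s" and t: "influenced_by n G t"
    and eq: "\<And>d. d < n \<Longrightarrow> d \<in> s {} \<longleftrightarrow> d \<in> t {}"
  shows "s = t"
proof (rule PiE_ext)
  show sP: "s \<in> Pow {..<n} \<rightarrow>\<^sub>E Pow {..<n}" and tP: "t \<in> Pow {..<n} \<rightarrow>\<^sub>E Pow {..<n}"
    using s t by (simp_all add: influenced_by_def)
  fix v assume v: "v \<in> Pow {..<n}"
  have "s v \<subseteq> {..<n}" "t v \<subseteq> {..<n}" using PiE_mem[OF sP v] PiE_mem[OF tP v] by auto
  moreover have "d \<in> s v \<longleftrightarrow> d \<in> t v" if "d < n" for d
    using influenced_by_mem[OF s _ that] influenced_by_mem[OF t _ that] eq[OF that] v by blast
  ultimately show "s v = t v" by blast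
qed

section \<open>Extensions and forest orders\<close>

text \<open>
  The extension element is placed to the left of all parentheses, so separation from it means
  enclosure. The set \<open>F\<close> may be chosen freely at the elements \<open>d < n\<close>, and this choice prescribes the
  outmap at the empty vertex; at \<open>d + n\<close> it is then forced by balancedness.
\<close>

lemma forest_order_simple_extension:
  assumes G: "forest_order n G" and s: "influenced_by n G s"
  obtains \<C> \<C>' where "cyclic_P_matroid n \<C>" "simple_extension n \<C> \<C>'" "associated_USO n \<C>' = s"
proof -
  obtain pos where bij: "bij_betw pos {..<2 * n} {..<2 * n}"
    and inside: "\<And>d g. d < n \<Longrightarrow> g < 2 * n \<Longrightarrow>
       pos d < pos g \<and> pos g < pos (d + n) \<longleftrightarrow> g \<in> with_complements n (strict_descendants G {..<n} d)"
    and less: "\<And>d. d < n \<Longrightarrow> pos d < pos (d + n)"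
    by (rule forest_order_positions[OF G]) (rule that)
  let ?q = "2 * n"
  define p where "p e = (if e < 2 * n then pos e else e)" for e
  have p0: "p permutes {..<2 * n}"
  proof (rule bij_imp_permutes)
    have "bij_betw p {..<2 * n} {..<2 * n} = bij_betw pos {..<2 * n} {..<2 * n}"
      by (rule bij_betw_cong) (simp add: p_def)
    then show "bij_betw p {..<2 * n} {..<2 * n}" using bij by simp
  qed (simp add: p_def)
  then have p: "p permutes {..2 * n}" by (rule permutes_subset) auto
  have pq: "p ?q = ?q" by (simp add: p_def)
  define x :: "nat \<Rightarrow> real" where "x e = (if e = ?q then - 1 else real e)" for e
  define k where "k = (\<lambda>e. x (p e))"
  have pos_less: "pos e < 2 * n" if "e < 2 * n" for e using bij_betwE[OF bij] that by auto
  have k: "k e = real (pos e)" if "e < 2 * n" for e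
    using that pos_less[OF that] by (simp add: k_def x_def p_def)
  have kq: "k ?q = - 1" by (simp add: k_def x_def pq)
  have "inj x" by (auto simp: inj_def x_def split: if_splits)
  then have inj: "inj_on k A" for A
    unfolding k_def using permutes_inj[OF p] by (auto simp: inj_on_def inj_def)
  have btw: "between k d (d + n) g \<longleftrightarrow> g \<in> with_complements n (strict_descendants G {..<n} d)" if "d < n" "g < 2 * n" for d g
    using inside[OF that] less[OF that(1)] that by (simp add: between_def k)
  have btw_pair: "between k i (i + n) j \<longleftrightarrow> (i, j) \<in> G" "between k i (i + n) (j + n) \<longleftrightarrow> (i, j) \<in> G"
    if "i < n" "j < n" "i \<noteq> j" for i j
    using that btw[of i j] btw[of i "j + n"] by (auto simp: with_complements_def strict_descendants_def)
  have nc: "noncrossing n k" using btw_pair by (simp add: noncrossing_def)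
  have GD: "G \<subseteq> {..<n} \<times> {..<n}" "\<And>d. d < n \<Longrightarrow> (d, d) \<in> G"
    using G unfolding forest_order_def by blast+
  have chord: "chord_order n k = G"
  proof -
    have "\<not> between k i (i + n) ?q" if "i < n" for i
      using that k[of i] k[of "i + n"] by (simp add: between_def kq)
    then have "(i, j) \<in> chord_order n k \<longleftrightarrow> (i, j) \<in> G" for i j
      using btw_pair[of i j] GD by (auto simp: chord_order_def)
    then show ?thesis by auto
  qed
  \<comment> \<open>Negating both ends of chord \<open>d\<close> switches the outmap in coordinate \<open>d\<close>; \<open>f d\<close> is the choice
    for which the outmap at the empty vertex is that of \<open>s\<close>.\<close>
  define f where "f d \<longleftrightarrow> (d \<in> s {} \<longleftrightarrow> odd (card {j \<in> {..<n}. between k d ?q j}))" for d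
  define F where "F = {d. d < n \<and> f d} \<union>
    {d + n | d. d < n \<and> (odd (card {j \<in> {..<n}. between k d (d + n) j}) \<longleftrightarrow> f d)}"
  have F1: "d \<in> F \<longleftrightarrow> f d" if "d < n" for d using that by (auto simp: F_def)
  have F2: "d + n \<in> F \<longleftrightarrow> (odd (card {j \<in> {..<n}. between k d (d + n) j}) \<longleftrightarrow> f d)" if "d < n" for d
    using that by (auto simp: F_def)
  have Fsub: "F \<subseteq> {..<2 * n}" by (auto simp: F_def)
  have bal: "balanced n k F" unfolding balanced_def using F1 F2 by blast
  define \<C> where "\<C> = realized_om {..<2 * n} n (signed_moment F k)"
  define \<C>' where "\<C>' = realized_om {..2 * n} n (signed_moment F k)"
  have alt: "sorted_wrt (\<lambda>e f. x e < x f) ([] @ [?q] @ [0..<2 * n])"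
    by (auto simp: x_def sorted_wrt_upt intro: sorted_wrt_mono_rel[OF _ sorted_wrt_upt])
  have "is_alternating [0..<2 * n] n (relabel p (reorient F \<C>))"
    unfolding is_alternating_def
  proof (intro exI[of _ x] conjI)
    show "sorted_wrt (\<lambda>e f. x e < x f) [0..<2 * n]" using alt by simp
    have "{0..<2 * n} = {..<2 * n}" by auto
    then show "relabel p (reorient F \<C>) = realized_om (set [0..<2 * n]) n (\<lambda>e j. x e ^ j)"
      unfolding \<C>_def k_def using relabel_reorient_signed_moment[OF p0, of F n x] by simp
  qed
  moreover have "P_matroid n \<C>"
    unfolding \<C>_def by (rule P_matroid_if_noncrossing_balanced[OF inj nc bal])
  ultimately have via: "cyclic_P_matroid_via n p F \<C>"
    unfolding cyclic_P_matroid_via_def using p0 Fsub by blast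
  have "is_alternating ([] @ [?q] @ [0..<2 * n]) n (relabel p (reorient F \<C>'))"
    unfolding is_alternating_def
  proof (intro exI[of _ x] conjI alt)
    have "set ([] @ [?q] @ [0..<2 * n]) = {..2 * n}" by auto
    then show "relabel p (reorient F \<C>') =
        realized_om (set ([] @ [?q] @ [0..<2 * n])) n (\<lambda>e j. x e ^ j)"
      unfolding \<C>'_def k_def using relabel_reorient_signed_moment[OF p, of F n x] by simp
  qed
  moreover have "F \<inter> {..<2 * n} = F" "F \<subseteq> {..2 * n}" using Fsub by auto
  moreover have "oriented_matroid {..2 * n} \<C>'"
    unfolding \<C>'_def by (rule oriented_matroid_realized_om) simp
  moreover have "\<C> = om_restrict \<C>' {..<2 * n}"
    unfolding \<C>_def \<C>'_def by (rule om_restrict_realized_om[symmetric]) auto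
  ultimately have "simple_extension n \<C> \<C>'"
    unfolding simple_extension_def using p pq via append_Nil[of "[0..<2 * n]"] by metis
  moreover have "cyclic_P_matroid n \<C>" using via by (auto simp: cyclic_P_matroid_def)
  moreover have "associated_USO n \<C>' = s"
  proof (rule influenced_by_unique[OF _ s])
    show "influenced_by n G (associated_USO n \<C>')"
      using associated_USO_influenced[OF inj nc bal] by (simp add: chord \<C>'_def)
    fix d assume d: "d < n"
    have "pair_choice n {} j = j" for j by (simp add: pair_choice_def)
    moreover have "?q \<notin> F" using Fsub by auto
    ultimately show "d \<in> associated_USO n \<C>' {} \<longleftrightarrow> d \<in> s {}"
      using associated_USO_mem[OF inj _ d, of "{}" F] F1[OF d] by (auto simp: \<C>'_def f_def)
  qed
  ultimately show ?thesis by (intro that) auto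
qed

lemma sorted_wrt_imp_inj_on:
  fixes x :: "'a \<Rightarrow> real"
  assumes "sorted_wrt (\<lambda>e f. x e < x f) xs"
  shows "inj_on x (set xs)"
  using assms
proof (induction xs)
  case (Cons a xs)
  then have "x a < x f" if "f \<in> set xs" for f using that by simp
  then have "x a \<notin> x ` set xs" by fastforce
  then show ?case using Cons by (auto simp: inj_on_insert)
qed simp

lemma simple_extension_imp_forest_order:
  assumes ext: "simple_extension n \<C> \<C>'"
  obtains G where "forest_order n G" "influenced_by n G (associated_USO n \<C>')"
proof -
  obtain p F ys zs x where p: "p permutes {..2 * n}" and yz: "ys @ zs = [0..<2 * n]"
    and x: "sorted_wrt (\<lambda>e f. x e < (x f :: real)) (ys @ [2 * n] @ zs)"
    and eq: "relabel p (reorient F \<C>') = realized_om (set (ys @ [2 * n] @ zs)) n (\<lambda>e j. x e ^ j)"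
    and P: "P_matroid n \<C>" and res: "\<C> = om_restrict \<C>' {..<2 * n}"
    using ext unfolding simple_extension_def is_alternating_def cyclic_P_matroid_via_def
    by (elim exE conjE) (rule that)
  have "set ys \<union> set zs = {..<2 * n}"
    using arg_cong[OF yz, of set] by (simp add: atLeast0LessThan)
  moreover have "set (ys @ [2 * n] @ zs) = insert (2 * n) (set ys \<union> set zs)" by simp
  moreover have "insert (2 * n) {..<2 * n} = {..2 * n}" by auto
  ultimately have set: "set (ys @ [2 * n] @ zs) = {..2 * n}" by simp
  define k where "k = (\<lambda>e. x (p e))"
  have C': "\<C>' = realized_om {..2 * n} n (signed_moment F k)"
    using eq unfolding set relabel_reorient_eq_moment_iff[OF p] k_def .
  have "inj_on x {..2 * n}" using sorted_wrt_imp_inj_on[OF x] by (simp only: set)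
  then have inj: "inj_on k {..2 * n}"
    unfolding k_def using permutes_inj[OF p] permutes_in_image[OF p] by (auto simp: inj_on_def inj_def)
  then have inj0: "inj_on k {..<2 * n}" by (rule inj_on_subset) auto
  have "\<C> = realized_om {..<2 * n} n (signed_moment F k)"
    unfolding res C' by (rule om_restrict_realized_om) auto
  then have ncb: "noncrossing n k" "balanced n k F"
    using P_matroid_imp_noncrossing_balanced[OF inj0] P by simp_all
  show ?thesis
    using that[OF forest_order_chord_order[OF inj ncb(1)]] associated_USO_influenced[OF inj ncb]
    by (simp add: C')
qed

theorem theorem4p9:
  fixes n :: nat
  assumes "n \<ge> 1"
  shows "{associated_USO n \<C>' | \<C> \<C>'. cyclic_P_matroid n \<C> \<and> simple_extension n \<C> \<C>'} =
         {s. matousek_type_USO n s \<and> realizable_USO n s}"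
proof (intro equalityI subsetI)
  fix s assume "s \<in> {associated_USO n \<C>' | \<C> \<C>'. cyclic_P_matroid n \<C> \<and> simple_extension n \<C> \<C>'}"
  then obtain \<C> \<C>' where s: "s = associated_USO n \<C>'" and "simple_extension n \<C> \<C>'" by blast
  then obtain G where G: "forest_order n G" "influenced_by n G s"
    using simple_extension_imp_forest_order by blast
  then show "s \<in> {s. matousek_type_USO n s \<and> realizable_USO n s}"
    using matousek_type_USO_if_influenced_by[OF forest_order_influence_graph] forest_order_realizable
    by blast
next
  fix s assume s: "s \<in> {s. matousek_type_USO n s \<and> realizable_USO n s}"
  then obtain G where "influence_graph n G" "influenced_by n G s"
    using influenced_by_if_matousek_type_USO by blast
  moreover from this have "forest_order n G" using realizable_imp_forest_order s by blast
  ultimately obtain \<C> \<C>' where "cyclic_P_matroid n \<C>" "simple_extension n \<C> \<C>'"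
    "associated_USO n \<C>' = s" using forest_order_simple_extension by blast
  then show "s \<in> {associated_USO n \<C>' | \<C> \<C>'. cyclic_P_matroid n \<C> \<and> simple_extension n \<C> \<C>'}"
    by blast
qed

end
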